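(* Assume conditions (A1), (A2) and (A3) stated in the context. Then the least squares estimator $\hat{\theta}_{n,\varepsilon}$ is consistent: $\hat{\theta}_{n,\varepsilon}\to\theta_0$ in $P_{\theta_0}$-probability as $\varepsilon\to 0$ and $n\to\infty$.
   Context: Lévy process. On a filtered probability space $(\Omega,\mathcal F,\mathbb P)$ with right-continuous increasing filtration $(\mathcal F_t)_{t\ge 0}$, let $(L_t)_{t\ge0}$ be the $\mathbb R^d$-valued Lévy process $$L_t=at+\sigma B_t+\int_0^t\int_{|z|\le 1}z\,\tilde N(ds,dz)+\int_0^t\int_{|z|>1}z\,N(ds,dz),$$ where $a\in\mathbb R^d$, $\sigma=(\sigma_{ij})$ is a real $d\times r$ matrix, $B=(B^1,\dots,B^r)$ is a standard $r$-dimensional Brownian motion, $N$ is a Poisson random measure on $\mathbb R_+\times(\mathbb R^d\setminus\{0\})$, independent of $B$, with characteristic (intensity) measure $dt\,\nu(dz)$, $\tilde N(ds,dz)=N(ds,dz)-ds\,\nu(dz)$, and $\nu$ is a Lévy measure, i.e. $\int_{\mathbb R^d\setminus\{0\}}(|z|^2\wedge1)\,\nu(dz)<\infty$. No moment condition is imposed on $L$. Model. $\Theta=\bar\Theta_0$ is the closure of an open bounded convex set $\Theta_0\subset\mathbb R^p$, $b=(b_1,\dots,b_d):\mathbb R^d\times\Theta\to\mathbb R^d$ is a known function, $x_0\in\mathbb R^d$, $\varepsilon\in(0,1]$, and $\theta_0\in\Theta_0$ is the true parameter value. Under the true parameter, $X$ (which depends on $\varepsilon$) is the unique strong solution of $dX_t=b(X_t,\theta_0)\,dt+\varepsilon\,dL_t$,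 $t\in[0,1]$, $X_0=x_0$; $P_{\theta_0}$ denotes the underlying probability when the parameter value is $\theta_0$. The process is observed at $t_k=k/n$, $k=1,\dots,n$ (with $t_0=0$), and $\Delta t_{k-1}=t_k-t_{k-1}=1/n$. The deterministic function $X^0$ solves $dX^0_t=b(X^0_t,\theta_0)\,dt$, $X^0_0=x_0$. The limit $\varepsilon\to0$, $n\to\infty$ is taken simultaneously. Least squares estimator. $\hat\theta_{n,\varepsilon}:=\arg\min_{\theta\in\Theta}\Psi_{n,\varepsilon}(\theta)$, where $$\Psi_{n,\varepsilon}(\theta)=\sum_{k=1}^n\frac{|X_{t_k}-X_{t_{k-1}}-b(X_{t_{k-1}},\theta)\,\Delta t_{k-1}|^2}{\varepsilon^2\,\Delta t_{k-1}}.$$ Function classes. $C^{k,l}(\mathbb R^d\times\Theta;\mathbb R)$ is the space of functions $f:\mathbb R^d\times\Theta\to\mathbb R$ that are $k$ times continuously differentiable in $x$ and $l$ times continuously differentiable in $\theta$. $C^{k,l}_\uparrow(\mathbb R^d\times\Theta;\mathbb R)$ is the class of $f\in C^{k,l}(\mathbb R^d\times\Theta;\mathbb R)$ such that, for universal positive constants $C,\lambda$, $\sup_{\theta\in\Theta}|\partial_\theta^\alpha\partial_x^\beta f(x,\theta)|\le C(1+|x|)^\lambda$ for all $x$ and all multi-indices $\alpha=(\alpha_1,\dots,\alpha_p)$, $\beta=(\beta_1,\dots,\beta_d)$ with $0\le\sum_i\alpha_i\le l$ and $0\le\sum_i\beta_i\le k$. Conditions. (A1) There is a constant $K_0>0$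 such that $|b(x,\theta)-b(y,\theta)|\le K_0|x-y|$ and $|b(x,\theta)|\le K_0(1+|x|)$ for all $x,y\in\mathbb R^d$, $\theta\in\Theta$. (A2) Each component $b_i$ of $b$ belongs to $C^{2,3}_\uparrow(\mathbb R^d\times\Theta;\mathbb R)$. (A3) For $\theta\in\Theta$: $\theta\ne\theta_0$ if and only if $b(X^0_t,\theta)\ne b(X^0_t,\theta_0)$ for at least one $t\in[0,1]$. *)

theory Defs
  imports "HOL-Probability.Probability"
begin

section \<open>Filtered spaces and the driving noise\<close>

text \<open>
  Time is indexed by \<^typ>\<open>real\<close>, but only times \<open>t \<ge> 0\<close> matter; the values of a filtration or of a
  process at negative times carry no information. Only the \<open>\<sigma>\<close>-algebra of \<open>F t\<close> is used.
\<close>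

definition filtered_prob_space :: "'w measure \<Rightarrow> (real \<Rightarrow> 'w measure) \<Rightarrow> bool" where
  "filtered_prob_space M F \<longleftrightarrow>
     prob_space M \<and> filtration (space M) F \<and> (\<forall>t. subalgebra M (F t)) \<and>
     (\<forall>t\<ge>0. sets (F t) = (\<Inter>u\<in>{t<..}. sets (F u)))"

definition adapted_on :: "real set \<Rightarrow> (real \<Rightarrow> 'w measure) \<Rightarrow> (real \<Rightarrow> 'w \<Rightarrow> 'a::topological_space) \<Rightarrow> bool" where
  "adapted_on T F Y \<longleftrightarrow> (\<forall>t\<in>T. Y t \<in> borel_measurable (F t))"

definition cadlag_on :: "real set \<Rightarrow> (real \<Rightarrow> 'a::topological_space) \<Rightarrow> bool" where
  "cadlag_on T f \<longleftrightarrow>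
     (\<forall>t\<in>T. (f \<longlongrightarrow> f t) (at t within (T \<inter> {t<..})) \<and> (\<exists>l. (f \<longlongrightarrow> l) (at t within (T \<inter> {..<t}))))"

definition generated_sets :: "'w measure \<Rightarrow> ('i \<Rightarrow> 'w \<Rightarrow> 'a::topological_space) \<Rightarrow> 'i set \<Rightarrow> 'w set set" where
  "generated_sets M Z I = sigma_sets (space M) {Z i -` C \<inter> space M | i C. i \<in> I \<and> C \<in> sets borel}"

definition brownian_motion ::
    "'w measure \<Rightarrow> (real \<Rightarrow> 'w measure) \<Rightarrow> (real \<Rightarrow> 'w \<Rightarrow> real ^ 'r) \<Rightarrow> bool" where
  "brownian_motion M F B \<longleftrightarrow>
     adapted_on {0..} F B \<and>
     (AE \<omega> in M. B 0 \<omega> = 0) \<and>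
     (AE \<omega> in M. continuous_on {0..} (\<lambda>t. B t \<omega>)) \<and>
     (\<forall>s t. 0 \<le> s \<and> s < t \<longrightarrow>
        (\<forall>i. distributed M lborel (\<lambda>\<omega>. (B t \<omega> - B s \<omega>) $ i) (normal_density 0 (sqrt (t - s)))) \<and>
        prob_space.indep_vars M (\<lambda>_. borel) (\<lambda>i \<omega>. (B t \<omega> - B s \<omega>) $ i) UNIV \<and>
        prob_space.indep_set M (sets (F s)) (generated_sets M (\<lambda>u \<omega>. B u \<omega> - B s \<omega>) {t}))"

definition levy_measure :: "(real ^ 'd) measure \<Rightarrow> bool" where
  "levy_measure \<nu> \<longleftrightarrow>
     sets \<nu> = sets (restrict_space borel (- {0})) \<and>
     (\<integral>\<^sup>+ z. ennreal (min ((norm z)\<^sup>2) 1) \<partial>\<nu>) < \<infinity>"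

text \<open>The measure \<open>dt \<nu>(dz)\<close>; its underlying space is \<open>{0..} \<times> - {0}\<close>.\<close>

definition jump_intensity :: "(real ^ 'd) measure \<Rightarrow> (real \<times> (real ^ 'd)) measure" where
  "jump_intensity \<nu> = restrict_space lborel {0..} \<Otimes>\<^sub>M \<nu>"

text \<open>
  The Poisson weights are written out, instead of using \<^const>\<open>poisson_pmf\<close>, because the latter
  requires a positive rate and here \<open>\<mu> A = 0\<close> is allowed.
\<close>

definition poisson_random_measure :: "'w measure \<Rightarrow> 'x measure \<Rightarrow> ('w \<Rightarrow> 'x measure) \<Rightarrow> bool" where
  "poisson_random_measure M \<mu> N \<longleftrightarrow>
     (\<forall>\<omega>\<in>space M. sets (N \<omega>) = sets \<mu> \<and> (\<forall>A\<in>sets \<mu>. emeasure (N \<omega>) A \<in> range ennreal_of_enat)) \<and>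
     (\<forall>A\<in>sets \<mu>. (\<lambda>\<omega>. emeasure (N \<omega>) A) \<in> borel_measurable M) \<and>
     (\<forall>A\<in>sets \<mu>. emeasure \<mu> A < \<infinity> \<longrightarrow>
        (\<forall>k::nat. measure M {\<omega>\<in>space M. emeasure (N \<omega>) A = of_nat k} =
           measure \<mu> A ^ k / fact k * exp (- measure \<mu> A))) \<and>
     (\<forall>A\<in>sets \<mu>. emeasure \<mu> A = \<infinity> \<longrightarrow> (AE \<omega> in M. emeasure (N \<omega>) A = \<infinity>)) \<and>
     (\<forall>A :: nat \<Rightarrow> 'x set. range A \<subseteq> sets \<mu> \<and> disjoint_family A \<longrightarrow>
        prob_space.indep_vars M (\<lambda>_. borel) (\<lambda>i \<omega>. emeasure (N \<omega>) (A i)) UNIV)"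

text \<open>Compatibility of a Poisson random measure on \<open>{0..} \<times> E\<close> with the filtration.\<close>

definition filtration_compatible ::
    "'w measure \<Rightarrow> (real \<Rightarrow> 'w measure) \<Rightarrow> (real \<times> 'e) measure \<Rightarrow> ('w \<Rightarrow> (real \<times> 'e) measure) \<Rightarrow> bool" where
  "filtration_compatible M F \<mu> N \<longleftrightarrow>
     (\<forall>t\<ge>0. \<forall>A\<in>sets \<mu>. A \<subseteq> {..t} \<times> UNIV \<longrightarrow> (\<lambda>\<omega>. emeasure (N \<omega>) A) \<in> borel_measurable (F t)) \<and>
     (\<forall>s\<ge>0. prob_space.indep_set M (sets (F s))
        (generated_sets M (\<lambda>A \<omega>. emeasure (N \<omega>) A) {A \<in> sets \<mu>. A \<subseteq> {s<..} \<times> UNIV}))"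

text \<open>
  \<open>J t\<close> is the compensated integral of \<open>z\<close> over \<open>(0, t] \<times> {z. \<bar>z\<bar> \<le> 1}\<close>: the limit in \<open>L\<^sup>2\<close>, as \<open>\<delta>\<close>
  decreases to \<open>0\<close>, of the integrals over \<open>\<delta> < \<bar>z\<bar> \<le> 1\<close>. On that region the intensity is finite, so
  the integral against \<open>N(ds,dz) - ds \<nu>(dz)\<close> is an ordinary difference of two Lebesgue integrals.
\<close>

definition compensated_jumps ::
    "(real ^ 'd) measure \<Rightarrow> ('w \<Rightarrow> (real \<times> (real ^ 'd)) measure) \<Rightarrow> real \<Rightarrow> real \<Rightarrow> 'w \<Rightarrow> real ^ 'd" where
  "compensated_jumps \<nu> N \<delta> t \<omega> =
     (LINT q : {0<..t} \<times> {z. \<delta> < norm z \<and> norm z \<le> 1} | N \<omega>. snd q)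
     - t *\<^sub>R (LINT z : {z. \<delta> < norm z \<and> norm z \<le> 1} | \<nu>. z)"

definition is_compensated_small_jump_integral ::
    "'w measure \<Rightarrow> (real ^ 'd) measure \<Rightarrow> ('w \<Rightarrow> (real \<times> (real ^ 'd)) measure) \<Rightarrow>
     (real \<Rightarrow> 'w \<Rightarrow> real ^ 'd) \<Rightarrow> bool" where
  "is_compensated_small_jump_integral M \<nu> N J \<longleftrightarrow>
     (\<forall>t\<ge>0. J t \<in> borel_measurable M \<and>
        ((\<lambda>\<delta>. \<integral>\<^sup>+ \<omega>. ennreal ((norm (J t \<omega> - compensated_jumps \<nu> N \<delta> t \<omega>))\<^sup>2) \<partial>M) \<longlongrightarrow> 0) (at_right 0)) \<and>
     (AE \<omega> in M. cadlag_on {0..} (\<lambda>t. J t \<omega>))"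

definition levy_process ::
    "'w measure \<Rightarrow> (real \<Rightarrow> 'w measure) \<Rightarrow> real ^ 'd \<Rightarrow> real ^ 'r ^ 'd \<Rightarrow> (real \<Rightarrow> 'w \<Rightarrow> real ^ 'r) \<Rightarrow>
     (real ^ 'd) measure \<Rightarrow> ('w \<Rightarrow> (real \<times> (real ^ 'd)) measure) \<Rightarrow> (real \<Rightarrow> 'w \<Rightarrow> real ^ 'd) \<Rightarrow> bool" where
  "levy_process M F a \<sigma> B \<nu> N L \<longleftrightarrow>
     brownian_motion M F B \<and>
     levy_measure \<nu> \<and>
     poisson_random_measure M (jump_intensity \<nu>) N \<and>
     filtration_compatible M F (jump_intensity \<nu>) N \<and>
     prob_space.indep_set M (generated_sets M B {0..})
       (generated_sets M (\<lambda>A \<omega>. emeasure (N \<omega>) A) (sets (jump_intensity \<nu>))) \<and>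
     adapted_on {0..} F L \<and>
     (\<exists>J. is_compensated_small_jump_integral M \<nu> N J \<and>
        (AE \<omega> in M. \<forall>t\<ge>0. L t \<omega> =
           t *\<^sub>R a + \<sigma> *v B t \<omega> + J t \<omega> + (LINT q : {0<..t} \<times> {z. 1 < norm z} | N \<omega>. snd q)))"

section \<open>The model and the estimator\<close>

definition sde_solution ::
    "'w measure \<Rightarrow> (real \<Rightarrow> 'w measure) \<Rightarrow> (real ^ 'd \<Rightarrow> real ^ 'd) \<Rightarrow> real ^ 'd \<Rightarrow> real \<Rightarrow>
     (real \<Rightarrow> 'w \<Rightarrow> real ^ 'd) \<Rightarrow> (real \<Rightarrow> 'w \<Rightarrow> real ^ 'd) \<Rightarrow> bool" where
  "sde_solution M F drift x\<^sub>0 \<epsilon> L X \<longleftrightarrow>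
     adapted_on {0..1} F X \<and>
     (AE \<omega> in M. cadlag_on {0..1} (\<lambda>t. X t \<omega>)) \<and>
     (AE \<omega> in M. \<forall>t\<in>{0..1}.
        (\<lambda>s. drift (X s \<omega>)) integrable_on {0..t} \<and>
        X t \<omega> = x\<^sub>0 + integral {0..t} (\<lambda>s. drift (X s \<omega>)) + \<epsilon> *\<^sub>R L t \<omega>)"

definition ode_solution :: "(real ^ 'd \<Rightarrow> real ^ 'd) \<Rightarrow> real ^ 'd \<Rightarrow> (real \<Rightarrow> real ^ 'd) \<Rightarrow> bool" where
  "ode_solution drift x\<^sub>0 Y \<longleftrightarrow>
     Y 0 = x\<^sub>0 \<and> (\<forall>t\<in>{0..1}. (Y has_vector_derivative drift (Y t)) (at t within {0..1}))"

definition contrast ::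
    "(real ^ 'd \<Rightarrow> real ^ 'p \<Rightarrow> real ^ 'd) \<Rightarrow> nat \<Rightarrow> real \<Rightarrow> (real \<Rightarrow> real ^ 'd) \<Rightarrow> real ^ 'p \<Rightarrow> real" where
  "contrast b n \<epsilon> x \<theta> =
     (\<Sum>k = 1..n.
        (norm (x (real k / real n) - x (real (k - 1) / real n)
           - (1 / real n) *\<^sub>R b (x (real (k - 1) / real n)) \<theta>))\<^sup>2 / (\<epsilon>\<^sup>2 * (1 / real n)))"

definition least_squares_estimator ::
    "'w measure \<Rightarrow> (real ^ 'd \<Rightarrow> real ^ 'p \<Rightarrow> real ^ 'd) \<Rightarrow> (real ^ 'p) set \<Rightarrow> nat \<Rightarrow> real \<Rightarrow>
     (real \<Rightarrow> 'w \<Rightarrow> real ^ 'd) \<Rightarrow> ('w \<Rightarrow> real ^ 'p) \<Rightarrow> bool" where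
  "least_squares_estimator M b \<Theta> n \<epsilon> X est \<longleftrightarrow>
     est \<in> borel_measurable M \<and>
     (\<forall>\<omega>\<in>space M. is_arg_min (contrast b n \<epsilon> (\<lambda>t. X t \<omega>)) (\<lambda>\<theta>. \<theta> \<in> \<Theta>) (est \<omega>))"

definition tendsto_in_prob ::
    "'w measure \<Rightarrow> ('i \<Rightarrow> 'w \<Rightarrow> 'a::metric_space) \<Rightarrow> 'a \<Rightarrow> 'i filter \<Rightarrow> bool" where
  "tendsto_in_prob M Y c G \<longleftrightarrow>
     (\<forall>\<delta>>0. ((\<lambda>i. measure M {\<omega>\<in>space M. \<delta> < dist (Y i \<omega>) c}) \<longlongrightarrow> 0) G)"

section \<open>Function classes and conditions\<close>

text \<open>
  \<open>D \<alpha> \<beta>\<close> plays the role of \<open>\<partial>\<^sub>\<theta>\<^sup>\<alpha> \<partial>\<^sub>x\<^sup>\<beta> f\<close> for multi-indices \<open>\<alpha>\<close>, \<open>\<beta>\<close>, the \<open>x\<close>-derivatives being taken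
  first. At boundary points of \<open>\<Theta>\<close> the coordinate directions may leave \<open>\<Theta>\<close>, so the \<open>\<theta>\<close>-derivatives
  are taken in the interior and are required to extend continuously to \<open>\<Theta>\<close>. If \<open>\<Theta>\<close> is the closure
  of its interior, this determines \<open>D \<alpha> \<beta>\<close> on \<open>UNIV \<times> \<Theta>\<close> for the orders considered.
\<close>

definition partial_derivatives ::
    "nat \<Rightarrow> nat \<Rightarrow> (real ^ 'p) set \<Rightarrow> (real ^ 'd \<Rightarrow> real ^ 'p \<Rightarrow> real) \<Rightarrow>
     (('p \<Rightarrow> nat) \<Rightarrow> ('d \<Rightarrow> nat) \<Rightarrow> real ^ 'd \<Rightarrow> real ^ 'p \<Rightarrow> real) \<Rightarrow> bool" where
  "partial_derivatives k l \<Theta> f D \<longleftrightarrow>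
     (\<forall>x. \<forall>\<theta>\<in>\<Theta>. D (\<lambda>_. 0) (\<lambda>_. 0) x \<theta> = f x \<theta>) \<and>
     (\<forall>\<beta> i x. \<forall>\<theta>\<in>\<Theta>. sum \<beta> UNIV < k \<longrightarrow>
        ((\<lambda>h. D (\<lambda>_. 0) \<beta> (x + h *\<^sub>R axis i 1) \<theta>) has_real_derivative
           D (\<lambda>_. 0) (\<beta>(i := Suc (\<beta> i))) x \<theta>) (at 0)) \<and>
     (\<forall>\<alpha> \<beta> j x. \<forall>\<theta>\<in>interior \<Theta>. sum \<alpha> UNIV < l \<and> sum \<beta> UNIV \<le> k \<longrightarrow>
        ((\<lambda>h. D \<alpha> \<beta> x (\<theta> + h *\<^sub>R axis j 1)) has_real_derivative
           D (\<alpha>(j := Suc (\<alpha> j))) \<beta> x \<theta>) (at 0)) \<and>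
     (\<forall>\<alpha> \<beta>. sum \<alpha> UNIV \<le> l \<and> sum \<beta> UNIV \<le> k \<longrightarrow>
        continuous_on (UNIV \<times> \<Theta>) (\<lambda>(x, \<theta>). D \<alpha> \<beta> x \<theta>))"

definition C_poly_growth :: "nat \<Rightarrow> nat \<Rightarrow> (real ^ 'p) set \<Rightarrow> (real ^ 'd \<Rightarrow> real ^ 'p \<Rightarrow> real) set" where
  "C_poly_growth k l \<Theta> = {f. \<exists>D. partial_derivatives k l \<Theta> f D \<and>
     (\<exists>C>0. \<exists>r>0. \<forall>\<alpha> \<beta>. sum \<alpha> UNIV \<le> l \<and> sum \<beta> UNIV \<le> k \<longrightarrow>
        (\<forall>x. \<forall>\<theta>\<in>\<Theta>. \<bar>D \<alpha> \<beta> x \<theta>\<bar> \<le> C * (1 + norm x) powr r))}"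

definition condition_A1 :: "(real ^ 'd \<Rightarrow> real ^ 'p \<Rightarrow> real ^ 'd) \<Rightarrow> (real ^ 'p) set \<Rightarrow> bool" where
  "condition_A1 b \<Theta> \<longleftrightarrow>
     (\<exists>K>0. \<forall>x y. \<forall>\<theta>\<in>\<Theta>. norm (b x \<theta> - b y \<theta>) \<le> K * norm (x - y) \<and> norm (b x \<theta>) \<le> K * (1 + norm x))"

definition condition_A2 :: "(real ^ 'd \<Rightarrow> real ^ 'p \<Rightarrow> real ^ 'd) \<Rightarrow> (real ^ 'p) set \<Rightarrow> bool" where
  "condition_A2 b \<Theta> \<longleftrightarrow> (\<forall>i. (\<lambda>x \<theta>. b x \<theta> $ i) \<in> C_poly_growth 2 3 \<Theta>)"

definition condition_A3 ::
    "(real ^ 'd \<Rightarrow> real ^ 'p \<Rightarrow> real ^ 'd) \<Rightarrow> (real ^ 'p) set \<Rightarrow> real ^ 'p \<Rightarrow> (real \<Rightarrow> real ^ 'd) \<Rightarrow> bool" where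
  "condition_A3 b \<Theta> \<theta>\<^sub>0 Y \<longleftrightarrow>
     (\<forall>\<theta>\<in>\<Theta>. \<theta> \<noteq> \<theta>\<^sub>0 \<longleftrightarrow> (\<exists>t\<in>{0..1}. b (Y t) \<theta> \<noteq> b (Y t) \<theta>\<^sub>0))"

end

theory Submission
  imports Defs
begin

text \<open>
  Off an event of small probability \<open>L\<close> is bounded by some \<open>R\<close> on \<open>{0..1}\<close>, and then Gronwall gives
  \<open>\<bar>X\<^sub>t - X\<^sup>0\<^sub>t\<bar> \<le> C R \<epsilon>\<close>. Comparing the contrast at its minimiser \<open>\<theta>\<close> with its value at \<open>\<theta>\<^sub>0\<close> yields
  \<open>\<integral>\<^sub>0\<^sup>1 \<bar>b(X\<^sup>0\<^sub>s,\<theta>) - b(X\<^sup>0\<^sub>s,\<theta>\<^sub>0)\<bar>\<^sup>2 ds \<le> C (\<epsilon> + 1/n) + 2 \<epsilon> \<bar>\<Sum>\<^sub>k (b(X\<^sub>k,\<theta>) - b(X\<^sub>k,\<theta>\<^sub>0)) \<bullet> (L\<^sub>k\<^sub>+\<^sub>1 - L\<^sub>k)\<bar>\<close>,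
  while by (A3) and compactness the left side is bounded away from \<open>0\<close> outside a ball around \<open>\<theta>\<^sub>0\<close>. Since
  \<open>\<epsilon>\<close> and \<open>1/n\<close> are unrelated, the last sum must be bounded in probability uniformly in \<open>\<theta>\<close>, \<open>n\<close> and \<open>\<epsilon>\<close>.
  The drift and the large jumps have finite variation. The Brownian part and the compensated small jumps
  have increments with exponential moments, so the sum has subexponential increments in \<open>\<theta>\<close> and
  chaining over \<open>\<Theta>\<close> applies.
\<close>

section \<open>Exponential moments of martingale transforms\<close>

text \<open>The minimiser depends on the whole path, so the weights it produces are not adapted and
  no martingale bound applies to them. The sum is therefore controlled for all \<theta> at once,
  with adapted weights for each fixed \<theta>, and the minimiser is inserted only at the end.
  Bounding the sum by the variation of \<open>L\<close> along the grid is no alternative: the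
  Brownian variation grows like sqrt n, and nothing is known about the size of \<epsilon> sqrt n.
  Exponential moments avoid this growth, since a time step 1/n costs a factor exp (C/n) and all n
  steps together cost exp C. Only jumps of norm at most 1 enter these moments, so no moments of
  \<open>L\<close> are required. A second obstacle is that the Lipschitz constant of
  \<open>b\<close> in \<theta> grows with the state. It is uniform only on balls, so the weights are
  cut off outside a ball, and the states \<open>X\<close> are shown to stay in that ball off a small
  event.\<close>

lemma (in prob_space) nn_integral_exp_indep:
  fixes D Y :: "'a \<Rightarrow> real" and g :: "'a \<Rightarrow> ennreal"
  assumes sub: "subalgebra M G"
    and D[measurable]: "D \<in> borel_measurable M"
    and indep: "indep_set (sets G) {D -` C \<inter> space M | C. C \<in> sets borel}"
    and g[measurable]: "g \<in> borel_measurable G" and Y[measurable]: "Y \<in> borel_measurable G"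
    and Y1: "\<And>\<omega>. \<omega> \<in> space M \<Longrightarrow> \<bar>Y \<omega>\<bar> \<le> 1"
    and mgf: "\<And>u. \<bar>u\<bar> \<le> 1 \<Longrightarrow> (\<integral>\<^sup>+ \<omega>. ennreal (exp (u * D \<omega>)) \<partial>M) \<le> K"
  shows "(\<integral>\<^sup>+ \<omega>. g \<omega> * ennreal (exp (Y \<omega> * D \<omega>)) \<partial>M) \<le> K * (\<integral>\<^sup>+ \<omega>. g \<omega> \<partial>M)"
proof -
  have sp: "space G = space M" and sG: "sets G \<subseteq> sets M" using sub by (auto simp: subalgebra_def)
  have id[measurable]: "(\<lambda>\<omega>. \<omega>) \<in> measurable M G"
    using measurable_from_subalg[OF sub measurable_ident] by (simp add: id_def)
  interpret D: prob_space "distr M borel D" by (rule prob_space_distr) simp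
  interpret G': prob_space "distr M G (\<lambda>\<omega>. \<omega>)" by (rule prob_space_distr) simp
  \<comment> \<open>Independence makes the joint law of the identity into \<open>G\<close> and of
    \<open>D\<close> a product; rectangles suffice to check this. Fubini then allows
    \<open>g\<close> and \<open>Y\<close> to be frozen while \<open>D\<close> is integrated, without
    conditional expectations.\<close>
  have dist: "distr M G (\<lambda>\<omega>. \<omega>) \<Otimes>\<^sub>M distr M borel D = distr M (G \<Otimes>\<^sub>M borel) (\<lambda>x. (x, D x))"
  proof (rule pair_measure_eqI)
    fix A B assume "A \<in> sets (distr M G (\<lambda>\<omega>. \<omega>))" "B \<in> sets (distr M borel D)"
    then have A: "A \<in> sets G" and B[measurable]: "B \<in> sets borel" by simp_all
    then have A'[measurable]: "A \<in> sets M" using sG by auto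
    have "prob (A \<inter> (D -` B \<inter> space M)) = prob A * prob (D -` B \<inter> space M)"
      using indep_setD[OF indep A] B by blast
    moreover have "(\<lambda>x. (x, D x)) -` (A \<times> B) \<inter> space M = A \<inter> (D -` B \<inter> space M)" by auto
    moreover have "A \<inter> space M = A" using sets.sets_into_space[OF A'] by auto
    ultimately show "emeasure (distr M G (\<lambda>\<omega>. \<omega>)) A * emeasure (distr M borel D) B =
        emeasure (distr M (G \<Otimes>\<^sub>M borel) (\<lambda>x. (x, D x))) (A \<times> B)"
      using A B by (simp add: emeasure_distr emeasure_eq_measure flip: ennreal_mult)
  qed (auto intro: sets_pair_measure_cong D.sigma_finite_measure_axioms G'.sigma_finite_measure_axioms)
  have [measurable]: "g \<in> borel_measurable (distr M G (\<lambda>\<omega>. \<omega>))" "Y \<in> borel_measurable (distr M G (\<lambda>\<omega>. \<omega>))"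
    by simp_all
  have "(\<integral>\<^sup>+ \<omega>. g \<omega> * ennreal (exp (Y \<omega> * D \<omega>)) \<partial>M)
      = (\<integral>\<^sup>+ q. g (fst q) * ennreal (exp (Y (fst q) * snd q)) \<partial>distr M (G \<Otimes>\<^sub>M borel) (\<lambda>x. (x, D x)))"
    by (subst nn_integral_distr) simp_all
  also have "\<dots> = (\<integral>\<^sup>+ q. g (fst q) * ennreal (exp (Y (fst q) * snd q)) \<partial>(distr M G (\<lambda>\<omega>. \<omega>) \<Otimes>\<^sub>M distr M borel D))"
    by (simp add: dist)
  also have "\<dots> = (\<integral>\<^sup>+ \<omega>. \<integral>\<^sup>+ x. g \<omega> * ennreal (exp (Y \<omega> * x)) \<partial>distr M borel D \<partial>distr M G (\<lambda>\<omega>. \<omega>))"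
    by (subst D.nn_integral_fst[symmetric]) (simp_all add: split_beta)
  also have "\<dots> = (\<integral>\<^sup>+ \<omega>. g \<omega> * (\<integral>\<^sup>+ x. ennreal (exp (Y \<omega> * x)) \<partial>distr M borel D) \<partial>distr M G (\<lambda>\<omega>. \<omega>))"
    by (intro nn_integral_cong nn_integral_cmult) simp
  also have "\<dots> \<le> (\<integral>\<^sup>+ \<omega>. K * g \<omega> \<partial>distr M G (\<lambda>\<omega>. \<omega>))"
  proof (intro nn_integral_mono)
    fix \<omega> assume "\<omega> \<in> space (distr M G (\<lambda>\<omega>. \<omega>))"
    then have "\<bar>Y \<omega>\<bar> \<le> 1" using Y1 sp by simp
    from mgf[OF this] have "(\<integral>\<^sup>+ x. ennreal (exp (Y \<omega> * x)) \<partial>distr M borel D) \<le> K"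
      by (subst nn_integral_distr) simp_all
    then show "g \<omega> * (\<integral>\<^sup>+ x. ennreal (exp (Y \<omega> * x)) \<partial>distr M borel D) \<le> K * g \<omega>"
      by (subst (2) mult.commute) (rule mult_left_mono, simp_all)
  qed
  also have "\<dots> = K * (\<integral>\<^sup>+ \<omega>. g \<omega> \<partial>M)"
    by (subst nn_integral_cmult) (simp_all add: nn_integral_distr)
  finally show ?thesis .
qed

lemma (in prob_space) nn_integral_exp_martingale_transform:
  fixes D Y :: "nat \<Rightarrow> 'a \<Rightarrow> real"
  assumes sub: "\<And>k. k \<le> n \<Longrightarrow> subalgebra M (G k)"
    and mono: "\<And>k. k < n \<Longrightarrow> sets (G k) \<subseteq> sets (G (Suc k))"
    and D: "\<And>k. k < n \<Longrightarrow> D k \<in> borel_measurable (G (Suc k))"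
    and indep: "\<And>k. k < n \<Longrightarrow> indep_set (sets (G k)) {D k -` C \<inter> space M | C. C \<in> sets borel}"
    and Y: "\<And>k. k < n \<Longrightarrow> Y k \<in> borel_measurable (G k)"
    and Y1: "\<And>k \<omega>. k < n \<Longrightarrow> \<omega> \<in> space M \<Longrightarrow> \<bar>Y k \<omega>\<bar> \<le> 1"
    and mgf: "\<And>k u. k < n \<Longrightarrow> \<bar>u\<bar> \<le> 1 \<Longrightarrow> (\<integral>\<^sup>+ \<omega>. ennreal (exp (u * D k \<omega>)) \<partial>M) \<le> K"
  shows "(\<integral>\<^sup>+ \<omega>. ennreal (exp (\<Sum>k<n. Y k \<omega> * D k \<omega>)) \<partial>M) \<le> K ^ n"
proof -
  have "(\<lambda>\<omega>. ennreal (exp (\<Sum>k<j. Y k \<omega> * D k \<omega>))) \<in> borel_measurable (G j) \<and>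
     (\<integral>\<^sup>+ \<omega>. ennreal (exp (\<Sum>k<j. Y k \<omega> * D k \<omega>)) \<partial>M) \<le> K ^ j" if "j \<le> n" for j
    using that
  proof (induction j)
    case 0
    then show ?case by (simp add: emeasure_space_1)
  next
    case (Suc j)
    then have j: "j < n" by simp
    let ?e = "\<lambda>j \<omega>. ennreal (exp (\<Sum>k<j. Y k \<omega> * D k \<omega>))"
    have m: "?e j \<in> borel_measurable (G j)" and le: "(\<integral>\<^sup>+ \<omega>. ?e j \<omega> \<partial>M) \<le> K ^ j"
      using Suc by auto
    have s: "subalgebra (G (Suc j)) (G j)"
      using sub[of j] sub[of "Suc j"] mono[OF j] Suc.prems by (auto simp: subalgebra_def)
    have split: "?e (Suc j) \<omega> = ?e j \<omega> * ennreal (exp (Y j \<omega> * D j \<omega>))" for \<omega>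
      by (simp add: exp_add ennreal_mult)
    note [measurable] = measurable_from_subalg[OF s m] measurable_from_subalg[OF s Y[OF j]] D[OF j]
    have "?e (Suc j) \<in> borel_measurable (G (Suc j))" unfolding split by measurable
    moreover have "(\<integral>\<^sup>+ \<omega>. ?e (Suc j) \<omega> \<partial>M) \<le> K * (\<integral>\<^sup>+ \<omega>. ?e j \<omega> \<partial>M)"
      unfolding split
    proof (rule nn_integral_exp_indep)
      show "D j \<in> borel_measurable M"
        using measurable_from_subalg[OF sub D[OF j]] Suc.prems by simp
    qed (use sub j m Y Y1 indep mgf in auto)
    moreover have "K * (\<integral>\<^sup>+ \<omega>. ?e j \<omega> \<partial>M) \<le> K * K ^ j" using le by (rule mult_left_mono) simp
    ultimately show ?case unfolding power_Suc by (meson order_trans)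
  qed
  then show ?thesis by blast
qed

section \<open>Dyadic nets of a bounded set\<close>

text \<open>At level \<open>m\<close> the coordinates, which lie between \<open>- D\<close> and
  \<open>D\<close>, are cut into pieces of length \<open>D / 2 ^ m\<close>. Each axis gets at most
  \<open>2 * 2 ^ m + 1 \<le> 4 ^ (m + 1)\<close> pieces, hence \<open>q = 4 ^ p\<close>. Geometric
  growth in \<open>m\<close> is what exponential tails can beat. Level 0 is one prescribed point,
  from which all chains start.\<close>

lemma bounded_polynomial_nets:
  fixes \<Theta> :: "(real ^ 'p) set"
  assumes "bounded \<Theta>" "\<theta>\<^sub>0 \<in> \<Theta>"
  shows "\<exists>T D q. 0 < D \<and> 1 \<le> (q::real) \<and> T 0 = {\<theta>\<^sub>0} \<and>
    (\<forall>m::nat. finite (T m) \<and> T m \<subseteq> \<Theta> \<and> real (card (T m)) \<le> q ^ (m + 1) \<and>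
       (\<forall>\<theta>\<in>\<Theta>. \<exists>x\<in>T m. norm (x - \<theta>) \<le> D / 2 ^ m))"
proof -
  obtain D where D: "D > 0" "\<And>\<theta>. \<theta> \<in> \<Theta> \<Longrightarrow> norm \<theta> \<le> D"
    using assms(1) bounded_pos by blast
  define c where "c m \<theta> = (\<lambda>i. \<lfloor>2 ^ m * \<theta> $ i / D\<rfloor>)" for m :: nat and \<theta> :: "real ^ 'p"
  \<comment> \<open>One representative for each cell that meets \<open>\<Theta>\<close>, picked
    inside \<open>\<Theta>\<close> because the random fields are only controlled there.\<close>
  define T where "T m = (if m = 0 then {\<theta>\<^sub>0} else inv_into \<Theta> (c m) ` c m ` \<Theta>)" for m
  define p where "p = CARD('p)"
  have rng: "c m ` \<Theta> \<subseteq> PiE UNIV (\<lambda>_. {- (2 ^ m)..2 ^ m})" for m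
  proof -
    have "- (2 ^ m) \<le> \<lfloor>2 ^ m * \<theta> $ i / D\<rfloor> \<and> \<lfloor>2 ^ m * \<theta> $ i / D\<rfloor> \<le> 2 ^ m" if "\<theta> \<in> \<Theta>" for \<theta> i
    proof -
      have "\<bar>\<theta> $ i\<bar> \<le> D" using D(2)[OF that] component_le_norm_cart[of \<theta> i] by linarith
      then have "\<bar>\<theta> $ i / D\<bar> \<le> 1" using D(1) by simp
      then have "\<bar>2 ^ m * (\<theta> $ i / D)\<bar> \<le> 2 ^ m"
        using mult_left_mono[of "\<bar>\<theta> $ i / D\<bar>" 1 "2 ^ m"] by (simp add: abs_mult)
      then have "- (2 ^ m) \<le> 2 ^ m * \<theta> $ i / D" "2 ^ m * \<theta> $ i / D \<le> 2 ^ m" unfolding abs_le_iff by simp_all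
      then show ?thesis by (simp add: le_floor_iff floor_le_iff)
    qed
    then show ?thesis by (auto simp: c_def)
  qed
  have fin: "finite (PiE (UNIV::'p set) (\<lambda>_. {- (2 ^ m)..(2 ^ m::int)}))" for m
    by (rule finite_PiE) auto
  have cardc: "card (c m ` \<Theta>) \<le> (4 ^ p) ^ (m + 1)" for m
  proof -
    have "card (c m ` \<Theta>) \<le> card (PiE (UNIV::'p set) (\<lambda>_. {- (2 ^ m)..(2 ^ m::int)}))"
      by (rule card_mono[OF fin rng])
    also have "\<dots> = nat (2 ^ m + 2 ^ m + 1) ^ p" by (simp add: card_PiE p_def)
    also have "nat (2 ^ m + 2 ^ m + 1) = 2 * 2 ^ m + (1::nat)" by (simp add: nat_add_distrib nat_mult_distrib nat_power_eq)
    also have "(2 * 2 ^ m + (1::nat)) ^ p \<le> (4 ^ (m + 1)) ^ p"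
    proof (rule power_mono)
      have "(2::nat) ^ m \<le> 4 ^ m" by (simp add: power_mono)
      moreover have "(1::nat) \<le> 4 ^ m" by simp
      moreover have "(4::nat) ^ (m + 1) = 4 * 4 ^ m" by simp
      ultimately show "2 * 2 ^ m + (1::nat) \<le> 4 ^ (m + 1)" by linarith
    qed simp
    also have "\<dots> = (4 ^ p) ^ (m + 1)" by (simp only: power_mult[symmetric] mult.commute)
    finally show ?thesis .
  qed
  \<comment> \<open>The radius \<open>(real p + 2) * D\<close> covers two cases: at level 0 the
    distance to the base point is at most \<open>2 * D\<close>, and at other levels the sum of
    \<open>p\<close> coordinate differences is at most \<open>p * D / 2 ^ m\<close>.\<close>
  have "norm (\<theta>\<^sub>0 - \<theta>) \<le> (real p + 2) * D" if "\<theta> \<in> \<Theta>" for \<theta>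
  proof -
    have "norm (\<theta>\<^sub>0 - \<theta>) \<le> 2 * D" using norm_triangle_ineq4[of \<theta>\<^sub>0 \<theta>] D(2)[OF that] D(2)[OF assms(2)] by simp
    also have "\<dots> \<le> (real p + 2) * D" using D(1) by (intro mult_right_mono) auto
    finally show ?thesis .
  qed
  moreover have "\<exists>x\<in>inv_into \<Theta> (c m) ` c m ` \<Theta>. norm (x - \<theta>) \<le> (real p + 2) * D / 2 ^ m" if \<theta>: "\<theta> \<in> \<Theta>" for \<theta> m
  proof (rule bexI)
    let ?x = "inv_into \<Theta> (c m) (c m \<theta>)"
    have x: "c m ?x = c m \<theta>" using \<theta> by (simp add: f_inv_into_f)
    have comp: "\<bar>(?x - \<theta>) $ i\<bar> \<le> D / 2 ^ m" for i
    proof -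
      have "\<lfloor>2 ^ m * ?x $ i / D\<rfloor> = \<lfloor>2 ^ m * \<theta> $ i / D\<rfloor>" using x by (auto simp: c_def fun_eq_iff)
      then have "\<bar>2 ^ m * ?x $ i / D - 2 ^ m * \<theta> $ i / D\<bar> \<le> 1" by linarith
      also have "2 ^ m * ?x $ i / D - 2 ^ m * \<theta> $ i / D = (2 ^ m / D) * (?x - \<theta>) $ i"
        by (simp add: diff_divide_distrib algebra_simps)
      finally have "2 ^ m / D * \<bar>(?x - \<theta>) $ i\<bar> \<le> 1" using D(1) by (simp add: abs_mult)
      then show ?thesis using D(1) by (simp add: field_simps)
    qed
    have "norm (?x - \<theta>) \<le> (\<Sum>i\<in>UNIV. \<bar>(?x - \<theta>) $ i\<bar>)" by (rule norm_le_l1_cart)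
    also have "\<dots> \<le> (\<Sum>i\<in>(UNIV::'p set). D / 2 ^ m)" by (rule sum_mono) (rule comp)
    also have "\<dots> \<le> (real p + 2) * D / 2 ^ m"
      using D(1) by (simp add: p_def field_simps)
    finally show "norm (?x - \<theta>) \<le> (real p + 2) * D / 2 ^ m" .
  qed (use \<theta> in auto)
  moreover have "finite (c m ` \<Theta>)" for m using finite_subset[OF rng fin] .
  moreover have "real (card (inv_into \<Theta> (c m) ` c m ` \<Theta>)) \<le> (4 ^ p) ^ (m + 1)" for m
  proof -
    have "card (inv_into \<Theta> (c m) ` c m ` \<Theta>) \<le> (4 ^ p) ^ (m + 1)"
      using card_image_le[OF \<open>finite (c m ` \<Theta>)\<close>, of "inv_into \<Theta> (c m)"] cardc[of m] by (rule order_trans)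
    then have "real (card (inv_into \<Theta> (c m) ` c m ` \<Theta>)) \<le> real ((4 ^ p) ^ (m + 1))" by (simp only: of_nat_le_iff)
    then show ?thesis by simp
  qed
  moreover have "inv_into \<Theta> (c m) ` c m ` \<Theta> \<subseteq> \<Theta>" for m by (auto intro: inv_into_into)
  moreover have "(real p + 2) * D > 0" using D(1) by (intro mult_pos_pos) auto
  moreover have "1 \<le> (4::real) ^ p" by simp
  ultimately have "0 < (real p + 2) * D \<and> 1 \<le> (4::real) ^ p \<and> T 0 = {\<theta>\<^sub>0} \<and>
    (\<forall>m. finite (T m) \<and> T m \<subseteq> \<Theta> \<and> real (card (T m)) \<le> (4 ^ p) ^ (m + 1) \<and>
       (\<forall>\<theta>\<in>\<Theta>. \<exists>x\<in>T m. norm (x - \<theta>) \<le> ((real p + 2) * D) / 2 ^ m))"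
    using assms(2) by (auto simp: T_def)
  then show ?thesis by blast
qed

section \<open>Chaining\<close>

lemma sum_Suc_div_power2_le: "(\<Sum>m<j. real (m + 1) / 2 ^ m) \<le> 4"
proof -
  have "(\<Sum>m<j. real (m + 1) / 2 ^ m) = 4 - (2 * real j + 4) / 2 ^ j"
  proof (induction j)
    case (Suc j)
    then show ?case by (simp only: sum.lessThan_Suc) (simp add: field_simps)
  qed simp
  then show ?thesis by simp
qed

text \<open>The order of quantifiers matters: \<open>A\<close> is fixed before the field
  \<open>S\<close> and depends only on the geometry of \<open>\<Theta>\<close>, on \<open>K\<close>
  and on \<open>\<eta>\<close>. In the application \<open>S\<close> varies with the grid and the
  observed states while \<open>K\<close> does not, so the bound is uniform in them.\<close>

lemma (in prob_space) subexponential_chaining: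
  fixes \<Theta> :: "(real ^ 'p) set"
  assumes "bounded \<Theta>" "\<theta>\<^sub>0 \<in> \<Theta>" "0 \<le> K" "0 < \<eta>"
  shows "\<exists>A\<ge>0. \<forall>S. (\<forall>\<theta>\<in>\<Theta>. S \<theta> \<in> borel_measurable M) \<longrightarrow>
     (\<forall>\<omega>\<in>space M. continuous_on \<Theta> (\<lambda>\<theta>. S \<theta> \<omega> :: real)) \<longrightarrow>
     (\<forall>x\<in>\<Theta>. \<forall>y\<in>\<Theta>. x \<noteq> y \<longrightarrow> (\<integral>\<^sup>+ \<omega>. ennreal (exp (\<bar>S x \<omega> - S y \<omega>\<bar> / norm (x - y))) \<partial>M) \<le> ennreal K) \<longrightarrow>
     (\<exists>E\<in>sets M. emeasure M E \<le> ennreal \<eta> \<and> (\<forall>\<omega>\<in>space M - E. \<forall>\<theta>\<in>\<Theta>. \<bar>S \<theta> \<omega> - S \<theta>\<^sub>0 \<omega>\<bar> \<le> A))"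
proof -
  obtain T D q where nets: "0 < D" "1 \<le> (q::real)" "T 0 = {\<theta>\<^sub>0}"
    "\<forall>m::nat. finite (T m) \<and> T m \<subseteq> \<Theta> \<and> real (card (T m)) \<le> q ^ (m + 1) \<and>
       (\<forall>\<theta>\<in>\<Theta>. \<exists>x\<in>T m. norm (x - \<theta>) \<le> D / 2 ^ m)"
    using bounded_polynomial_nets[OF assms(1,2)] by (elim exE conjE)
  note D = nets(1) and q = nets(2) and T0 = nets(3)
  have fin: "finite (T m)" and TS: "T m \<subseteq> \<Theta>" and card: "real (card (T m)) \<le> q ^ (m + 1)"
    and net: "\<theta> \<in> \<Theta> \<Longrightarrow> \<exists>x\<in>T m. norm (x - \<theta>) \<le> D / 2 ^ m" for m \<theta>
    using nets(4) by simp_all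
  \<comment> \<open>The exceptional probability will be at most the sum of
    \<open>K * r ^ (m + 1)\<close>. Since \<open>r \<le> 1/2\<close> this is at most
    \<open>2 * K * r\<close>, and the second entry of the minimum makes that at most
    \<open>\<eta>\<close>; the 1 added to \<open>K\<close> avoids division by zero.\<close>
  define r where "r = min (1/2) (\<eta> / (2 * (K + 1)))"
  have r: "0 < r" using assms by (simp add: r_def add_nonneg_pos)
  have r2: "r \<le> 1/2" unfolding r_def by (rule min.cobounded1)
  have Kr: "K * (2 * r) \<le> \<eta>"
  proof -
    have "K * (2 * r) \<le> K * (2 * (\<eta> / (2 * (K + 1))))"
      using assms by (intro mult_left_mono) (auto simp: r_def)
    also have "\<dots> = \<eta> * (K / (K + 1))" using assms by (simp add: field_simps)
    also have "\<dots> \<le> \<eta> * 1" using assms by (intro mult_left_mono) (auto simp: field_simps)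
    finally show ?thesis by simp
  qed
  \<comment> \<open>There are at most
    \<open>q ^ (m + 1) * q ^ (m + 2) \<le> (q ^ 3) ^ (m + 1)\<close> links at level
    \<open>m\<close>, each failing with probability at most \<open>K * exp (- a) ^ (m + 1)\<close>.
    This \<open>a\<close> makes the union bound geometric with ratio \<open>r\<close>.\<close>
  define a where "a = ln (q ^ 3 / r)"
  have q3: "q ^ 3 \<ge> 1" using q by simp
  have a: "q ^ 3 * exp (- a) = r" using q r by (simp add: a_def exp_minus)
  have a0: "a \<ge> 0" unfolding a_def using q3 r r2 by (intro ln_ge_zero) (simp add: field_simps)
  \<comment> \<open>Threshold for a link of length at most \<open>2 * D / 2 ^ m\<close>. The factor
    \<open>m + 1\<close> pays for the number of links and still leaves a convergent series: the
    thresholds sum to at most \<open>2 * a * D * 4\<close>, which is \<open>A\<close>.\<close>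
  define u where "u m = a * real (m + 1) * (2 * D / 2 ^ m)" for m :: nat
  define A where "A = 8 * a * D"
  have "\<exists>E\<in>sets M. emeasure M E \<le> ennreal \<eta> \<and> (\<forall>\<omega>\<in>space M - E. \<forall>\<theta>\<in>\<Theta>. \<bar>S \<theta> \<omega> - S \<theta>\<^sub>0 \<omega>\<bar> \<le> A)"
    if meas: "\<forall>\<theta>\<in>\<Theta>. S \<theta> \<in> borel_measurable M"
     and cont: "\<forall>\<omega>\<in>space M. continuous_on \<Theta> (\<lambda>\<theta>. S \<theta> \<omega> :: real)"
     and tail: "\<forall>x\<in>\<Theta>. \<forall>y\<in>\<Theta>. x \<noteq> y \<longrightarrow> (\<integral>\<^sup>+ \<omega>. ennreal (exp (\<bar>S x \<omega> - S y \<omega>\<bar> / norm (x - y))) \<partial>M) \<le> ennreal K"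
   for S
  proof -
    define Q where "Q m = {(x, y) \<in> T m \<times> T (Suc m). x \<noteq> y \<and> norm (x - y) \<le> 2 * D / 2 ^ m}" for m
    define Z where "Z m = (\<Union>(x, y)\<in>Q m. {\<omega>\<in>space M. u m < \<bar>S x \<omega> - S y \<omega>\<bar>})" for m
    have finQ: "finite (Q m)" for m
      unfolding Q_def by (rule finite_subset[OF _ finite_cartesian_product[OF fin fin]]) auto
    have cardQ: "real (card (Q m)) \<le> (q ^ 3) ^ (m + 1)" for m
    proof -
      have "card (Q m) \<le> card (T m \<times> T (Suc m))"
        unfolding Q_def by (intro card_mono finite_cartesian_product fin) auto
      then have "real (card (Q m)) \<le> real (card (T m)) * real (card (T (Suc m)))"
        by (simp add: card_cartesian_product flip: of_nat_mult)
      also have "\<dots> \<le> q ^ (m + 1) * q ^ (Suc m + 1)"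
        using q by (intro mult_mono card) auto
      also have "\<dots> = q ^ (2 * m + 3)" unfolding power_add[symmetric] by (rule arg_cong[where f="\<lambda>k. q ^ k"]) simp
      also have "\<dots> \<le> q ^ (3 * (m + 1))" using q by (intro power_increasing) auto
      finally show ?thesis by (simp only: power_mult)
    qed
    have QS: "x \<in> \<Theta>" "y \<in> \<Theta>" if "(x, y) \<in> Q m" for x y m using that TS by (auto simp: Q_def)
    have ms: "{\<omega>\<in>space M. u m < \<bar>S x \<omega> - S y \<omega>\<bar>} \<in> sets M" if "(x, y) \<in> Q m" for x y m
    proof -
      note [measurable] = bspec[OF meas QS(1)[OF that]] bspec[OF meas QS(2)[OF that]]
      show ?thesis by measurable
    qed
    \<comment> \<open>Markov's inequality for the exponential of the normalised increment; shorter
      links only make the normalised threshold larger.\<close>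
    have pair: "emeasure M {\<omega>\<in>space M. u m < \<bar>S x \<omega> - S y \<omega>\<bar>} \<le> ennreal (K * exp (- a) ^ (m + 1))"
      if xy: "(x, y) \<in> Q m" for x y m
    proof -
      let ?E = "{\<omega>\<in>space M. u m < \<bar>S x \<omega> - S y \<omega>\<bar>}"
      have v: "0 < norm (x - y)" "norm (x - y) \<le> 2 * D / 2 ^ m" using xy by (auto simp: Q_def)
      have "ennreal (exp (a * real (m + 1))) * emeasure M ?E = (\<integral>\<^sup>+ \<omega>. ennreal (exp (a * real (m + 1))) * indicator ?E \<omega> \<partial>M)"
        using ms[OF xy] by (simp add: nn_integral_cmult_indicator)
      also have "\<dots> \<le> (\<integral>\<^sup>+ \<omega>. ennreal (exp (\<bar>S x \<omega> - S y \<omega>\<bar> / norm (x - y))) \<partial>M)"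
      proof (intro nn_integral_mono)
        fix \<omega>
        have "a * real (m + 1) \<le> \<bar>S x \<omega> - S y \<omega>\<bar> / norm (x - y)" if "u m < \<bar>S x \<omega> - S y \<omega>\<bar>"
        proof -
          have "a * real (m + 1) * norm (x - y) \<le> u m"
            unfolding u_def using v a0 by (intro mult_left_mono) auto
          then show ?thesis using v that by (simp add: field_simps)
        qed
        then show "ennreal (exp (a * real (m + 1))) * indicator ?E \<omega> \<le> ennreal (exp (\<bar>S x \<omega> - S y \<omega>\<bar> / norm (x - y)))"
          by (auto split: split_indicator intro!: ennreal_leI)
      qed
      also have "\<dots> \<le> ennreal K" using tail QS[OF xy] v by auto
      finally have "ennreal (exp (a * real (m + 1))) * emeasure M ?E \<le> ennreal K" .
      then have "exp (a * real (m + 1)) * measure M ?E \<le> K"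
        using assms(3) by (simp add: emeasure_eq_measure flip: ennreal_mult)
      then have "measure M ?E \<le> K * exp (- (a * real (m + 1)))"
        by (simp only: exp_minus) (simp add: field_simps)
      also have "exp (- (a * real (m + 1))) = exp (- a) ^ (m + 1)"
        by (subst exp_of_nat_mult[symmetric]) (simp add: mult.commute)
      finally show ?thesis by (simp add: emeasure_eq_measure ennreal_leI)
    qed
    have Zm: "Z m \<in> sets M" for m unfolding Z_def using finQ ms by (intro sets.finite_UN) auto
    have Z: "emeasure M (Z m) \<le> ennreal (K * r ^ (m + 1))" for m
    proof -
      have "emeasure M (Z m) \<le> (\<Sum>p\<in>Q m. emeasure M (case p of (x, y) \<Rightarrow> {\<omega>\<in>space M. u m < \<bar>S x \<omega> - S y \<omega>\<bar>}))"
        unfolding Z_def by (rule emeasure_subadditive_finite[OF finQ]) (use ms in auto)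
      also have "\<dots> \<le> (\<Sum>p\<in>Q m. ennreal (K * exp (- a) ^ (m + 1)))"
        by (intro sum_mono) (use pair in auto)
      also have "\<dots> = ennreal (real (card (Q m)) * (K * exp (- a) ^ (m + 1)))"
        using assms(3) by (simp add: ennreal_mult ennreal_of_nat_eq_real_of_nat)
      also have "\<dots> \<le> ennreal ((q ^ 3) ^ (m + 1) * (K * exp (- a) ^ (m + 1)))"
        using cardQ[of m] assms(3) by (intro ennreal_leI mult_right_mono) auto
      also have "(q ^ 3) ^ (m + 1) * (K * exp (- a) ^ (m + 1)) = K * (q ^ 3 * exp (- a)) ^ (m + 1)"
        unfolding power_mult_distrib by (rule mult.left_commute)
      finally show ?thesis by (simp only: a)
    qed
    have sums: "(\<lambda>m. K * r ^ (m + 1)) sums (K * r * (1 / (1 - r)))"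
    proof -
      have "(\<lambda>m. K * r * r ^ m) sums (K * r * (1 / (1 - r)))"
        by (rule sums_mult[OF geometric_sums]) (use r r2 in simp)
      then show ?thesis by (simp only: mult.assoc Suc_eq_plus1[symmetric] power_Suc)
    qed
    have "emeasure M (\<Union>m. Z m) \<le> (\<Sum>m. emeasure M (Z m))"
      by (rule emeasure_subadditive_countably) (use Zm in auto)
    also have "\<dots> \<le> (\<Sum>m. ennreal (K * r ^ (m + 1)))"
      by (rule suminf_le[OF Z summableI summableI])
    also have "\<dots> = ennreal (K * r * (1 / (1 - r)))"
      by (rule suminf_ennreal_eq[OF _ sums]) (use r assms(3) in simp)
    also have "\<dots> \<le> ennreal (K * (2 * r))"
    proof (rule ennreal_leI)
      have "1 / (1 - r) \<le> 2" using r r2 by (simp add: field_simps)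
      then have "K * r * (1 / (1 - r)) \<le> K * r * 2" using assms(3) r r2 by (intro mult_left_mono) auto
      then show "K * r * (1 / (1 - r)) \<le> K * (2 * r)" by simp
    qed
    also have "\<dots> \<le> ennreal \<eta>" by (rule ennreal_leI[OF Kr])
    finally have E: "emeasure M (\<Union>m. Z m) \<le> ennreal \<eta>" .
    have "\<bar>S \<theta> \<omega> - S \<theta>\<^sub>0 \<omega>\<bar> \<le> A" if \<omega>: "\<omega> \<in> space M - (\<Union>m. Z m)" and \<theta>: "\<theta> \<in> \<Theta>" for \<omega> \<theta>
    proof -
      obtain x where x: "\<And>m. x m \<in> T m" "\<And>m. norm (x m - \<theta>) \<le> D / 2 ^ m"
        using net[OF \<theta>] by metis
      have step: "\<bar>S (x (Suc m)) \<omega> - S (x m) \<omega>\<bar> \<le> u m" for m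
      proof (cases "x m = x (Suc m)")
        case True
        then show ?thesis using a0 D by (simp add: u_def)
      next
        case False
        have "norm (x m - x (Suc m)) \<le> norm (x m - \<theta>) + norm (x (Suc m) - \<theta>)"
          using norm_triangle_ineq4[of "x m - \<theta>" "x (Suc m) - \<theta>"] by simp
        also have "\<dots> \<le> D / 2 ^ m + D / 2 ^ m"
          using x(2)[of m] x(2)[of "Suc m"] D by (intro add_mono) (auto simp: field_simps)
        finally have "(x m, x (Suc m)) \<in> Q m" using x(1) False by (auto simp: Q_def)
        then show ?thesis using \<omega> by (force simp: Z_def abs_minus_commute)
      qed
      have bnd: "\<bar>S (x j) \<omega> - S \<theta>\<^sub>0 \<omega>\<bar> \<le> A" for j
      proof -
        have "S (x j) \<omega> - S (x 0) \<omega> = (\<Sum>m<j. S (x (Suc m)) \<omega> - S (x m) \<omega>)"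
          by (rule sum_lessThan_telescope[symmetric])
        then have "\<bar>S (x j) \<omega> - S (x 0) \<omega>\<bar> \<le> (\<Sum>m<j. \<bar>S (x (Suc m)) \<omega> - S (x m) \<omega>\<bar>)"
          by (simp only: sum_abs)
        also have "\<dots> \<le> (\<Sum>m<j. u m)" by (rule sum_mono) (rule step)
        also have "\<dots> = 2 * a * D * (\<Sum>m<j. real (m + 1) / 2 ^ m)"
          unfolding u_def sum_distrib_left by (intro sum.cong) simp_all
        also have "\<dots> \<le> 2 * a * D * 4"
          using a0 D by (intro mult_left_mono sum_Suc_div_power2_le) auto
        finally show ?thesis using x(1)[of 0] T0 by (simp add: A_def)
      qed
      \<comment> \<open>The bound along the chain does not depend on the level, so continuity of the
        field carries it to the limit point \<theta>. No separability argument over all of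
        \<open>\<Theta>\<close> is required.\<close>
      have "(\<lambda>m. D / 2 ^ m) \<longlonglongrightarrow> 0"
        by (rule LIMSEQ_divide_realpow_zero) simp
      then have "x \<longlonglongrightarrow> \<theta>"
        by (rule LIM_zero_cancel[OF Lim_null_comparison[rotated]]) (use x(2) in auto)
      then have "(\<lambda>m. S (x m) \<omega>) \<longlonglongrightarrow> S \<theta> \<omega>"
      proof (rule continuous_on_tendsto_compose[rotated])
        show "\<forall>\<^sub>F m in sequentially. x m \<in> \<Theta>" using x(1) TS by (intro always_eventually) blast
        show "continuous_on \<Theta> (\<lambda>\<theta>. S \<theta> \<omega>)" using cont \<omega> by blast
      qed (rule \<theta>)
      then have "(\<lambda>m. \<bar>S (x m) \<omega> - S \<theta>\<^sub>0 \<omega>\<bar>) \<longlonglongrightarrow> \<bar>S \<theta> \<omega> - S \<theta>\<^sub>0 \<omega>\<bar>"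
        by (intro tendsto_intros)
      then show ?thesis by (rule LIMSEQ_le_const2) (use bnd in auto)
    qed
    then show ?thesis using E Zm by (intro bexI[of _ "\<Union>m. Z m"]) auto
  qed
  moreover have "A \<ge> 0" using a0 D by (simp add: A_def)
  ultimately show ?thesis by blast
qed

section \<open>Poisson random measures\<close>

text \<open>It turns the exponent \<open>exp c - 1 - c\<close> of a compensated Poisson count into
  the second-moment bound \<open>c\<^sup>2\<close>. For negative arguments it is
  \<open>exp y \<ge> 1 + y\<close> multiplied by \<open>1 - y + y\<^sup>2\<close>.\<close>

lemma exp_le_quadratic:
  fixes x :: real
  assumes "\<bar>x\<bar> \<le> 1"
  shows "exp x \<le> 1 + x + x\<^sup>2"
proof (cases "0 \<le> x")
  case True
  then show ?thesis using exp_bound[of x] assms by simp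
next
  case False
  define y where "y = - x"
  have y: "0 \<le> y" using False by (simp add: y_def)
  have "1 \<le> (1 + y) * (1 - y + y\<^sup>2)"
  proof -
    have "(1 + y) * (1 - y + y\<^sup>2) = 1 + y ^ 3" by algebra
    then show ?thesis using y by simp
  qed
  also have "\<dots> \<le> exp y * (1 - y + y\<^sup>2)"
  proof (rule mult_right_mono[OF exp_ge_add_one_self])
    have "1 - y + y\<^sup>2 = (y - 1/2)\<^sup>2 + 3/4" by (simp add: power2_eq_square algebra_simps)
    then show "0 \<le> 1 - y + y\<^sup>2" by simp
  qed
  finally have "exp (- y) \<le> 1 - y + y\<^sup>2" by (simp add: exp_minus field_simps)
  then show ?thesis by (simp add: y_def)
qed

text \<open>The Poisson weights add up to 1, which leaves no mass for the value infinity.\<close>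

lemma (in prob_space) poisson_AE_nat:
  assumes N: "poisson_random_measure M \<mu> N" and A: "A \<in> sets \<mu>" "emeasure \<mu> A < \<infinity>"
  shows "AE \<omega> in M. \<exists>k::nat. emeasure (N \<omega>) A = of_nat k"
proof -
  have [measurable]: "(\<lambda>\<omega>. emeasure (N \<omega>) A) \<in> borel_measurable M"
    using N A by (auto simp: poisson_random_measure_def)
  define E where "E k = {\<omega>\<in>space M. emeasure (N \<omega>) A = of_nat k}" for k :: nat
  have E[measurable]: "E k \<in> sets M" for k unfolding E_def by measurable
  have P: "measure M (E k) = measure \<mu> A ^ k / fact k * exp (- measure \<mu> A)" for k
    using N A unfolding E_def by (auto simp: poisson_random_measure_def)
  have "(\<lambda>k. measure M (E k)) sums measure M (\<Union>k. E k)"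
    by (rule finite_measure_UNION) (auto simp: E_def disjoint_family_on_def)
  moreover have "(\<lambda>k. measure M (E k)) sums (exp (measure \<mu> A) * exp (- measure \<mu> A))"
    unfolding P using sums_mult2[OF exp_converges[of "measure \<mu> A"], of "exp (- measure \<mu> A)"]
    by (simp add: divide_inverse mult.commute mult.left_commute)
  ultimately have "measure M (\<Union>k. E k) = exp (measure \<mu> A) * exp (- measure \<mu> A)"
    by (rule sums_unique2)
  also have "\<dots> = 1" by (simp flip: exp_add)
  finally have "AE \<omega> in M. \<omega> \<in> (\<Union>k. E k)" by (subst prob_eq_1[symmetric]) auto
  then show ?thesis by (auto simp: E_def)
qed

lemma (in prob_space) poisson_exp_moment:
  assumes N: "poisson_random_measure M \<mu> N" and A: "A \<in> sets \<mu>" "emeasure \<mu> A < \<infinity>"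
  shows "(\<integral>\<^sup>+ \<omega>. ennreal (exp (c * measure (N \<omega>) A)) \<partial>M) = ennreal (exp (measure \<mu> A * (exp c - 1)))"
proof -
  have [measurable]: "(\<lambda>\<omega>. emeasure (N \<omega>) A) \<in> borel_measurable M"
    using N A by (auto simp: poisson_random_measure_def)
  define E where "E k = {\<omega>\<in>space M. emeasure (N \<omega>) A = of_nat k}" for k :: nat
  have E[measurable]: "E k \<in> sets M" for k unfolding E_def by measurable
  have P: "measure M (E k) = measure \<mu> A ^ k / fact k * exp (- measure \<mu> A)" for k
    using N A unfolding E_def by (auto simp: poisson_random_measure_def)
  have "(\<integral>\<^sup>+ \<omega>. ennreal (exp (c * measure (N \<omega>) A)) \<partial>M)
      = (\<integral>\<^sup>+ \<omega>. (\<Sum>k. ennreal (exp (c * real k)) * indicator (E k) \<omega>) \<partial>M)"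
  proof (rule nn_integral_cong_AE)
    show "AE \<omega> in M. ennreal (exp (c * measure (N \<omega>) A)) = (\<Sum>k. ennreal (exp (c * real k)) * indicator (E k) \<omega>)"
      using poisson_AE_nat[OF N A] AE_space
    proof (eventually_elim, safe)
      fix \<omega> and j :: nat
      assume *: "emeasure (N \<omega>) A = of_nat j" "\<omega> \<in> space M"
      have "(\<lambda>k. ennreal (exp (c * real k)) * indicator (E k) \<omega>) = (\<lambda>k. if k = j then ennreal (exp (c * real k)) else 0)"
        using * by (auto simp: E_def fun_eq_iff)
      then have "(\<Sum>k. ennreal (exp (c * real k)) * indicator (E k) \<omega>) = ennreal (exp (c * real j))"
        using sums_single[of j "\<lambda>k. ennreal (exp (c * real k))"] by (auto intro: sums_unique[symmetric])
      moreover have "measure (N \<omega>) A = real j" using * by (simp add: measure_def)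
      ultimately      show "ennreal (exp (c * measure (N \<omega>) A)) = (\<Sum>k. ennreal (exp (c * real k)) * indicator (E k) \<omega>)" by simp
    qed
  qed
  also have "\<dots> = (\<Sum>k. ennreal (exp (c * real k)) * emeasure M (E k))"
    by (subst nn_integral_suminf) (auto simp: nn_integral_cmult_indicator)
  also have "\<dots> = (\<Sum>k. ennreal (exp (- measure \<mu> A) * (exp c * measure \<mu> A) ^ k / fact k))"
    by (intro suminf_cong)
       (simp add: emeasure_eq_measure P power_mult_distrib exp_of_nat_mult[symmetric] mult.commute mult.left_commute flip: ennreal_mult)
  also have "\<dots> = ennreal (exp (- measure \<mu> A) * exp (exp c * measure \<mu> A))"
  proof (rule suminf_ennreal_eq)
    show "(\<lambda>k. exp (- measure \<mu> A) * (exp c * measure \<mu> A) ^ k / fact k) sums (exp (- measure \<mu> A) * exp (exp c * measure \<mu> A))"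
      using sums_mult[OF exp_converges[of "exp c * measure \<mu> A"], of "exp (- measure \<mu> A)"]
      by (simp add: divide_inverse mult.commute mult.left_commute)
  qed simp
  also have "exp (- measure \<mu> A) * exp (exp c * measure \<mu> A) = exp (measure \<mu> A * (exp c - 1))"
    by (simp add: algebra_simps flip: exp_add)
  finally show ?thesis .
qed

text \<open>Counts of disjoint sets are independent, so the moment factorises. Compensation removes
  the linear term of each exponent \<open>measure \<mu> (A i) * (exp (u * c i) - 1)\<close>, and the
  rest is quadratic because \<open>u * c i\<close> stays between -1 and 1.\<close>

lemma (in prob_space) poisson_simple_exp_moment:
  fixes A :: "nat \<Rightarrow> 'b set" and c :: "nat \<Rightarrow> real"
  assumes N: "poisson_random_measure M \<mu> N" and A: "\<And>i. A i \<in> sets \<mu>" "\<And>i. emeasure \<mu> (A i) < \<infinity>"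
    and dj: "disjoint_family A" and c: "\<And>i. i < m \<Longrightarrow> \<bar>c i\<bar> \<le> 1" and u: "\<bar>u\<bar> \<le> 1"
  shows "(\<integral>\<^sup>+ \<omega>. ennreal (exp (u * (\<Sum>i<m. c i * (measure (N \<omega>) (A i) - measure \<mu> (A i))))) \<partial>M)
      \<le> ennreal (exp (\<Sum>i<m. (c i)\<^sup>2 * measure \<mu> (A i)))"
proof -
  have [measurable]: "(\<lambda>\<omega>. emeasure (N \<omega>) (A i)) \<in> borel_measurable M" for i
    using N A by (auto simp: poisson_random_measure_def)
  have iv: "indep_vars (\<lambda>_. borel) (\<lambda>i \<omega>. emeasure (N \<omega>) (A i)) UNIV"
  proof -
    have "\<forall>A :: nat \<Rightarrow> 'b set. range A \<subseteq> sets \<mu> \<and> disjoint_family A \<longrightarrow>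
        indep_vars (\<lambda>_. borel) (\<lambda>i \<omega>. emeasure (N \<omega>) (A i)) UNIV"
      using N unfolding poisson_random_measure_def by (elim conjE)
    moreover have "range A \<subseteq> sets \<mu>" using A(1) by auto
    ultimately show ?thesis using dj by (elim allE[of _ A]) (rule mp, assumption, rule conjI)
  qed
  let ?f = "\<lambda>i \<omega>. ennreal (exp (u * (c i * (measure (N \<omega>) (A i) - measure \<mu> (A i)))))"
  have "indep_vars (\<lambda>_. borel) (\<lambda>i \<omega>. ennreal (exp (u * (c i * (enn2real (emeasure (N \<omega>) (A i)) - measure \<mu> (A i)))))) {..<m}"
    by (rule indep_vars_compose2[OF indep_vars_subset[OF iv subset_UNIV]]) measurable
  then have iv2: "indep_vars (\<lambda>_. borel) ?f {..<m}" by (simp add: measure_def)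
  have "(\<integral>\<^sup>+ \<omega>. ennreal (exp (u * (\<Sum>i<m. c i * (measure (N \<omega>) (A i) - measure \<mu> (A i))))) \<partial>M)
      = (\<integral>\<^sup>+ \<omega>. (\<Prod>i<m. ?f i \<omega>) \<partial>M)"
    by (simp add: sum_distrib_left exp_sum prod_ennreal)
  also have "\<dots> = (\<Prod>i<m. \<integral>\<^sup>+ \<omega>. ?f i \<omega> \<partial>M)"
    by (rule indep_vars_nn_integral[OF _ iv2]) auto
  also have "\<dots> \<le> (\<Prod>i<m. ennreal (exp ((c i)\<^sup>2 * measure \<mu> (A i))))"
  proof (rule prod_mono_ennreal)
    fix i assume i: "i \<in> {..<m}"
    have uc: "\<bar>u * c i\<bar> \<le> 1" using u c[of i] i by (simp add: abs_mult mult_le_one)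
    have "(\<integral>\<^sup>+ \<omega>. ?f i \<omega> \<partial>M) = (\<integral>\<^sup>+ \<omega>. ennreal (exp (- (u * c i) * measure \<mu> (A i))) * ennreal (exp ((u * c i) * measure (N \<omega>) (A i))) \<partial>M)"
      by (intro nn_integral_cong) (simp add: algebra_simps flip: ennreal_mult exp_add)
    also have "\<dots> = ennreal (exp (- (u * c i) * measure \<mu> (A i))) * ennreal (exp (measure \<mu> (A i) * (exp (u * c i) - 1)))"
      by (subst nn_integral_cmult) (simp_all add: measure_def poisson_exp_moment[OF N A, unfolded measure_def])
    also have "\<dots> = ennreal (exp (measure \<mu> (A i) * (exp (u * c i) - 1 - u * c i)))"
      by (simp add: algebra_simps flip: ennreal_mult exp_add)
    also have "\<dots> \<le> ennreal (exp ((c i)\<^sup>2 * measure \<mu> (A i)))"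
    proof -
      have "exp (u * c i) - 1 - u * c i \<le> (u * c i)\<^sup>2" using exp_le_quadratic[OF uc] by simp
      also have "\<dots> \<le> (c i)\<^sup>2"
        using u abs_square_le_1[of u] by (simp add: power_mult_distrib mult_left_le_one_le)
      finally have "measure \<mu> (A i) * (exp (u * c i) - 1 - u * c i) \<le> measure \<mu> (A i) * (c i)\<^sup>2"
        by (intro mult_left_mono) auto
      then show ?thesis by (intro ennreal_leI) (simp add: mult.commute)
    qed
    finally show "(\<integral>\<^sup>+ \<omega>. ?f i \<omega> \<partial>M) \<le> ennreal (exp ((c i)\<^sup>2 * measure \<mu> (A i)))" .
  qed
  also have "\<dots> = ennreal (exp (\<Sum>i<m. (c i)\<^sup>2 * measure \<mu> (A i)))"
    by (simp add: prod_ennreal exp_sum)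
  finally show ?thesis .
qed

text \<open>Compatibility with the filtration is stated for the sigma-algebra of the counts; this
  transfers its independence from the past to finite linear combinations of counts.\<close>

lemma generated_sets_measurable_combination:
  fixes N :: "'w \<Rightarrow> 'x measure"
  assumes A: "\<And>i. i < (m::nat) \<Longrightarrow> A i \<in> \<A>" and C: "C \<in> sets borel"
  shows "(\<lambda>\<omega>. \<Sum>i<m. c i * (measure (N \<omega>) (A i) - d i) :: real) -` C \<inter> space M
     \<in> generated_sets M (\<lambda>A \<omega>. emeasure (N \<omega>) A) \<A>"
proof -
  define G where "G = {(\<lambda>\<omega>. emeasure (N \<omega>) A) -` B \<inter> space M | A B. A \<in> \<A> \<and> B \<in> sets borel}"
  have G: "G \<subseteq> Pow (space M)" by (auto simp: G_def)
  have [measurable]: "(\<lambda>\<omega>. emeasure (N \<omega>) (A i)) \<in> borel_measurable (sigma (space M) G)" if "i < m" for i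
    using A[OF that] G by (intro measurableI) (auto simp: G_def space_measure_of_conv intro!: in_measure_of)
  have "(\<lambda>\<omega>. \<Sum>i<m. c i * (measure (N \<omega>) (A i) - d i)) \<in> borel_measurable (sigma (space M) G)"
    unfolding measure_def by measurable
  from measurable_sets[OF this C] show ?thesis
    using G by (simp add: generated_sets_def G_def space_measure_of_conv sets_measure_of)
qed

text \<open>Rounding towards \<open>0\<close>, so that second moments do not increase.\<close>

definition trunc_div :: "nat \<Rightarrow> real \<Rightarrow> real" where
  "trunc_div m x = (if 0 \<le> x then of_int \<lfloor>real m * x\<rfloor> else of_int \<lceil>real m * x\<rceil>) / real m"

text \<open>The index \<open>l\<close> is shifted by \<open>m\<close> to allow negative values: on \<open>{-1..1}\<close> only \<open>l \<le> 2 m\<close> occur.\<close>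

definition level_set :: "nat \<Rightarrow> nat \<Rightarrow> real set" where
  "level_set m l = {x. trunc_div m x = (real l - real m) / real m}"

lemma trunc_div_measurable[measurable]: "trunc_div m \<in> borel_measurable borel"
  unfolding trunc_div_def[abs_def] by measurable

lemma level_set_measurable[measurable]: "level_set m l \<in> sets borel"
  unfolding level_set_def by measurable

lemma trunc_div_bounds:
  assumes "0 < m"
  shows "\<bar>trunc_div m x\<bar> \<le> \<bar>x\<bar>" "\<bar>trunc_div m x - x\<bar> \<le> 1 / real m"
proof -
  have m: "real m > 0" using assms by simp
  have 1: "\<bar>trunc_div m x * real m\<bar> \<le> \<bar>x * real m\<bar> \<and> \<bar>trunc_div m x * real m - x * real m\<bar> \<le> 1"
  proof (cases "0 \<le> x")
    case True
    then have "0 \<le> real m * x" using m by simp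
    then show ?thesis using True m by (simp add: trunc_div_def mult.commute) linarith
  next
    case False
    then have "real m * x \<le> 0" using m by (simp add: mult_le_0_iff)
    then show ?thesis using False m by (simp add: trunc_div_def mult.commute) linarith
  qed
  then show "\<bar>trunc_div m x\<bar> \<le> \<bar>x\<bar>" using m by (simp add: abs_mult)
  have "\<bar>trunc_div m x - x\<bar> * real m \<le> 1"
    using 1 m by (simp flip: left_diff_distrib add: abs_mult)
  then show "\<bar>trunc_div m x - x\<bar> \<le> 1 / real m" using m by (simp add: field_simps)
qed

lemma sum_level_set:
  assumes "0 < m" "\<bar>x\<bar> \<le> 1"
  shows "(\<Sum>l<2 * m + 1. g ((real l - real m) / real m) * indicator (level_set m l) x) = (g (trunc_div m x) :: real)"
proof -
  have m: "real m > 0" using assms by simp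
  define i where "i = (if 0 \<le> x then \<lfloor>real m * x\<rfloor> else \<lceil>real m * x\<rceil>)"
  have "- real m \<le> real m * x" "real m * x \<le> real m" using assms(2) m
    by (auto simp: abs_le_iff mult_le_cancel_left1 intro: order_trans[OF _ mult_left_mono[of "-1" x "real m"]])
  then have i: "- int m \<le> i" "i \<le> int m" unfolding i_def by (auto simp: le_floor_iff ceiling_le_iff floor_le_iff le_ceiling_iff)
  define l0 where "l0 = nat (i + int m)"
  have l0: "real l0 = of_int i + real m" using i by (simp add: l0_def)
  have t: "trunc_div m x = (real l0 - real m) / real m" by (simp add: trunc_div_def l0 i_def)
  have "x \<in> level_set m l \<longleftrightarrow> l = l0" for l
    using m by (auto simp: level_set_def t)
  then have "(\<Sum>l<2 * m + 1. g ((real l - real m) / real m) * indicator (level_set m l) x)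
     = (\<Sum>l<2 * m + 1. if l = l0 then g ((real l - real m) / real m) else 0)"
    by (intro sum.cong) (auto simp: indicator_def)
  also have "\<dots> = g ((real l0 - real m) / real m)"
    using i by (simp add: l0_def) linarith
  finally show ?thesis by (simp add: t)
qed

text \<open>The sum is the integral of a step function. With \<open>g\<close> the identity it
  discretises an integral, with \<open>g\<close> the square it computes the second moment of the
  rounded values; \<open>Q\<close> will be both a realisation of the random measure and the Levy
  measure.\<close>

lemma level_sum_eq_set_integral:
  fixes f :: "'x \<Rightarrow> real" and Q :: "'x measure"
  assumes S[measurable]: "S \<in> sets Q" and fin: "emeasure Q S < \<infinity>" and f[measurable]: "f \<in> borel_measurable Q"
    and f1: "\<And>x. x \<in> S \<Longrightarrow> \<bar>f x\<bar> \<le> 1" and m: "0 < m"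
  shows "(\<Sum>l<2 * m + 1. g ((real l - real m) / real m) * measure Q {x\<in>S. f x \<in> level_set m l})
     = (LINT x:S|Q. (g (trunc_div m (f x)) :: real))"
proof -
  have Sl: "{x\<in>S. f x \<in> level_set m l} = S \<inter> (f -` level_set m l \<inter> space Q)" for l
    using sets.sets_into_space[OF S] by auto
  have [measurable]: "{x\<in>S. f x \<in> level_set m l} \<in> sets Q" for l unfolding Sl by measurable
  have finl: "emeasure Q {x\<in>S. f x \<in> level_set m l} < \<infinity>" for l
    by (rule le_less_trans[OF emeasure_mono fin]) auto
  have "(LINT x:S|Q. g (trunc_div m (f x))) = (\<integral>x. (\<Sum>l<2 * m + 1. g ((real l - real m) / real m) * indicator {x\<in>S. f x \<in> level_set m l} x) \<partial>Q)"
    unfolding set_lebesgue_integral_def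
  proof (intro Bochner_Integration.integral_cong refl)
    fix x
    show "indicator S x *\<^sub>R g (trunc_div m (f x)) = (\<Sum>l<2 * m + 1. g ((real l - real m) / real m) * indicator {x\<in>S. f x \<in> level_set m l} x)"
    proof (cases "x \<in> S")
      case True
      then show ?thesis using sum_level_set[OF m f1[OF True], of g] by (simp add: indicator_def)
    next
      case False then show ?thesis by simp
    qed
  qed
  also have "\<dots> = (\<Sum>l<2 * m + 1. \<integral>x. g ((real l - real m) / real m) * indicator {x\<in>S. f x \<in> level_set m l} x \<partial>Q)"
    using finl by (intro Bochner_Integration.integral_sum integrable_mult_right integrable_real_indicator) auto
  also have "\<dots> = (\<Sum>l<2 * m + 1. g ((real l - real m) / real m) * measure Q {x\<in>S. f x \<in> level_set m l})"
    using finl by (intro sum.cong) auto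
  finally show ?thesis by simp
qed

lemma set_integrable_bounded_finite:
  fixes f :: "'x \<Rightarrow> 'b::{banach, second_countable_topology}"
  assumes [measurable]: "S \<in> sets Q" and fin: "emeasure Q S < \<infinity>" and [measurable]: "f \<in> borel_measurable Q"
    and "\<And>x. x \<in> S \<Longrightarrow> norm (f x) \<le> B"
  shows "set_integrable Q S f"
  unfolding set_integrable_def
proof (rule Bochner_Integration.integrable_bound)
  show "integrable Q (\<lambda>x. B * indicator S x :: real)" using fin by (intro integrable_mult_right integrable_real_indicator) auto
  show "AE x in Q. norm (indicator S x *\<^sub>R f x) \<le> norm (B * indicator S x)"
  proof (rule AE_I2)
    fix x
    show "norm (indicator S x *\<^sub>R f x) \<le> norm (B * indicator S x)"
      using assms(4)[of x] by (cases "x \<in> S") auto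
  qed
qed measurable

text \<open>Rounding errs by at most \<open>1 / m\<close> uniformly, and \<open>S\<close> has finite
  measure. The resolution is written \<open>Suc i\<close> so that it is never zero.\<close>

lemma level_sum_tendsto:
  fixes f :: "'x \<Rightarrow> real" and Q :: "'x measure"
  assumes S[measurable]: "S \<in> sets Q" and fin: "emeasure Q S < \<infinity>" and f[measurable]: "f \<in> borel_measurable Q"
    and f1: "\<And>x. x \<in> S \<Longrightarrow> \<bar>f x\<bar> \<le> 1"
  shows "(\<lambda>i. \<Sum>l<2 * Suc i + 1. ((real l - real (Suc i)) / real (Suc i)) * measure Q {x\<in>S. f x \<in> level_set (Suc i) l})
     \<longlonglongrightarrow> (LINT x:S|Q. f x)"
proof -
  have t1: "\<bar>trunc_div (Suc i) (f x)\<bar> \<le> 1" if "x \<in> S" for i x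
    using trunc_div_bounds(1)[of "Suc i" "f x"] f1[OF that] by simp
  have i1: "set_integrable Q S f" by (rule set_integrable_bounded_finite[where B=1]) (use fin f1 in auto)
  have i2: "set_integrable Q S (\<lambda>x. trunc_div (Suc i) (f x))" for i
    by (rule set_integrable_bounded_finite[where B=1]) (use fin t1 in auto)
  have "(\<lambda>i. (LINT x:S|Q. trunc_div (Suc i) (f x)) - (LINT x:S|Q. f x)) \<longlonglongrightarrow> 0"
  proof (rule Lim_null_comparison)
    show "(\<lambda>i. measure Q S * (1 / real (Suc i))) \<longlonglongrightarrow> 0"
      using tendsto_mult_left[OF LIMSEQ_inverse_real_of_nat, of "measure Q S"] by (simp add: divide_inverse)
    show "\<forall>\<^sub>F i in sequentially. norm ((LINT x:S|Q. trunc_div (Suc i) (f x)) - (LINT x:S|Q. f x)) \<le> measure Q S * (1 / real (Suc i))"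
    proof (intro always_eventually allI)
      fix i
      have "(LINT x:S|Q. trunc_div (Suc i) (f x)) - (LINT x:S|Q. f x) = (LINT x:S|Q. trunc_div (Suc i) (f x) - f x)"
        using i1 i2 by (simp add: set_integral_diff)
      also have "norm \<dots> \<le> (LINT x:S|Q. norm (trunc_div (Suc i) (f x) - f x))"
        by (rule set_integral_norm_bound) (use i1 i2 in auto)
      also have "\<dots> \<le> (LINT x:S|Q. 1 / real (Suc i))"
      proof (rule set_integral_mono)
        show "set_integrable Q S (\<lambda>x. norm (trunc_div (Suc i) (f x) - f x))"
          by (intro set_integrable_norm set_integral_diff i1 i2)
        show "set_integrable Q S (\<lambda>x. 1 / real (Suc i))"
          by (rule set_integrable_bounded_finite[where B="1 / real (Suc i)"]) (use fin in auto)
      qed (use trunc_div_bounds(2)[of "Suc i"] in auto)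
      also have "\<dots> = measure Q S * (1 / real (Suc i))"
        by (simp add: set_lebesgue_integral_def)
      finally show "norm ((LINT x:S|Q. trunc_div (Suc i) (f x)) - (LINT x:S|Q. f x)) \<le> measure Q S * (1 / real (Suc i))" .
    qed
  qed
  then have "(\<lambda>i. LINT x:S|Q. trunc_div (Suc i) (f x)) \<longlonglongrightarrow> (LINT x:S|Q. f x)"
    by (rule LIM_zero_cancel)
  then show ?thesis
    by (subst level_sum_eq_set_integral[where g="\<lambda>x. x"]) (use S fin f f1 in auto)
qed

section \<open>Exponential integrators\<close>

text \<open>
  \<open>W k\<close> is only required to be \<open>M\<close>-measurable: the integral of the compensated small jumps is an
  \<open>L\<^sup>2\<close>-limit and need not be adapted, since \<open>F\<close> need not be complete.
\<close>

definition exp_integrator ::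
    "'w measure \<Rightarrow> (real \<Rightarrow> 'w measure) \<Rightarrow> nat \<Rightarrow> real \<Rightarrow> (nat \<Rightarrow> 'w \<Rightarrow> real) \<Rightarrow> bool" where
  "exp_integrator M F n C W \<longleftrightarrow>
     (\<forall>k\<le>n. W k \<in> borel_measurable M) \<and>
     (\<forall>Y. (\<forall>k<n. Y k \<in> borel_measurable (F (real k / real n)) \<and> (\<forall>\<omega>\<in>space M. \<bar>Y k \<omega>\<bar> \<le> 1)) \<longrightarrow>
        (\<integral>\<^sup>+ \<omega>. ennreal (exp (\<Sum>k<n. Y k \<omega> * (W (Suc k) \<omega> - W k \<omega>))) \<partial>M) \<le> ennreal (exp C))"

lemma (in prob_space) indep_set_mono_right:
  assumes "indep_set A B" "B' \<subseteq> B"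
  shows "indep_set A B'"
  unfolding indep_set_def
  by (rule indep_sets_mono_sets[OF assms(1)[unfolded indep_set_def]]) (use assms(2) in \<open>auto split: bool.splits\<close>)

text \<open>The requirement \<open>C / real n\<close> per step is proportional to the length of a
  grid interval, so the product over all steps is \<open>exp C\<close> for every
  \<open>n\<close>.\<close>

lemma exp_integratorI:
  fixes M :: "'w measure"
  assumes F: "filtered_prob_space M F" and n: "1 \<le> n"
    and W: "\<And>k. k \<le> n \<Longrightarrow> W k \<in> borel_measurable (F (real k / real n))"
    and indep: "\<And>k. k < n \<Longrightarrow> prob_space.indep_set M (sets (F (real k / real n)))
       {(\<lambda>\<omega>. W (Suc k) \<omega> - W k \<omega>) -` S \<inter> space M | S. S \<in> sets borel}"
    and mgf: "\<And>k u. k < n \<Longrightarrow> \<bar>u\<bar> \<le> 1 \<Longrightarrow>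
       (\<integral>\<^sup>+ \<omega>. ennreal (exp (u * (W (Suc k) \<omega> - W k \<omega>))) \<partial>M) \<le> ennreal (exp (C / real n))"
  shows "exp_integrator M F n C W"
  unfolding exp_integrator_def
proof (intro conjI allI impI)
  interpret prob_space M using F by (simp add: filtered_prob_space_def)
  have sub: "subalgebra M (F t)" for t using F by (simp add: filtered_prob_space_def)
  have mono: "sets (F s) \<subseteq> sets (F t)" if "s \<le> t" for s t
    using F that filtration.sets_F_mono[of "space M" F s t] by (simp add: filtered_prob_space_def)
  show "W k \<in> borel_measurable M" if "k \<le> n" for k
    by (rule measurable_from_subalg[OF sub W[OF that]])
  fix Y :: "nat \<Rightarrow> 'w \<Rightarrow> real" assume Y: "\<forall>k<n. Y k \<in> borel_measurable (F (real k / real n)) \<and> (\<forall>\<omega>\<in>space M. \<bar>Y k \<omega>\<bar> \<le> 1)"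
  have sub2: "subalgebra (F t) (F s)" if "s \<le> t" for s t
    using sub[of s] sub[of t] mono[OF that] by (auto simp: subalgebra_def)
  have "(\<integral>\<^sup>+ \<omega>. ennreal (exp (\<Sum>k<n. Y k \<omega> * (W (Suc k) \<omega> - W k \<omega>))) \<partial>M) \<le> ennreal (exp (C / real n)) ^ n"
  proof (rule nn_integral_exp_martingale_transform[where G="\<lambda>k. F (real k / real n)"])
    fix k assume k: "k < n"
    have le: "real k / real n \<le> real (Suc k) / real n" by (simp add: divide_right_mono)
    show "sets (F (real k / real n)) \<subseteq> sets (F (real (Suc k) / real n))"
      by (rule mono[OF le])
    show "(\<lambda>\<omega>. W (Suc k) \<omega> - W k \<omega>) \<in> borel_measurable (F (real (Suc k) / real n))"
      using k by (intro borel_measurable_diff W measurable_from_subalg[OF sub2[OF le] W]) auto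
  qed (use sub indep Y mgf in auto)
  also have "\<dots> = ennreal (exp C)"
    using n by (simp add: ennreal_power flip: exp_of_nat_mult)
  finally show "(\<integral>\<^sup>+ \<omega>. ennreal (exp (\<Sum>k<n. Y k \<omega> * (W (Suc k) \<omega> - W k \<omega>))) \<partial>M) \<le> ennreal (exp C)" .
qed

text \<open>Fatou's lemma: the bound survives almost sure limits without uniform integrability. The
  weights \<open>Y\<close> are kept fixed, so only they have to be adapted, not the limit.\<close>

lemma exp_integrator_AE_limit:
  fixes M :: "'w measure"
  assumes F: "filtered_prob_space M F"
    and W: "\<And>i. exp_integrator M F n C (W i)"
    and V: "\<And>k. k \<le> n \<Longrightarrow> V k \<in> borel_measurable M"
    and lim: "AE \<omega> in M. \<forall>k\<le>n. (\<lambda>i::nat. W i k \<omega>) \<longlonglongrightarrow> V k \<omega>"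
  shows "exp_integrator M F n C V"
  unfolding exp_integrator_def
proof (intro conjI allI impI V)
  have sub: "subalgebra M (F t)" for t using F by (simp add: filtered_prob_space_def)
  fix Y :: "nat \<Rightarrow> 'w \<Rightarrow> real" assume Y: "\<forall>k<n. Y k \<in> borel_measurable (F (real k / real n)) \<and> (\<forall>\<omega>\<in>space M. \<bar>Y k \<omega>\<bar> \<le> 1)"
  let ?e = "\<lambda>W \<omega>. ennreal (exp (\<Sum>k<n. Y k \<omega> * (W (Suc k) \<omega> - W k \<omega>)))"
  have Ym: "Y k \<in> borel_measurable M" if "k < n" for k
    using Y that measurable_from_subalg[OF sub] by blast
  have Wm: "W i k \<in> borel_measurable M" if "k \<le> n" for i k
    using W that by (auto simp: exp_integrator_def)
  have "(\<integral>\<^sup>+ \<omega>. ?e V \<omega> \<partial>M) = (\<integral>\<^sup>+ \<omega>. liminf (\<lambda>i. ?e (W i) \<omega>) \<partial>M)"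
  proof (rule nn_integral_cong_AE)
    show "AE \<omega> in M. ?e V \<omega> = liminf (\<lambda>i. ?e (W i) \<omega>)"
      using lim
    proof eventually_elim
      case (elim \<omega>)
      have "(\<lambda>i. ?e (W i) \<omega>) \<longlonglongrightarrow> ?e V \<omega>"
        using elim by (intro tendsto_intros) auto
      then show ?case by (intro lim_imp_Liminf[symmetric]) auto
    qed
  qed
  also have "\<dots> \<le> liminf (\<lambda>i. \<integral>\<^sup>+ \<omega>. ?e (W i) \<omega> \<partial>M)"
  proof (rule nn_integral_liminf)
    fix i
    have "(\<lambda>\<omega>. \<Sum>k<n. Y k \<omega> * (W i (Suc k) \<omega> - W i k \<omega>)) \<in> borel_measurable M"
      by (intro borel_measurable_sum borel_measurable_times borel_measurable_diff Ym Wm) auto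
    then show "?e (W i) \<in> borel_measurable M" by measurable
  qed
  also have "\<dots> \<le> liminf (\<lambda>i::nat. ennreal (exp C))"
    using W Y by (intro Liminf_mono always_eventually allI) (simp add: exp_integrator_def)
  also have "\<dots> = ennreal (exp C)" by (rule Liminf_const) simp
  finally show "(\<integral>\<^sup>+ \<omega>. ?e V \<omega> \<partial>M) \<le> ennreal (exp C)" .
qed

section \<open>Brownian increments\<close>

lemma nn_integral_exp_normal_density:
  assumes "0 < \<tau>"
  shows "(\<integral>\<^sup>+ x. ennreal (normal_density 0 \<tau> x) * ennreal (exp (u * x)) \<partial>lborel) = ennreal (exp (u\<^sup>2 * \<tau>\<^sup>2 / 2))"
proof -
  interpret P: prob_space "density lborel (normal_density (u * \<tau>\<^sup>2) \<tau>)" by (rule prob_space_normal_density[OF assms])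
  have one: "(\<integral>\<^sup>+ x. ennreal (normal_density (u * \<tau>\<^sup>2) \<tau> x) \<partial>lborel) = 1"
    using assms P.emeasure_space_1 by (simp add: emeasure_density)
  have "normal_density 0 \<tau> x * exp (u * x) = exp (u\<^sup>2 * \<tau>\<^sup>2 / 2) * normal_density (u * \<tau>\<^sup>2) \<tau> x" for x
  proof -
    \<comment> \<open>Completing the square: multiplying the centred normal density by
      \<open>exp (u * x)\<close> gives a normal density with mean \<open>u * \<tau>\<^sup>2\<close>,
      up to the constant that is the moment sought.\<close>
    have "- (x - 0)\<^sup>2 / (2 * \<tau>\<^sup>2) + u * x = u\<^sup>2 * \<tau>\<^sup>2 / 2 + - (x - u * \<tau>\<^sup>2)\<^sup>2 / (2 * \<tau>\<^sup>2)"
      using assms by (simp add: field_simps power2_eq_square)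
    then have "exp (- (x - 0)\<^sup>2 / (2 * \<tau>\<^sup>2)) * exp (u * x) = exp (u\<^sup>2 * \<tau>\<^sup>2 / 2) * exp (- (x - u * \<tau>\<^sup>2)\<^sup>2 / (2 * \<tau>\<^sup>2))"
      by (simp only: exp_add[symmetric])
    then show ?thesis unfolding normal_density_def by simp
  qed
  then have "(\<integral>\<^sup>+ x. ennreal (normal_density 0 \<tau> x) * ennreal (exp (u * x)) \<partial>lborel)
     = (\<integral>\<^sup>+ x. ennreal (exp (u\<^sup>2 * \<tau>\<^sup>2 / 2)) * ennreal (normal_density (u * \<tau>\<^sup>2) \<tau> x) \<partial>lborel)"
    by (simp add: normal_density_nonneg flip: ennreal_mult)
  also have "\<dots> = ennreal (exp (u\<^sup>2 * \<tau>\<^sup>2 / 2))"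
    by (subst nn_integral_cmult) (simp_all add: one)
  finally show ?thesis .
qed

lemma brownian_exp_integrator:
  fixes B :: "real \<Rightarrow> 'w \<Rightarrow> real ^ 'r"
  assumes F: "filtered_prob_space M F" and B: "brownian_motion M F B" and n: "1 \<le> n"
  shows "exp_integrator M F n (1/2) (\<lambda>k \<omega>. B (real k / real n) \<omega> $ i)"
proof (rule exp_integratorI[OF F n])
  interpret prob_space M using F by (simp add: filtered_prob_space_def)
  have ad: "B t \<in> borel_measurable (F t)" if "0 \<le> t" for t
    using B that by (auto simp: brownian_motion_def adapted_on_def)
  show "(\<lambda>\<omega>. B (real k / real n) \<omega> $ i) \<in> borel_measurable (F (real k / real n))" for k
    using ad[of "real k / real n"] by (intro measurable_compose[OF _ borel_measurable_nth]) auto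
  fix k assume k: "k < n"
  define s t where "s = real k / real n" and "t = real (Suc k) / real n"
  have st: "0 \<le> s" "s < t" "t - s = 1 / real n"
    using k n by (auto simp: s_def t_def field_simps)
  have inc: "distributed M lborel (\<lambda>\<omega>. (B t \<omega> - B s \<omega>) $ i) (normal_density 0 (sqrt (t - s)))"
    "indep_set (sets (F s)) (generated_sets M (\<lambda>u \<omega>. B u \<omega> - B s \<omega>) {t})"
    using B st(1,2) by (auto simp: brownian_motion_def)
  have "{(\<lambda>\<omega>. B t \<omega> $ i - B s \<omega> $ i) -` S \<inter> space M |S. S \<in> sets borel}
     \<subseteq> generated_sets M (\<lambda>u \<omega>. B u \<omega> - B s \<omega>) {t}"
  proof safe
    fix S :: "real set" assume S: "S \<in> sets borel"
    have "(\<lambda>x::real ^ 'r. x $ i) -` S \<in> sets borel"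
      using measurable_sets[OF borel_measurable_nth S] by simp
    moreover have "(\<lambda>\<omega>. B t \<omega> $ i - B s \<omega> $ i) -` S \<inter> space M
      = (\<lambda>\<omega>. B t \<omega> - B s \<omega>) -` ((\<lambda>x::real ^ 'r. x $ i) -` S) \<inter> space M" by auto
    ultimately show "(\<lambda>\<omega>. B t \<omega> $ i - B s \<omega> $ i) -` S \<inter> space M
        \<in> generated_sets M (\<lambda>u \<omega>. B u \<omega> - B s \<omega>) {t}"
      unfolding generated_sets_def by (intro sigma_sets.Basic) blast
  qed
  then show "indep_set (sets (F (real k / real n)))
      {(\<lambda>\<omega>. B (real (Suc k) / real n) \<omega> $ i - B (real k / real n) \<omega> $ i) -` S \<inter> space M |S. S \<in> sets borel}"
    using indep_set_mono_right[OF inc(2)] unfolding s_def t_def by blast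
  fix u :: real assume u: "\<bar>u\<bar> \<le> 1"
  have "(\<integral>\<^sup>+ \<omega>. ennreal (exp (u * (B t \<omega> - B s \<omega>) $ i)) \<partial>M)
     = (\<integral>\<^sup>+ x. ennreal (normal_density 0 (sqrt (t - s)) x) * ennreal (exp (u * x)) \<partial>lborel)"
    by (rule distributed_nn_integral[OF inc(1), symmetric]) simp
  also have "\<dots> = ennreal (exp (u\<^sup>2 * (t - s) / 2))"
    using st n by (subst nn_integral_exp_normal_density) auto
  also have "\<dots> \<le> ennreal (exp ((1/2) / real n))"
  proof -
    have "u\<^sup>2 * (1 / real n) \<le> 1 * (1 / real n)"
      using u by (intro mult_right_mono) (auto simp: abs_square_le_1)
    then show ?thesis using st by (intro ennreal_leI) simp
  qed
  finally show "(\<integral>\<^sup>+ \<omega>. ennreal (exp (u * (B (real (Suc k) / real n) \<omega> $ i - B (real k / real n) \<omega> $ i))) \<partial>M)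
      \<le> ennreal (exp (1 / 2 / real n))" by (simp add: s_def t_def)
qed

section \<open>The compensated small jumps\<close>

lemma norm_annulus_sets:
  assumes "levy_measure (\<nu> :: (real ^ 'd) measure)" "0 \<le> \<delta>"
  shows "{z. \<delta> < norm z} \<in> sets \<nu>" "{z. \<delta> < norm z \<and> norm z \<le> 1} \<in> sets \<nu>"
proof -
  have s: "sets \<nu> = sets (restrict_space borel (- {0}))" using assms by (simp add: levy_measure_def)
  have "{z::real ^ 'd. \<delta> < norm z} \<in> sets borel" "{z::real ^ 'd. \<delta> < norm z \<and> norm z \<le> 1} \<in> sets borel"
    by measurable
  moreover have "- {0::real ^ 'd} \<inter> space borel \<in> sets borel" by simp
  ultimately show "{z. \<delta> < norm z} \<in> sets \<nu>" "{z. \<delta> < norm z \<and> norm z \<le> 1} \<in> sets \<nu>"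
    unfolding s using assms(2) by (auto simp: sets_restrict_space_iff)
qed

lemma levy_measure_space:
  assumes "levy_measure (\<nu> :: (real ^ 'd) measure)"
  shows "space \<nu> = - {0}"
  using sets_eq_imp_space_eq[of \<nu> "restrict_space borel (- {0})"] assms
  by (simp add: levy_measure_def space_restrict_space)

lemma levy_measure_id_measurable:
  assumes "levy_measure (\<nu> :: (real ^ 'd) measure)"
  shows "(\<lambda>z. z) \<in> borel_measurable \<nu>"
proof -
  have "(\<lambda>z. z) \<in> borel_measurable (restrict_space borel (- {0::real ^ 'd}))"
    by (intro measurable_restrict_space1) simp
  moreover have "sets \<nu> = sets (restrict_space borel (- {0}))" using assms by (simp add: levy_measure_def)
  ultimately show ?thesis using measurable_cong_sets[of \<nu> _ borel borel] by blast
qed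

text \<open>On this set the integrand \<open>min ((norm z)\<^sup>2) 1\<close> is at least
  \<open>min (\<delta>\<^sup>2) 1\<close>, so its finite integral bounds the measure.\<close>

lemma levy_measure_finite:
  assumes L: "levy_measure (\<nu> :: (real ^ 'd) measure)" and d: "0 < \<delta>"
  shows "emeasure \<nu> {z. \<delta> < norm z} < \<infinity>"
proof -
  define c where "c = min (\<delta>\<^sup>2) 1"
  have c: "c > 0" using d by (simp add: c_def)
  note [measurable] = norm_annulus_sets(1)[OF L less_imp_le[OF d]]
  have "ennreal c * emeasure \<nu> {z. \<delta> < norm z} = (\<integral>\<^sup>+ z. ennreal c * indicator {z. \<delta> < norm z} z \<partial>\<nu>)"
    by (simp add: nn_integral_cmult_indicator)
  also have "\<dots> \<le> (\<integral>\<^sup>+ z. ennreal (min ((norm z)\<^sup>2) 1) \<partial>\<nu>)"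
  proof (intro nn_integral_mono)
    fix z :: "real ^ 'd"
    have "c \<le> min ((norm z)\<^sup>2) 1" if "\<delta> < norm z"
    proof -
      have "\<delta>\<^sup>2 \<le> (norm z)\<^sup>2" using that d by (intro power_mono) auto
      then show ?thesis by (simp add: c_def)
    qed
    then show "ennreal c * indicator {z. \<delta> < norm z} z \<le> ennreal (min ((norm z)\<^sup>2) 1)"
      by (auto split: split_indicator intro: ennreal_leI)
  qed
  also have "\<dots> < \<infinity>" using L by (simp add: levy_measure_def)
  finally show ?thesis using c by (auto simp: ennreal_mult_less_top)
qed

lemma levy_measure_sigma_finite:
  assumes L: "levy_measure (\<nu> :: (real ^ 'd) measure)"
  shows "sigma_finite_measure \<nu>"
proof
  let ?A = "range (\<lambda>i::nat. {z::real ^ 'd. 1 / real (Suc i) < norm z})"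
  have "z \<in> \<Union> ?A" if z: "z \<noteq> 0" for z :: "real ^ 'd"
  proof -
    obtain i where "inverse (real (Suc i)) < norm z"
      using reals_Archimedean[of "norm z"] z by (metis zero_less_norm_iff)
    then show ?thesis by (auto simp: divide_inverse)
  qed
  then have "\<Union> ?A = space \<nu>" by (auto simp: levy_measure_space[OF L])
  moreover have "countable ?A" by simp
  moreover have "?A \<subseteq> sets \<nu>" using norm_annulus_sets(1)[OF L] by auto
  moreover have "\<forall>a\<in>?A. emeasure \<nu> a \<noteq> \<infinity>" using levy_measure_finite[OF L] by (auto simp: less_top)
  ultimately show "\<exists>A. countable A \<and> A \<subseteq> sets \<nu> \<and> \<Union> A = space \<nu> \<and> (\<forall>a\<in>A. emeasure \<nu> a \<noteq> \<infinity>)"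
    by blast
qed

lemma jump_intensity_rectangle:
  assumes L: "levy_measure (\<nu> :: (real ^ 'd) measure)" and st: "0 \<le> s" "s \<le> t" and Z: "Z \<in> sets \<nu>"
  shows "{s<..t} \<times> Z \<in> sets (jump_intensity \<nu>)"
    and "emeasure (jump_intensity \<nu>) ({s<..t} \<times> Z) = ennreal (t - s) * emeasure \<nu> Z"
    and "measure (jump_intensity \<nu>) ({s<..t} \<times> Z) = (t - s) * measure \<nu> Z"
proof -
  interpret sigma_finite_measure \<nu> by (rule levy_measure_sigma_finite[OF L])
  have I: "{s<..t} \<in> sets (restrict_space lborel {0..})"
    using st by (auto simp: sets_restrict_space_iff)
  show "{s<..t} \<times> Z \<in> sets (jump_intensity \<nu>)"
    unfolding jump_intensity_def by (rule pair_measureI[OF I Z])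
  have "emeasure (restrict_space lborel {0..}) {s<..t} = ennreal (t - s)"
    using st by (subst emeasure_restrict_space) auto
  then show *: "emeasure (jump_intensity \<nu>) ({s<..t} \<times> Z) = ennreal (t - s) * emeasure \<nu> Z"
    unfolding jump_intensity_def by (subst emeasure_pair_measure_Times[OF I Z]) simp
  show "measure (jump_intensity \<nu>) ({s<..t} \<times> Z) = (t - s) * measure \<nu> Z"
    unfolding measure_def * using st by (simp add: enn2real_mult)
qed

lemma jump_size_measurable:
  assumes L: "levy_measure (\<nu> :: (real ^ 'd) measure)" and Q: "sets Q = sets (jump_intensity \<nu>)"
  shows "snd \<in> borel_measurable Q"
proof -
  have "(\<lambda>q. snd q) \<in> borel_measurable (jump_intensity \<nu>)"
    unfolding jump_intensity_def
    by (rule measurable_compose[OF measurable_snd levy_measure_id_measurable[OF L]])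
  then have "snd \<in> borel_measurable (jump_intensity \<nu>)" by simp
  then show ?thesis using measurable_cong_sets[OF Q, of borel borel] by blast
qed

text \<open>It dominates the second moment of the jumps of norm at most 1, and is the exponent
  constant of the small jumps at every truncation level and every resolution.\<close>

definition levy_variance :: "(real ^ 'd) measure \<Rightarrow> real" where
  "levy_variance \<nu> = (\<integral> z. min ((norm z)\<^sup>2) 1 \<partial>\<nu>)"

text \<open>Rounding towards 0 does not increase squares, so the discretised second moment stays
  below a quantity free of \<open>\<delta>\<close>, \<open>m\<close> and \<open>j\<close>. The later
  limits in \<open>m\<close> and \<open>\<delta>\<close> rely on this.\<close>

lemma annulus_second_moment:
  fixes \<nu> :: "(real ^ 'd) measure"
  assumes L: "levy_measure \<nu>" and d: "0 < \<delta>" and m: "0 < m"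
  defines "Z \<equiv> {z. \<delta> < norm z \<and> norm z \<le> 1}"
  shows "(\<Sum>l<2 * m + 1. ((real l - real m) / real m)\<^sup>2 * measure \<nu> {z\<in>Z. z $ j \<in> level_set m l}) \<le> levy_variance \<nu>"
proof -
  note [measurable] = levy_measure_id_measurable[OF L] norm_annulus_sets(2)[OF L less_imp_le[OF d], folded Z_def]
  have fin: "emeasure \<nu> Z < \<infinity>"
    by (rule le_less_trans[OF emeasure_mono levy_measure_finite[OF L d]])
       (use norm_annulus_sets(1)[OF L less_imp_le[OF d]] in \<open>auto simp: Z_def\<close>)
  have z1: "\<bar>z $ j\<bar> \<le> 1" if "z \<in> Z" for z
    using that component_le_norm_cart[of z j] by (auto simp: Z_def)
  have [measurable]: "(\<lambda>z. z $ j) \<in> borel_measurable \<nu>"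
    by (rule measurable_compose[OF levy_measure_id_measurable[OF L] borel_measurable_nth])
  have "(\<Sum>l<2 * m + 1. ((real l - real m) / real m)\<^sup>2 * measure \<nu> {z\<in>Z. z $ j \<in> level_set m l})
      = (LINT z:Z|\<nu>. (trunc_div m (z $ j))\<^sup>2)"
    by (rule level_sum_eq_set_integral[where g="\<lambda>x. x\<^sup>2"]) (use fin z1 m in auto)
  also have "\<dots> \<le> levy_variance \<nu>"
    unfolding set_lebesgue_integral_def levy_variance_def
  proof (rule integral_mono_AE)
    show "integrable \<nu> (\<lambda>z. min ((norm z)\<^sup>2) 1)"
      using L by (intro integrableI_nonneg) (auto simp: levy_measure_def)
    have sq: "(trunc_div m (z $ j))\<^sup>2 \<le> min ((norm z)\<^sup>2) 1" if "z \<in> Z" for z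
    proof -
      have "\<bar>trunc_div m (z $ j)\<bar> \<le> norm z"
        using trunc_div_bounds(1)[OF m, of "z $ j"] component_le_norm_cart[of z j] by simp
      then have "(trunc_div m (z $ j))\<^sup>2 \<le> (norm z)\<^sup>2"
        using power_mono[of "\<bar>trunc_div m (z $ j)\<bar>" "norm z" 2] by simp
      moreover have "(norm z)\<^sup>2 \<le> 1" using that by (simp add: Z_def abs_square_le_1)
      ultimately show ?thesis by simp
    qed
    have "set_integrable \<nu> Z (\<lambda>z. (trunc_div m (z $ j))\<^sup>2)"
      by (rule set_integrable_bounded_finite[where B=1]) (use fin sq in auto)
    then show "integrable \<nu> (\<lambda>z. indicator Z z *\<^sub>R (trunc_div m (z $ j))\<^sup>2)"
      by (simp add: set_integrable_def)
    show "AE z in \<nu>. indicator Z z *\<^sub>R (trunc_div m (z $ j))\<^sup>2 \<le> min ((norm z)\<^sup>2) 1"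
      using sq by (auto split: split_indicator)
  qed
  finally show ?thesis .
qed

text \<open>Coordinate \<open>j\<close> of the compensated jumps in the time interval from
  \<open>s\<close> to \<open>t\<close>, with jump coordinates rounded to multiples of
  \<open>1 / m\<close>. This is a finite combination of Poisson counts over disjoint rectangles,
  hence measurable and with a computable exponential moment.\<close>

definition jump_sums ::
    "(real ^ 'd) measure \<Rightarrow> ('w \<Rightarrow> (real \<times> (real ^ 'd)) measure) \<Rightarrow> real \<Rightarrow> 'd \<Rightarrow> nat \<Rightarrow> real \<Rightarrow> real \<Rightarrow> 'w \<Rightarrow> real" where
  "jump_sums \<nu> N \<delta> j m s t \<omega> =
     (\<Sum>l<2 * m + 1. ((real l - real m) / real m) *
        (measure (N \<omega>) ({s<..t} \<times> {z. (\<delta> < norm z \<and> norm z \<le> 1) \<and> z $ j \<in> level_set m l})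
         - measure (jump_intensity \<nu>) ({s<..t} \<times> {z. (\<delta> < norm z \<and> norm z \<le> 1) \<and> z $ j \<in> level_set m l})))"

lemma level_annulus_sets:
  assumes L: "levy_measure (\<nu> :: (real ^ 'd) measure)" and d: "0 < \<delta>"
  shows "{z. (\<delta> < norm z \<and> norm z \<le> 1) \<and> z $ j \<in> level_set m l} \<in> sets \<nu>"
    and "emeasure \<nu> {z. (\<delta> < norm z \<and> norm z \<le> 1) \<and> z $ j \<in> level_set m l} < \<infinity>"
proof -
  have [measurable]: "(\<lambda>z. z $ j) \<in> borel_measurable \<nu>"
    by (rule measurable_compose[OF levy_measure_id_measurable[OF L] borel_measurable_nth])
  have "{z. (\<delta> < norm z \<and> norm z \<le> 1) \<and> z $ j \<in> level_set m l} =
     {z. \<delta> < norm z \<and> norm z \<le> 1} \<inter> ((\<lambda>z. z $ j) -` level_set m l \<inter> space \<nu>)"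
    using d by (auto simp: levy_measure_space[OF L])
  also have "\<dots> \<in> sets \<nu>"
    by (intro sets.Int norm_annulus_sets(2)[OF L] measurable_sets[of _ \<nu> borel]) (use d in auto)
  finally show "{z. (\<delta> < norm z \<and> norm z \<le> 1) \<and> z $ j \<in> level_set m l} \<in> sets \<nu>" .
  show "emeasure \<nu> {z. (\<delta> < norm z \<and> norm z \<le> 1) \<and> z $ j \<in> level_set m l} < \<infinity>"
    by (rule le_less_trans[OF emeasure_mono levy_measure_finite[OF L d]])
       (use norm_annulus_sets(1)[OF L less_imp_le[OF d]] in auto)
qed

text \<open>Over a grid interval only rectangles strictly after its left endpoint are counted, which
  gives independence of the past. Their intensity is \<open>1 / real n\<close> times the Levy
  measure of the cell, so the exponent is \<open>1 / real n\<close> times a second moment.\<close>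

lemma jump_sums_exp_integrator:
  fixes \<nu> :: "(real ^ 'd) measure"
  assumes F: "filtered_prob_space M F" and n: "1 \<le> n" and L: "levy_measure \<nu>" and d: "0 < \<delta>" and m: "0 < m"
    and P: "poisson_random_measure M (jump_intensity \<nu>) N"
    and C: "filtration_compatible M F (jump_intensity \<nu>) N"
  shows "exp_integrator M F n (levy_variance \<nu>)
     (\<lambda>k \<omega>. \<Sum>i<k. jump_sums \<nu> N \<delta> j m (real i / real n) (real (Suc i) / real n) \<omega>)"
proof (rule exp_integratorI[OF F n])
  interpret prob_space M using F by (simp add: filtered_prob_space_def)
  let ?\<mu> = "jump_intensity \<nu>"
  let ?Z = "\<lambda>l. {z. (\<delta> < norm z \<and> norm z \<le> 1) \<and> z $ j \<in> level_set m l}"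
  let ?t = "\<lambda>k::nat. real k / real n"
  have t: "0 \<le> ?t k" "?t k \<le> ?t (Suc k)" "?t (Suc k) - ?t k = 1 / real n" for k
    using n by (auto simp: field_simps)
  have A: "{?t k<..?t (Suc k)} \<times> ?Z l \<in> sets ?\<mu>" for k l
    by (rule jump_intensity_rectangle(1)[OF L t(1,2) level_annulus_sets(1)[OF L d]])
  have Af: "emeasure ?\<mu> ({?t k<..?t (Suc k)} \<times> ?Z l) < \<infinity>" for k l
    using level_annulus_sets(2)[OF L d, of j m l]
    by (subst jump_intensity_rectangle(2)[OF L t(1,2) level_annulus_sets(1)[OF L d]]) (auto simp: ennreal_mult_less_top)
  have sub: "subalgebra M (F t)" for t using F by (simp add: filtered_prob_space_def)
  have mono: "sets (F s) \<subseteq> sets (F t)" if "s \<le> t" for s t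
    using F that filtration.sets_F_mono[of "space M" F s t] by (simp add: filtered_prob_space_def)
  have sub2: "subalgebra (F t) (F s)" if "s \<le> t" for s t
    using sub[of s] sub[of t] mono[OF that] by (auto simp: subalgebra_def)
  have J: "jump_sums \<nu> N \<delta> j m (?t i) (?t (Suc i)) \<in> borel_measurable (F (?t k))" if "Suc i \<le> k" for i k
  proof -
    have le: "?t (Suc i) \<le> ?t k" using that by (simp add: divide_right_mono)
    have [measurable]: "(\<lambda>\<omega>. emeasure (N \<omega>) ({?t i<..?t (Suc i)} \<times> ?Z l)) \<in> borel_measurable (F (?t k))" for l
    proof -
      have "\<forall>t\<ge>0. \<forall>A\<in>sets ?\<mu>. A \<subseteq> {..t} \<times> UNIV \<longrightarrow> (\<lambda>\<omega>. emeasure (N \<omega>) A) \<in> borel_measurable (F t)"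
        using C unfolding filtration_compatible_def by (elim conjE)
      from this[rule_format, OF t(1) A] have r: "{?t i<..?t (Suc i)} \<times> ?Z l \<subseteq> {..?t k} \<times> UNIV \<Longrightarrow> ?thesis" .
      have "{a<..b} \<subseteq> {..c}" if "b \<le> c" for a b c :: real using that by auto
      from Sigma_mono[OF this[OF le] subset_UNIV] show ?thesis by (rule r)
    qed
    show ?thesis unfolding jump_sums_def[abs_def] measure_def[of "N _"] by measurable
  qed
  show "(\<lambda>\<omega>. \<Sum>i<k. jump_sums \<nu> N \<delta> j m (?t i) (?t (Suc i)) \<omega>) \<in> borel_measurable (F (?t k))" for k
    by (intro borel_measurable_sum J) auto
  have inc: "(\<Sum>i<Suc k. jump_sums \<nu> N \<delta> j m (?t i) (?t (Suc i)) \<omega>) - (\<Sum>i<k. jump_sums \<nu> N \<delta> j m (?t i) (?t (Suc i)) \<omega>)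
     = jump_sums \<nu> N \<delta> j m (?t k) (?t (Suc k)) \<omega>" for k \<omega> by simp
  fix k assume k: "k < n"
  let ?\<A> = "{A \<in> sets ?\<mu>. A \<subseteq> {?t k<..} \<times> UNIV}"
  have "indep_set (sets (F (?t k))) (generated_sets M (\<lambda>A \<omega>. emeasure (N \<omega>) A) ?\<A>)"
    using C t(1) unfolding filtration_compatible_def by blast
  moreover have "{jump_sums \<nu> N \<delta> j m (?t k) (?t (Suc k)) -` S \<inter> space M |S. S \<in> sets borel}
     \<subseteq> generated_sets M (\<lambda>A \<omega>. emeasure (N \<omega>) A) ?\<A>"
  proof safe
    fix S :: "real set" assume S: "S \<in> sets borel"
    have "{?t k<..?t (Suc k)} \<times> ?Z l \<in> ?\<A>" for l using A by auto
    from generated_sets_measurable_combination[where A="\<lambda>l. {?t k<..?t (Suc k)} \<times> ?Z l" and \<A>="?\<A>" and m="2 * m + 1" and N=N and M=M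
         and c="\<lambda>l. (real l - real m) / real m" and d="\<lambda>l. measure ?\<mu> ({?t k<..?t (Suc k)} \<times> ?Z l)", OF this S]
    show "jump_sums \<nu> N \<delta> j m (?t k) (?t (Suc k)) -` S \<inter> space M \<in> generated_sets M (\<lambda>A \<omega>. emeasure (N \<omega>) A) ?\<A>"
      unfolding jump_sums_def[abs_def] by simp
  qed
  ultimately show "indep_set (sets (F (?t k)))
     {(\<lambda>\<omega>. (\<Sum>i<Suc k. jump_sums \<nu> N \<delta> j m (?t i) (?t (Suc i)) \<omega>) - (\<Sum>i<k. jump_sums \<nu> N \<delta> j m (?t i) (?t (Suc i)) \<omega>)) -` S \<inter> space M |S. S \<in> sets borel}"
    unfolding inc by (rule indep_set_mono_right)
  fix u :: real assume u: "\<bar>u\<bar> \<le> 1"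
  let ?c = "\<lambda>l. (real l - real m) / real m"
  have "(\<integral>\<^sup>+ \<omega>. ennreal (exp (u * jump_sums \<nu> N \<delta> j m (?t k) (?t (Suc k)) \<omega>)) \<partial>M)
     \<le> ennreal (exp (\<Sum>l<2 * m + 1. (?c l)\<^sup>2 * measure ?\<mu> ({?t k<..?t (Suc k)} \<times> ?Z l)))"
    unfolding jump_sums_def
  proof (rule poisson_simple_exp_moment[OF P A Af _ _ u])
    have "?Z l \<inter> ?Z l' = {}" if "l \<noteq> l'" for l l' using that m by (auto simp: level_set_def)
    then show "disjoint_family (\<lambda>l. {?t k<..?t (Suc k)} \<times> ?Z l)"
      unfolding disjoint_family_on_def by blast
    show "\<bar>?c l\<bar> \<le> 1" if "l < 2 * m + 1" for l using that m by (auto simp: abs_le_iff field_simps)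
  qed
  also have "(\<Sum>l<2 * m + 1. (?c l)\<^sup>2 * measure ?\<mu> ({?t k<..?t (Suc k)} \<times> ?Z l))
     = (1 / real n) * (\<Sum>l<2 * m + 1. (?c l)\<^sup>2 * measure \<nu> (?Z l))"
    by (simp only: jump_intensity_rectangle(3)[OF L t(1,2) level_annulus_sets(1)[OF L d]] t(3) sum_distrib_left mult.left_commute)
  also have "ennreal (exp ((1 / real n) * (\<Sum>l<2 * m + 1. (?c l)\<^sup>2 * measure \<nu> (?Z l)))) \<le> ennreal (exp (levy_variance \<nu> / real n))"
  proof -
    have "(\<Sum>l<2 * m + 1. (?c l)\<^sup>2 * measure \<nu> (?Z l)) \<le> levy_variance \<nu>"
      using annulus_second_moment[OF L d m, of j] by simp
    then have "(1 / real n) * (\<Sum>l<2 * m + 1. (?c l)\<^sup>2 * measure \<nu> (?Z l)) \<le> (1 / real n) * levy_variance \<nu>"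
      by (rule mult_left_mono) simp
    then show ?thesis by (intro ennreal_leI) simp
  qed
  finally show "(\<integral>\<^sup>+ \<omega>. ennreal (exp (u * ((\<Sum>i<Suc k. jump_sums \<nu> N \<delta> j m (?t i) (?t (Suc i)) \<omega>) - (\<Sum>i<k. jump_sums \<nu> N \<delta> j m (?t i) (?t (Suc i)) \<omega>)))) \<partial>M)
      \<le> ennreal (exp (levy_variance \<nu> / real n))" unfolding inc .
qed

lemma annulus_finite:
  assumes L: "levy_measure (\<nu> :: (real ^ 'd) measure)" and d: "0 < \<delta>"
  shows "emeasure \<nu> {z. \<delta> < norm z \<and> norm z \<le> 1} < \<infinity>"
  by (rule le_less_trans[OF emeasure_mono levy_measure_finite[OF L d]])
     (use norm_annulus_sets(1)[OF L less_imp_le[OF d]] in auto)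

lemma jump_sums_tendsto:
  fixes \<nu> :: "(real ^ 'd) measure"
  assumes L: "levy_measure \<nu>" and d: "0 < \<delta>" and st: "0 \<le> s" "s \<le> t"
    and sets: "sets (N \<omega>) = sets (jump_intensity \<nu>)"
    and fin: "emeasure (N \<omega>) ({s<..t} \<times> {z. \<delta> < norm z \<and> norm z \<le> 1}) < \<infinity>"
  shows "(\<lambda>i. jump_sums \<nu> N \<delta> j (Suc i) s t \<omega>) \<longlonglongrightarrow>
     (LINT q : {s<..t} \<times> {z. \<delta> < norm z \<and> norm z \<le> 1} | N \<omega>. snd q $ j)
     - (t - s) * (LINT z : {z. \<delta> < norm z \<and> norm z \<le> 1} | \<nu>. z $ j)"
proof -
  let ?Z = "{z::real ^ 'd. \<delta> < norm z \<and> norm z \<le> 1}"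
  let ?c = "\<lambda>i l. (real l - real (Suc i)) / real (Suc i)"
  note Z = norm_annulus_sets(2)[OF L less_imp_le[OF d]]
  have z1: "\<bar>z $ j\<bar> \<le> 1" if "z \<in> ?Z" for z
    using that component_le_norm_cart[of z j] by auto
  have "(\<lambda>i. \<Sum>l<2 * Suc i + 1. ?c i l * measure (N \<omega>) {q\<in>{s<..t} \<times> ?Z. snd q $ j \<in> level_set (Suc i) l})
     \<longlonglongrightarrow> (LINT q:{s<..t} \<times> ?Z|N \<omega>. snd q $ j)"
  proof (rule level_sum_tendsto[OF _ fin])
    show "{s<..t} \<times> ?Z \<in> sets (N \<omega>)" unfolding sets by (rule jump_intensity_rectangle(1)[OF L st Z])
    show "(\<lambda>q. snd q $ j) \<in> borel_measurable (N \<omega>)"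
      by (rule measurable_compose[OF jump_size_measurable[OF L sets] borel_measurable_nth])
  qed (use z1 in auto)
  moreover have "(\<lambda>i. \<Sum>l<2 * Suc i + 1. ?c i l * measure \<nu> {z\<in>?Z. z $ j \<in> level_set (Suc i) l})
     \<longlonglongrightarrow> (LINT z:?Z|\<nu>. z $ j)"
    by (rule level_sum_tendsto[OF Z annulus_finite[OF L d]
          measurable_compose[OF levy_measure_id_measurable[OF L] borel_measurable_nth] z1])
  ultimately have lim: "(\<lambda>i. (\<Sum>l<2 * Suc i + 1. ?c i l * measure (N \<omega>) {q\<in>{s<..t} \<times> ?Z. snd q $ j \<in> level_set (Suc i) l})
      - (t - s) * (\<Sum>l<2 * Suc i + 1. ?c i l * measure \<nu> {z\<in>?Z. z $ j \<in> level_set (Suc i) l}))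
     \<longlonglongrightarrow> (LINT q:{s<..t} \<times> ?Z|N \<omega>. snd q $ j) - (t - s) * (LINT z:?Z|\<nu>. z $ j)"
    by (intro tendsto_intros)
  have rect: "{q\<in>{s<..t} \<times> ?Z. snd q $ j \<in> level_set m l} = {s<..t} \<times> {z. (\<delta> < norm z \<and> norm z \<le> 1) \<and> z $ j \<in> level_set m l}" for m l
    by auto
  have "jump_sums \<nu> N \<delta> j (Suc i) s t \<omega> = (\<Sum>l<2 * Suc i + 1. ?c i l * measure (N \<omega>) {q\<in>{s<..t} \<times> ?Z. snd q $ j \<in> level_set (Suc i) l})
      - (t - s) * (\<Sum>l<2 * Suc i + 1. ?c i l * measure \<nu> {z\<in>?Z. z $ j \<in> level_set (Suc i) l})" for i
    unfolding jump_sums_def rect sum_distrib_left sum_subtractf[symmetric]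
    by (rule sum.cong[OF refl])
       (simp only: jump_intensity_rectangle(3)[OF L st level_annulus_sets(1)[OF L d]] mem_Collect_eq right_diff_distrib mult.left_commute)
  then show ?thesis using lim by presburger
qed

lemma compensated_jumps_increment:
  fixes \<nu> :: "(real ^ 'd) measure"
  assumes L: "levy_measure \<nu>" and d: "0 < \<delta>" and st: "0 \<le> s" "s \<le> t"
    and sets: "sets (N \<omega>) = sets (jump_intensity \<nu>)"
    and fin: "emeasure (N \<omega>) ({0<..t} \<times> {z. \<delta> < norm z \<and> norm z \<le> 1}) < \<infinity>"
  shows "(compensated_jumps \<nu> N \<delta> t \<omega> - compensated_jumps \<nu> N \<delta> s \<omega>) $ j =
     (LINT q : {s<..t} \<times> {z. \<delta> < norm z \<and> norm z \<le> 1} | N \<omega>. snd q $ j)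
     - (t - s) * (LINT z : {z. \<delta> < norm z \<and> norm z \<le> 1} | \<nu>. z $ j)"
proof -
  let ?Z = "{z::real ^ 'd. \<delta> < norm z \<and> norm z \<le> 1}"
  note Z = norm_annulus_sets(2)[OF L less_imp_le[OF d]]
  have rect: "{u<..v} \<times> ?Z \<in> sets (N \<omega>)" if "0 \<le> u" "u \<le> v" for u v
    unfolding sets by (rule jump_intensity_rectangle(1)[OF L that Z])
  have finr: "emeasure (N \<omega>) ({u<..v} \<times> ?Z) < \<infinity>" if "0 \<le> u" "u \<le> v" "v \<le> t" for u v
    by (rule le_less_trans[OF emeasure_mono fin]) (use that rect[of 0 t] st in auto)
  have int: "set_integrable (N \<omega>) ({u<..v} \<times> ?Z) snd" if "0 \<le> u" "u \<le> v" "v \<le> t" for u v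
    by (rule set_integrable_bounded_finite[where B=1, OF rect finr jump_size_measurable[OF L sets]]) (use that in auto)
  have un: "{0<..t} \<times> ?Z = {0<..s} \<times> ?Z \<union> {s<..t} \<times> ?Z" using st by auto
  have "(LINT q : {0<..t} \<times> ?Z | N \<omega>. snd q) = (LINT q : {0<..s} \<times> ?Z | N \<omega>. snd q) + (LINT q : {s<..t} \<times> ?Z | N \<omega>. snd q)"
    unfolding un by (rule set_integral_Un) (use int st in auto)
  then have *: "compensated_jumps \<nu> N \<delta> t \<omega> - compensated_jumps \<nu> N \<delta> s \<omega> =
     (LINT q : {s<..t} \<times> ?Z | N \<omega>. snd q) - (t - s) *\<^sub>R (LINT z : ?Z | \<nu>. z)"
    by (simp add: compensated_jumps_def algebra_simps)
  have "(LINT q : {s<..t} \<times> ?Z | N \<omega>. snd q) $ j = (LINT q : {s<..t} \<times> ?Z | N \<omega>. snd q $ j)"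
    using int[OF st order_refl] unfolding set_lebesgue_integral_def set_integrable_def
    by (subst integral_bounded_linear[OF bounded_linear_vec_nth, symmetric]) auto
  moreover have "set_integrable \<nu> ?Z (\<lambda>z. z)"
    by (rule set_integrable_bounded_finite[where B=1, OF Z annulus_finite[OF L d] levy_measure_id_measurable[OF L]]) auto
  then have "(LINT z : ?Z | \<nu>. z) $ j = (LINT z : ?Z | \<nu>. z $ j)"
    unfolding set_lebesgue_integral_def set_integrable_def
    by (subst integral_bounded_linear[OF bounded_linear_vec_nth, symmetric]) auto
  ultimately show ?thesis unfolding * by simp
qed

text \<open>Almost every path has finitely many jumps in the annulus up to time 1, and along it the
  rounded sums converge to the true integrals. \<open>V\<close> is the pointwise limit of these
  sums: it is measurable by construction and agrees with the compensated jumps almost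
  everywhere.\<close>

lemma compensated_jumps_exp_integrator:
  fixes \<nu> :: "(real ^ 'd) measure"
  assumes F: "filtered_prob_space M F" and n: "1 \<le> n" and L: "levy_measure \<nu>" and d: "0 < \<delta>"
    and P: "poisson_random_measure M (jump_intensity \<nu>) N"
    and C: "filtration_compatible M F (jump_intensity \<nu>) N"
  shows "\<exists>V. exp_integrator M F n (levy_variance \<nu>) V \<and>
     (AE \<omega> in M. \<forall>k\<le>n. V k \<omega> = compensated_jumps \<nu> N \<delta> (real k / real n) \<omega> $ j)"
proof -
  interpret prob_space M using F by (simp add: filtered_prob_space_def)
  let ?Z = "{z::real ^ 'd. \<delta> < norm z \<and> norm z \<le> 1}"
  let ?t = "\<lambda>k::nat. real k / real n"
  define W where "W i k \<omega> = (\<Sum>l<k. jump_sums \<nu> N \<delta> j (Suc i) (?t l) (?t (Suc l)) \<omega>)" for i k \<omega>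
  define V where "V k \<omega> = lim (\<lambda>i. W i k \<omega>)" for k \<omega>
  have W: "exp_integrator M F n (levy_variance \<nu>) (W i)" for i
    unfolding W_def[abs_def] by (rule jump_sums_exp_integrator[OF F n L d _ P C]) simp
  have V: "V k \<in> borel_measurable M" if "k \<le> n" for k
    unfolding V_def[abs_def] using W that by (intro borel_measurable_lim_metric) (auto simp: exp_integrator_def)
  note Z = norm_annulus_sets(2)[OF L less_imp_le[OF d]]
  have A: "{0<..1} \<times> ?Z \<in> sets (jump_intensity \<nu>)"
    by (rule jump_intensity_rectangle(1)[OF L _ _ Z]) auto
  have "emeasure (jump_intensity \<nu>) ({0<..1} \<times> ?Z) < \<infinity>"
    using annulus_finite[OF L d] by (subst jump_intensity_rectangle(2)[OF L _ _ Z]) auto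
  from poisson_AE_nat[OF P A this]
  have lim: "AE \<omega> in M. \<forall>k\<le>n. (\<lambda>i. W i k \<omega>) \<longlonglongrightarrow> compensated_jumps \<nu> N \<delta> (?t k) \<omega> $ j"
    using AE_space
  proof (eventually_elim, intro allI impI)
    fix \<omega> k assume ex: "\<exists>m::nat. emeasure (N \<omega>) ({0<..1} \<times> ?Z) = of_nat m" and \<omega>: "\<omega> \<in> space M" and k: "k \<le> n"
    have sets: "sets (N \<omega>) = sets (jump_intensity \<nu>)" using P \<omega> unfolding poisson_random_measure_def by blast
    have fin: "emeasure (N \<omega>) ({s<..t} \<times> ?Z) < \<infinity>" if "0 \<le> s" "t \<le> 1" for s t
    proof -
      have "emeasure (N \<omega>) ({s<..t} \<times> ?Z) \<le> emeasure (N \<omega>) ({0<..1} \<times> ?Z)"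
        using A that by (intro emeasure_mono) (auto simp: sets)
      also have "\<dots> < \<infinity>" using ex by (auto simp: of_nat_less_top)
      finally show ?thesis .
    qed
    have t1: "?t l \<le> 1" if "l \<le> n" for l using that n by (simp add: divide_le_eq_1)
    have t: "0 \<le> ?t l" "?t l \<le> ?t (Suc l)" for l by (auto simp: divide_right_mono)
    show "(\<lambda>i. W i k \<omega>) \<longlonglongrightarrow> compensated_jumps \<nu> N \<delta> (?t k) \<omega> $ j"
      using k
    proof (induction k)
      case 0
      then show ?case by (simp add: W_def compensated_jumps_def set_lebesgue_integral_def)
    next
      case (Suc k)
      have le: "?t (Suc k) \<le> 1" using Suc.prems by (rule t1)
      have "(\<lambda>i. jump_sums \<nu> N \<delta> j (Suc i) (?t k) (?t (Suc k)) \<omega>) \<longlonglongrightarrow>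
        (compensated_jumps \<nu> N \<delta> (?t (Suc k)) \<omega> - compensated_jumps \<nu> N \<delta> (?t k) \<omega>) $ j"
        unfolding compensated_jumps_increment[where N=N and \<omega>=\<omega>, OF L d t sets fin[OF order_refl le]]
        by (rule jump_sums_tendsto[where N=N and \<omega>=\<omega>, OF L d t sets fin[OF t(1) le]])
      moreover have "(\<lambda>i. W i k \<omega>) \<longlonglongrightarrow> compensated_jumps \<nu> N \<delta> (?t k) \<omega> $ j" using Suc by simp
      ultimately have "(\<lambda>i. W i k \<omega> + jump_sums \<nu> N \<delta> j (Suc i) (?t k) (?t (Suc k)) \<omega>) \<longlonglongrightarrow>
         compensated_jumps \<nu> N \<delta> (?t k) \<omega> $ j + (compensated_jumps \<nu> N \<delta> (?t (Suc k)) \<omega> - compensated_jumps \<nu> N \<delta> (?t k) \<omega>) $ j"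
        by (intro tendsto_add)
      then show ?case by (simp add: W_def del: of_nat_Suc)
    qed
  qed
  then have eq: "AE \<omega> in M. \<forall>k\<le>n. V k \<omega> = compensated_jumps \<nu> N \<delta> (?t k) \<omega> $ j"
    by eventually_elim (auto simp: V_def intro: limI)
  have "AE \<omega> in M. \<forall>k\<le>n. (\<lambda>i. W i k \<omega>) \<longlonglongrightarrow> V k \<omega>"
    using lim eq by eventually_elim auto
  from exp_integrator_AE_limit[OF F W V this] eq show ?thesis by blast
qed

text \<open>Indices are chosen with integrals below \<open>(1/2) ^ l\<close>. The series of the
  chosen terms then has finite integral, so it converges almost everywhere and its terms vanish. The
  index map \<open>r\<close> need not be monotone for this.\<close>

lemma AE_subsequence_of_nn_integral_tendsto_0:
  fixes u :: "nat \<Rightarrow> 'w \<Rightarrow> real"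
  assumes u: "\<And>i. u i \<in> borel_measurable M" "\<And>i \<omega>. 0 \<le> u i \<omega>"
    and lim: "(\<lambda>i. \<integral>\<^sup>+ \<omega>. ennreal (u i \<omega>) \<partial>M) \<longlonglongrightarrow> 0"
  shows "\<exists>r. AE \<omega> in M. (\<lambda>i::nat. u (r i) \<omega>) \<longlonglongrightarrow> 0"
proof -
  have "\<exists>i. (\<integral>\<^sup>+ \<omega>. ennreal (u i \<omega>) \<partial>M) < ennreal ((1/2) ^ l)" for l :: nat
  proof -
    have "0 < ennreal ((1/2) ^ l)" by simp
    from order_tendstoD(2)[OF lim this] show ?thesis by (auto simp: eventually_sequentially)
  qed
  then obtain r where r: "\<And>l::nat. (\<integral>\<^sup>+ \<omega>. ennreal (u (r l) \<omega>) \<partial>M) < ennreal ((1/2) ^ l)"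
    by metis
  have "(\<integral>\<^sup>+ \<omega>. (\<Sum>l. ennreal (u (r l) \<omega>)) \<partial>M) = (\<Sum>l. \<integral>\<^sup>+ \<omega>. ennreal (u (r l) \<omega>) \<partial>M)"
    using u(1) by (intro nn_integral_suminf) auto
  also have "\<dots> \<le> (\<Sum>l. ennreal ((1/2) ^ l))"
    by (rule suminf_le[OF less_imp_le[OF r] summableI summableI])
  also have "\<dots> = ennreal (1 / (1 - 1/2))"
    by (rule suminf_ennreal_eq[OF _ geometric_sums]) auto
  finally have "(\<integral>\<^sup>+ \<omega>. (\<Sum>l. ennreal (u (r l) \<omega>)) \<partial>M) \<noteq> \<infinity>" by (auto simp: top_unique)
  then have "AE \<omega> in M. (\<Sum>l. ennreal (u (r l) \<omega>)) \<noteq> \<infinity>"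
    using u(1) by (intro nn_integral_PInf_AE) auto
  then have "AE \<omega> in M. (\<lambda>l. u (r l) \<omega>) \<longlonglongrightarrow> 0"
  proof eventually_elim
    case (elim \<omega>)
    then show ?case using u(2) by (intro summable_LIMSEQ_zero summable_suminf_not_top) auto
  qed
  then show ?thesis by blast
qed

text \<open>Convergence in square mean as the truncation level decreases is converted into almost
  sure convergence along a sequence of levels. Fatou's lemma then applies because the constant of
  the truncated integrals does not depend on the level.\<close>

lemma small_jump_exp_integrator:
  fixes \<nu> :: "(real ^ 'd) measure"
  assumes F: "filtered_prob_space M F" and n: "1 \<le> n" and L: "levy_measure \<nu>"
    and P: "poisson_random_measure M (jump_intensity \<nu>) N"
    and C: "filtration_compatible M F (jump_intensity \<nu>) N"
    and J: "is_compensated_small_jump_integral M \<nu> N J"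
  shows "exp_integrator M F n (levy_variance \<nu>) (\<lambda>k \<omega>. J (real k / real n) \<omega> $ j)"
proof -
  let ?t = "\<lambda>k::nat. real k / real n"
  define \<delta> where "\<delta> i = 1 / real (Suc i)" for i
  have \<delta>0: "0 < \<delta> i" for i by (simp add: \<delta>_def)
  have \<delta>: "filterlim \<delta> (at_right 0) sequentially"
  proof -
    have "\<delta> \<longlonglongrightarrow> 0"
      unfolding \<delta>_def[abs_def] using LIMSEQ_inverse_real_of_nat by (simp only: inverse_eq_divide)
    moreover have "\<forall>\<^sub>F i in sequentially. \<delta> i \<in> {0<..} \<and> \<delta> i \<noteq> 0"
      using \<delta>0 by (intro always_eventually allI) (auto simp: less_imp_neq[symmetric])
    ultimately show ?thesis unfolding filterlim_at by blast
  qed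
  have Jm: "J (?t k) \<in> borel_measurable M" for k using J by (simp add: is_compensated_small_jump_integral_def)
  have Jjm: "(\<lambda>\<omega>. J (?t k) \<omega> $ j) \<in> borel_measurable M" for k
    by (rule measurable_compose[OF Jm borel_measurable_nth])
  have "\<forall>i. \<exists>V. exp_integrator M F n (levy_variance \<nu>) V \<and>
     (AE \<omega> in M. \<forall>k\<le>n. V k \<omega> = compensated_jumps \<nu> N (\<delta> i) (?t k) \<omega> $ j)"
    by (intro allI compensated_jumps_exp_integrator[OF F n L \<delta>0 P C])
  from choice[OF this] obtain V where VV: "\<forall>i. exp_integrator M F n (levy_variance \<nu>) (V i) \<and>
     (AE \<omega> in M. \<forall>k\<le>n. V i k \<omega> = compensated_jumps \<nu> N (\<delta> i) (?t k) \<omega> $ j)"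
    by (rule exE)
  then have V: "exp_integrator M F n (levy_variance \<nu>) (V i)"
    and Veq: "AE \<omega> in M. \<forall>k\<le>n. V i k \<omega> = compensated_jumps \<nu> N (\<delta> i) (?t k) \<omega> $ j" for i
    by simp_all
  have Vm: "V i k \<in> borel_measurable M" if "k \<le> n" for i k using V that by (simp add: exp_integrator_def)
  \<comment> \<open>Adding the squared errors over all grid times yields a single sequence of levels
    that works at every grid time.\<close>
  define u where "u i \<omega> = (\<Sum>k\<le>n. (J (?t k) \<omega> $ j - V i k \<omega>)\<^sup>2)" for i \<omega>
  have um: "u i \<in> borel_measurable M" for i
    unfolding u_def[abs_def] by (intro borel_measurable_sum borel_measurable_power borel_measurable_diff Jjm Vm) auto
  have le: "(\<integral>\<^sup>+ \<omega>. ennreal (u i \<omega>) \<partial>M) \<le> (\<Sum>k\<le>n. \<integral>\<^sup>+ \<omega>. ennreal ((norm (J (?t k) \<omega> - compensated_jumps \<nu> N (\<delta> i) (?t k) \<omega>))\<^sup>2) \<partial>M)" for i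
  proof -
    have "(\<integral>\<^sup>+ \<omega>. ennreal (u i \<omega>) \<partial>M) = (\<Sum>k\<le>n. \<integral>\<^sup>+ \<omega>. ennreal ((J (?t k) \<omega> $ j - V i k \<omega>)\<^sup>2) \<partial>M)"
    proof -
      have "(\<integral>\<^sup>+ \<omega>. ennreal (u i \<omega>) \<partial>M) = (\<integral>\<^sup>+ \<omega>. (\<Sum>k\<le>n. ennreal ((J (?t k) \<omega> $ j - V i k \<omega>)\<^sup>2)) \<partial>M)"
        by (simp add: u_def sum_ennreal)
      also have "\<dots> = (\<Sum>k\<le>n. \<integral>\<^sup>+ \<omega>. ennreal ((J (?t k) \<omega> $ j - V i k \<omega>)\<^sup>2) \<partial>M)"
        by (intro nn_integral_sum measurable_compose[OF _ measurable_ennreal] borel_measurable_power borel_measurable_diff Jjm Vm) auto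
      finally show ?thesis .
    qed
    also have "\<dots> \<le> (\<Sum>k\<le>n. \<integral>\<^sup>+ \<omega>. ennreal ((norm (J (?t k) \<omega> - compensated_jumps \<nu> N (\<delta> i) (?t k) \<omega>))\<^sup>2) \<partial>M)"
    proof (intro sum_mono nn_integral_mono_AE)
      fix k assume k: "k \<in> {..n}"
      show "AE \<omega> in M. ennreal ((J (?t k) \<omega> $ j - V i k \<omega>)\<^sup>2) \<le> ennreal ((norm (J (?t k) \<omega> - compensated_jumps \<nu> N (\<delta> i) (?t k) \<omega>))\<^sup>2)"
        using Veq[of i]
      proof eventually_elim
        case (elim \<omega>)
        let ?x = "J (?t k) \<omega> - compensated_jumps \<nu> N (\<delta> i) (?t k) \<omega>"
        have "J (?t k) \<omega> $ j - V i k \<omega> = ?x $ j" using elim k by simp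
        moreover have "(?x $ j)\<^sup>2 \<le> (norm ?x)\<^sup>2"
          using component_le_norm_cart[of ?x j] power_mono[of "\<bar>?x $ j\<bar>" "norm ?x" 2] by simp
        ultimately show ?case by (simp add: ennreal_leI)
      qed
    qed
    finally show ?thesis .
  qed
  have "(\<lambda>i. \<Sum>k\<le>n. \<integral>\<^sup>+ \<omega>. ennreal ((norm (J (?t k) \<omega> - compensated_jumps \<nu> N (\<delta> i) (?t k) \<omega>))\<^sup>2) \<partial>M) \<longlonglongrightarrow> (\<Sum>k\<le>n. 0)"
  proof (rule tendsto_sum)
    fix k
    have "((\<lambda>\<delta>. \<integral>\<^sup>+ \<omega>. ennreal ((norm (J (?t k) \<omega> - compensated_jumps \<nu> N \<delta> (?t k) \<omega>))\<^sup>2) \<partial>M) \<longlongrightarrow> 0) (at_right 0)"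
      using J by (simp add: is_compensated_small_jump_integral_def)
    from filterlim_compose[OF this \<delta>]
    show "(\<lambda>i. \<integral>\<^sup>+ \<omega>. ennreal ((norm (J (?t k) \<omega> - compensated_jumps \<nu> N (\<delta> i) (?t k) \<omega>))\<^sup>2) \<partial>M) \<longlonglongrightarrow> 0" .
  qed
  then have lim0: "(\<lambda>i. \<Sum>k\<le>n. \<integral>\<^sup>+ \<omega>. ennreal ((norm (J (?t k) \<omega> - compensated_jumps \<nu> N (\<delta> i) (?t k) \<omega>))\<^sup>2) \<partial>M) \<longlonglongrightarrow> 0"
    by simp
  have "(\<lambda>i. \<integral>\<^sup>+ \<omega>. ennreal (u i \<omega>) \<partial>M) \<longlonglongrightarrow> 0"
    by (rule tendsto_sandwich[OF _ _ tendsto_const lim0]) (use le in \<open>auto intro: always_eventually\<close>)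
  moreover have "0 \<le> u i \<omega>" for i \<omega> by (simp add: u_def sum_nonneg)
  ultimately obtain r where r: "AE \<omega> in M. (\<lambda>i::nat. u (r i) \<omega>) \<longlonglongrightarrow> 0"
    using AE_subsequence_of_nn_integral_tendsto_0[of u M, OF um] by blast
  show ?thesis
  proof (rule exp_integrator_AE_limit[OF F V[of "r _"] Jjm])
    show "AE \<omega> in M. \<forall>k\<le>n. (\<lambda>i. V (r i) k \<omega>) \<longlonglongrightarrow> J (?t k) \<omega> $ j"
      using r
    proof (eventually_elim, intro allI impI)
      fix \<omega> k assume lim: "(\<lambda>i. u (r i) \<omega>) \<longlonglongrightarrow> 0" and k: "k \<le> n"
      have "(\<lambda>i. (J (?t k) \<omega> $ j - V (r i) k \<omega>)\<^sup>2) \<longlonglongrightarrow> 0"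
      proof (rule tendsto_sandwich[OF _ _ tendsto_const lim])
        have "(J (?t k) \<omega> $ j - V (r i) k \<omega>)\<^sup>2 \<le> u (r i) \<omega>" for i
          unfolding u_def by (rule member_le_sum[of k "{..n}" "\<lambda>k. (J (?t k) \<omega> $ j - V (r i) k \<omega>)\<^sup>2"]) (use k in auto)
        then show "\<forall>\<^sub>F i in sequentially. (J (?t k) \<omega> $ j - V (r i) k \<omega>)\<^sup>2 \<le> u (r i) \<omega>" by (intro always_eventually) auto
      qed auto
      then have "(\<lambda>i. sqrt ((J (?t k) \<omega> $ j - V (r i) k \<omega>)\<^sup>2)) \<longlonglongrightarrow> 0"
        using tendsto_real_sqrt by fastforce
      then have "(\<lambda>i. J (?t k) \<omega> $ j - V (r i) k \<omega>) \<longlonglongrightarrow> 0"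
        by (simp add: tendsto_rabs_zero_iff)
      then have "(\<lambda>i. J (?t k) \<omega> $ j - (J (?t k) \<omega> $ j - V (r i) k \<omega>)) \<longlonglongrightarrow> J (?t k) \<omega> $ j - 0"
        by (intro tendsto_intros)
      then show "(\<lambda>i. V (r i) k \<omega>) \<longlonglongrightarrow> J (?t k) \<omega> $ j" by simp
    qed
  qed
qed

section \<open>Deterministic estimates\<close>

text \<open>Near each point the values lie within distance 1 of the right value or of the left
  limit, so \<open>f\<close> is locally bounded; a finite subcover makes this global.\<close>

lemma cadlag_on_bounded:
  fixes f :: "real \<Rightarrow> 'b::metric_space"
  assumes f: "cadlag_on T f" and T: "compact T"
  shows "bounded (f ` T)"
proof -
  have "\<exists>U. open U \<and> t \<in> U \<and> bounded (f ` (U \<inter> T))" if t: "t \<in> T" for t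
  proof -
    obtain l where r: "(f \<longlongrightarrow> f t) (at t within (T \<inter> {t<..}))" and l: "(f \<longlongrightarrow> l) (at t within (T \<inter> {..<t}))"
      using f t by (auto simp: cadlag_on_def)
    obtain U1 where U1: "open U1" "t \<in> U1" "\<And>x. x \<in> U1 \<Longrightarrow> x \<noteq> t \<Longrightarrow> x \<in> T \<inter> {t<..} \<Longrightarrow> dist (f x) (f t) < 1"
      using tendstoD[OF r, of 1] unfolding eventually_at_topological by auto
    obtain U2 where U2: "open U2" "t \<in> U2" "\<And>x. x \<in> U2 \<Longrightarrow> x \<noteq> t \<Longrightarrow> x \<in> T \<inter> {..<t} \<Longrightarrow> dist (f x) l < 1"
      using tendstoD[OF l, of 1] unfolding eventually_at_topological by auto
    have "f ` (U1 \<inter> U2 \<inter> T) \<subseteq> ball (f t) 1 \<union> ball l 1"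
    proof safe
      fix x assume x: "x \<in> U1" "x \<in> U2" "x \<in> T" "f x \<notin> ball l 1"
      show "f x \<in> ball (f t) 1"
        using U1(3)[OF x(1)] U2(3)[OF x(2)] x(3,4) by (cases x t rule: linorder_cases) (auto simp: dist_commute)
    qed
    moreover have "bounded (ball (f t) 1 \<union> ball l 1)" by simp
    ultimately have "bounded (f ` (U1 \<inter> U2 \<inter> T))" by (rule bounded_subset[rotated])
    with U1 U2 show ?thesis by (intro exI[of _ "U1 \<inter> U2"]) auto
  qed
  then obtain U where U: "\<And>t. t \<in> T \<Longrightarrow> open (U t) \<and> t \<in> U t \<and> bounded (f ` (U t \<inter> T))" by metis
  then have "T \<subseteq> (\<Union>t\<in>T. U t)" by auto
  then obtain C where C: "C \<subseteq> T" "finite C" "T \<subseteq> (\<Union>t\<in>C. U t)"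
    using compactE_image[OF T, of T U] U by auto
  have "bounded (\<Union>t\<in>C. f ` (U t \<inter> T))" using C U by (intro bounded_UN) auto
  moreover have "f ` T \<subseteq> (\<Union>t\<in>C. f ` (U t \<inter> T))" using C(3) by blast
  ultimately show ?thesis by (rule bounded_subset)
qed

text \<open>The weight \<open>exp (- 2 K t)\<close> turns the integral operator into a contraction with factor \<open>1/2\<close>, so that
  no regularity of \<open>v\<close> beyond boundedness is needed.\<close>

lemma integral_gronwall:
  fixes v g :: "real \<Rightarrow> 'b::euclidean_space"
  assumes K: "0 < K" and bdd: "bounded (v ` {0..1})"
    and g: "\<And>t. t \<in> {0..1} \<Longrightarrow> g integrable_on {0..t}"
    and gv: "\<And>s. s \<in> {0..1} \<Longrightarrow> norm (g s) \<le> K * norm (v s)"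
    and v: "\<And>t. t \<in> {0..1} \<Longrightarrow> norm (v t) \<le> norm (integral {0..t} g) + c"
    and t: "t \<in> {0..1}"
  shows "norm (v t) \<le> 2 * c * exp (2 * K)"
proof -
  define S where "S = (\<lambda>t. exp (- 2 * K * t) * norm (v t)) ` {0..1}"
  from bdd obtain B where "\<forall>x\<in>v ` {0..1}. norm x \<le> B" unfolding bounded_iff by blast
  then have B: "norm (v t) \<le> B" if "t \<in> {0..1}" for t using that by blast
  have "exp (- 2 * K * t) * norm (v t) \<le> B" if "t \<in> {0..1}" for t
  proof -
    have "exp (- 2 * K * t) * norm (v t) \<le> 1 * norm (v t)" using K that by (intro mult_right_mono) auto
    then show ?thesis using B[OF that] by simp
  qed
  then have bS: "bdd_above S" unfolding S_def by (intro bdd_aboveI[of _ B]) auto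
  define w where "w = Sup S"
  have w: "norm (v t) \<le> w * exp (2 * K * t)" if "t \<in> {0..1}" for t
  proof -
    have "exp (- 2 * K * t) * norm (v t) \<le> w" unfolding w_def using bS that by (intro cSup_upper) (auto simp: S_def)
    then show ?thesis by (simp add: exp_minus field_simps)
  qed
  have "exp (- 2 * K * 0) * norm (v 0) \<le> w" unfolding w_def using bS by (intro cSup_upper) (force simp: S_def)+
  then have w0: "0 \<le> w" using order_trans[OF norm_ge_zero] by simp
  have c: "exp (- 2 * K * t) * norm (v t) \<le> w / 2 + c" if t: "t \<in> {0..1}" for t
  proof -
    have hi: "((\<lambda>s. K * w * exp (2 * K * s)) has_integral (w / 2 * exp (2 * K * t) - w / 2 * exp (2 * K * 0))) {0..t}"
    proof (rule fundamental_theorem_of_calculus)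
      fix s assume "s \<in> {0..t}"
      show "((\<lambda>s. w / 2 * exp (2 * K * s)) has_vector_derivative K * w * exp (2 * K * s)) (at s within {0..t})"
        unfolding has_real_derivative_iff_has_vector_derivative[symmetric]
        by (auto intro!: derivative_eq_intros)
    qed (use t in auto)
    have "norm (integral {0..t} g) \<le> integral {0..t} (\<lambda>s. K * w * exp (2 * K * s))"
    proof (rule integral_norm_bound_integral[OF g[OF t]])
      show "(\<lambda>s. K * w * exp (2 * K * s)) integrable_on {0..t}" using hi by blast
      fix s assume "s \<in> {0..t}"
      then have s: "s \<in> {0..1}" using t by auto
      have "norm (g s) \<le> K * norm (v s)" by (rule gv[OF s])
      also have "\<dots> \<le> K * (w * exp (2 * K * s))" using w[OF s] K by (intro mult_left_mono) auto
      finally show "norm (g s) \<le> K * w * exp (2 * K * s)" by simp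
    qed
    also have "\<dots> = w / 2 * exp (2 * K * t) - w / 2 * exp (2 * K * 0)" by (rule integral_unique[OF hi])
    also have "\<dots> \<le> w / 2 * exp (2 * K * t)" using w0 by simp
    finally have "norm (v t) \<le> w / 2 * exp (2 * K * t) + c" using v[OF t] by simp
    then have "exp (- 2 * K * t) * norm (v t) \<le> exp (- 2 * K * t) * (w / 2 * exp (2 * K * t) + c)"
      by (intro mult_left_mono) auto
    also have "\<dots> = w / 2 + exp (- 2 * K * t) * c" by (simp add: exp_minus field_simps)
    also have "\<dots> \<le> w / 2 + c"
    proof -
      have "0 \<le> c" using order_trans[OF norm_ge_zero v[of 0]] by simp
      then have "exp (- 2 * K * t) * c \<le> 1 * c" using K t by (intro mult_right_mono) auto
      then show ?thesis by simp
    qed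
    finally show ?thesis .
  qed
  \<comment> \<open>The inequality \<open>w \<le> w / 2 + c\<close> can be solved for
    \<open>w\<close> since boundedness of \<open>v\<close> makes the weighted supremum finite. This
    is the origin of the factor 2 in the conclusion.\<close>
  have "Sup S \<le> w / 2 + c" by (rule cSup_least) (use c in \<open>auto simp: S_def\<close>)
  then have "w \<le> w / 2 + c" by (simp only: w_def)
  then have "w \<le> 2 * c" by simp
  have "norm (v t) \<le> w * exp (2 * K * t)" by (rule w[OF t])
  also have "\<dots> \<le> 2 * c * exp (2 * K)"
    using \<open>w \<le> 2 * c\<close> w0 t K by (intro mult_mono) auto
  finally show ?thesis .
qed

lemma riemann_sum_lipschitz:
  fixes f :: "real \<Rightarrow> real"
  assumes lip: "\<And>s t. s \<in> {0..1} \<Longrightarrow> t \<in> {0..1} \<Longrightarrow> \<bar>f s - f t\<bar> \<le> C * \<bar>s - t\<bar>" and n: "1 \<le> n"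
  shows "\<bar>(\<Sum>k<n. f (real k / real n) / real n) - integral {0..1} f\<bar> \<le> C / real n"
proof -
  have C: "0 \<le> C" using order_trans[OF abs_ge_zero lip[of 0 1]] by simp
  have cont: "continuous_on {0..1} f"
    by (rule lipschitz_on_continuous_on[OF lipschitz_onI[where L=C]]) (use lip C in \<open>auto simp: dist_real_def\<close>)
  have int: "f integrable_on {a..b}" if "0 \<le> a" "b \<le> 1" for a b
    by (rule integrable_continuous_real[OF continuous_on_subset[OF cont]]) (use that in auto)
  have "\<bar>(\<Sum>k<m. f (real k / real n) / real n) - integral {0..real m / real n} f\<bar> \<le> real m * (C / (real n * real n))"
    if "m \<le> n" for m
    using that
  proof (induction m)
    case (Suc m)
    let ?a = "real m / real n" and ?b = "real (Suc m) / real n"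
    have ab: "0 \<le> ?a" "?a \<le> ?b" "?b \<le> 1" "?b - ?a = 1 / real n"
      using Suc.prems n by (auto simp: field_simps)
    have split: "integral {0..?b} f = integral {0..?a} f + integral {?a..?b} f"
      using ab int by (intro Henstock_Kurzweil_Integration.integral_combine[symmetric]) auto
    have "f ?a / real n - integral {?a..?b} f = integral {?a..?b} (\<lambda>s. f ?a - f s)"
      using ab int[of ?a ?b] by (subst Henstock_Kurzweil_Integration.integral_diff) auto
    also have "\<bar>\<dots>\<bar> \<le> integral {?a..?b} (\<lambda>s. C / real n)"
      unfolding real_norm_def[symmetric]
    proof (rule integral_norm_bound_integral)
      fix s assume s: "s \<in> {?a..?b}"
      have "0 \<le> s" using s order_trans[OF ab(1), of s] by simp
      moreover have "s \<le> 1" using s order_trans[OF _ ab(3), of s] by simp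
      moreover have "?a \<le> 1" using ab(2,3) by (rule order_trans)
      ultimately have "\<bar>f ?a - f s\<bar> \<le> C * \<bar>?a - s\<bar>" using ab(1) by (intro lip) auto
      also have "\<dots> \<le> C * (1 / real n)" using s ab C by (intro mult_left_mono) auto
      finally show "norm (f ?a - f s) \<le> C / real n" by simp
    qed (use ab int[of ?a ?b] in \<open>auto intro: integrable_diff\<close>)
    also have "\<dots> = C / (real n * real n)" using ab by simp
    finally have "\<bar>f ?a / real n - integral {?a..?b} f\<bar> \<le> C / (real n * real n)" .
    moreover have "\<bar>(\<Sum>k<m. f (real k / real n) / real n) - integral {0..?a} f\<bar> \<le> real m * (C / (real n * real n))"
      using Suc by simp
    moreover have "real (Suc m) * (C / (real n * real n)) = real m * (C / (real n * real n)) + C / (real n * real n)"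
      by (simp only: of_nat_Suc distrib_right mult_1 add.commute)
    ultimately show ?case unfolding split sum.lessThan_Suc by linarith
  qed simp
  from this[OF order_refl] show ?thesis using n by simp
qed

section \<open>Lipschitz bounds from partial derivatives\<close>

lemma coordinate_lipschitz_step:
  fixes g :: "real ^ 'p \<Rightarrow> real"
  assumes U: "convex U" and d: "\<And>\<theta>. \<theta> \<in> U \<Longrightarrow> \<exists>d. ((\<lambda>h. g (\<theta> + h *\<^sub>R axis j 1)) has_real_derivative d) (at 0) \<and> \<bar>d\<bar> \<le> B"
    and \<theta>: "\<theta> \<in> U" "\<theta> + h *\<^sub>R axis j 1 \<in> U"
  shows "\<bar>g (\<theta> + h *\<^sub>R axis j 1) - g \<theta>\<bar> \<le> B * \<bar>h\<bar>"
proof -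
  let ?S = "{s. \<theta> + s *\<^sub>R axis j 1 \<in> U}"
  have S: "convex ?S"
  proof (rule convexI)
    fix x y u v :: real assume *: "x \<in> ?S" "y \<in> ?S" "0 \<le> u" "0 \<le> v" "u + v = 1"
    have "u *\<^sub>R (\<theta> + x *\<^sub>R axis j 1) + v *\<^sub>R (\<theta> + y *\<^sub>R axis j 1) \<in> U"
      using * U by (intro convexD) auto
    also have "u *\<^sub>R (\<theta> + x *\<^sub>R axis j 1) + v *\<^sub>R (\<theta> + y *\<^sub>R axis j 1) = (u + v) *\<^sub>R \<theta> + (u *\<^sub>R x + v *\<^sub>R y) *\<^sub>R axis j 1"
      by (simp add: algebra_simps)
    finally show "u *\<^sub>R x + v *\<^sub>R y \<in> ?S" using * by simp
  qed
  have "\<exists>d. ((\<lambda>s. g (\<theta> + s *\<^sub>R axis j 1)) has_real_derivative d) (at s) \<and> \<bar>d\<bar> \<le> B" if s: "s \<in> ?S" for s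
  proof -
    obtain d where d: "((\<lambda>h. g (\<theta> + s *\<^sub>R axis j 1 + h *\<^sub>R axis j 1)) has_real_derivative d) (at 0)" "\<bar>d\<bar> \<le> B"
      using d[of "\<theta> + s *\<^sub>R axis j 1"] s by auto
    have "((\<lambda>h. g (\<theta> + (h + s) *\<^sub>R axis j 1)) has_real_derivative d) (at 0)"
      using d(1) by (simp add: algebra_simps)
    then have "((\<lambda>s. g (\<theta> + s *\<^sub>R axis j 1)) has_real_derivative d) (at (0 + s))"
      by (subst DERIV_shift)
    then show ?thesis using d(2) by auto
  qed
  then obtain d' where d': "\<And>s. s \<in> ?S \<Longrightarrow> ((\<lambda>s. g (\<theta> + s *\<^sub>R axis j 1)) has_real_derivative d' s) (at s) \<and> \<bar>d' s\<bar> \<le> B"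
    by metis
  have "norm (g (\<theta> + h *\<^sub>R axis j 1) - g (\<theta> + 0 *\<^sub>R axis j 1)) \<le> B * norm (h - 0)"
  proof (rule field_differentiable_bound[OF S])
    show "((\<lambda>s. g (\<theta> + s *\<^sub>R axis j 1)) has_field_derivative d' s) (at s within ?S)" if "s \<in> ?S" for s
      using d'[OF that] by (auto intro: has_field_derivative_at_within)
  qed (use d' \<theta> in auto)
  then show ?thesis by simp
qed

text \<open>The increment is made one coordinate at a time. The corners \<open>P I\<close> of this
  axis-parallel path have norm at most that of \<open>v\<close>, so the path stays in the ball; in a
  general convex set it might leave.\<close>

lemma local_lipschitz_of_partial_derivatives:
  fixes g :: "real ^ 'p \<Rightarrow> real"
  assumes d: "\<And>\<theta> j. \<theta> \<in> U \<Longrightarrow> \<exists>d. ((\<lambda>h. g (\<theta> + h *\<^sub>R axis j 1)) has_real_derivative d) (at 0) \<and> \<bar>d\<bar> \<le> B"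
    and r: "ball \<theta> r \<subseteq> U" and v: "norm v < r" and B: "0 \<le> B"
  shows "\<bar>g (\<theta> + v) - g \<theta>\<bar> \<le> B * real CARD('p) * norm v"
proof -
  define P where "P I = (\<chi> i. if i \<in> I then v $ i else 0)" for I
  have nP: "norm (P I) \<le> norm v" for I
    by (rule norm_le_componentwise_cart) (auto simp: P_def)
  have inb: "\<theta> + P I \<in> ball \<theta> r" for I using nP[of I] v by (simp add: dist_norm)
  have "\<bar>g (\<theta> + P I) - g \<theta>\<bar> \<le> B * real (card I) * norm v" for I
  proof (induction I rule: finite_induct[OF finite])
    case 1
    then show ?case by (simp add: P_def zero_vec_def[symmetric])
  next
    case (2 j I)
    have P: "\<theta> + P (insert j I) = \<theta> + P I + v $ j *\<^sub>R axis j 1"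
      using 2(2) by (auto simp: P_def vec_eq_iff axis_def)
    have "\<bar>g (\<theta> + P I + v $ j *\<^sub>R axis j 1) - g (\<theta> + P I)\<bar> \<le> B * \<bar>v $ j\<bar>"
      by (rule coordinate_lipschitz_step[of "ball \<theta> r"]) (use d r inb[of I] inb[of "insert j I"] P in auto)
    also have "\<dots> \<le> B * norm v" using B by (intro mult_left_mono component_le_norm_cart)
    finally have "\<bar>g (\<theta> + P (insert j I)) - g (\<theta> + P I)\<bar> \<le> B * norm v" by (simp only: P)
    moreover have "real (card (insert j I)) = real (card I) + 1" using 2 by simp
    ultimately show ?case using 2(3) by (simp only: distrib_left distrib_right mult_1_right)
  qed
  from this[of UNIV] show ?thesis by (simp add: P_def)
qed

text \<open>A compact segment has a uniform distance to the complement of \<open>U\<close>. Cut into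
  pieces shorter than that, it reduces to the local bound, and since the pieces add up to its length
  the constant is not worsened.\<close>

lemma lipschitz_of_partial_derivatives:
  fixes g :: "real ^ 'p \<Rightarrow> real"
  assumes U: "open U" "convex U"
    and d: "\<And>\<theta> j. \<theta> \<in> U \<Longrightarrow> \<exists>d. ((\<lambda>h. g (\<theta> + h *\<^sub>R axis j 1)) has_real_derivative d) (at 0) \<and> \<bar>d\<bar> \<le> B"
    and B: "0 \<le> B" and x: "x \<in> U" and y: "y \<in> U"
  shows "\<bar>g y - g x\<bar> \<le> B * real CARD('p) * norm (y - x)"
proof -
  have seg: "closed_segment x y \<subseteq> U" by (rule closed_segment_subset[OF x y U(2)])
  obtain r where r: "0 < r" "(\<Union>z\<in>closed_segment x y. ball z r) \<subseteq> U"
    using compact_subset_open_imp_ball_epsilon_subset[OF compact_segment U(1) seg] by blast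
  obtain m :: nat where m: "norm (y - x) / r < real m" using reals_Archimedean2 by blast
  define n where "n = Suc m"
  have n: "0 < real n" "norm (y - x) / real n < r"
    using m r(1) by (auto simp: n_def field_simps intro: less_trans)
  define v where "v = (1 / real n) *\<^sub>R (y - x)"
  have nv: "norm v = norm (y - x) / real n" using n by (simp add: v_def)
  have "\<bar>g (x + real k *\<^sub>R v) - g x\<bar> \<le> real k * (B * real CARD('p) * norm v)" if "k \<le> n" for k
    using that
  proof (induction k)
    case (Suc k)
    have "x + real k *\<^sub>R v \<in> closed_segment x y"
      unfolding in_segment using Suc.prems n(1)
      by (intro exI[of _ "real k / real n"]) (auto simp: v_def algebra_simps)
    then have "ball (x + real k *\<^sub>R v) r \<subseteq> U" using r(2) by blast
    from local_lipschitz_of_partial_derivatives[of U g B, OF d this _ B, of v]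
    have "\<bar>g (x + real k *\<^sub>R v + v) - g (x + real k *\<^sub>R v)\<bar> \<le> B * real CARD('p) * norm v"
      using n(2) nv by simp
    moreover have "x + real k *\<^sub>R v + v = x + real (Suc k) *\<^sub>R v" by (simp add: algebra_simps)
    moreover have "\<bar>g (x + real k *\<^sub>R v) - g x\<bar> \<le> real k * (B * real CARD('p) * norm v)" using Suc by simp
    moreover have "real (Suc k) * (B * real CARD('p) * norm v) = real k * (B * real CARD('p) * norm v) + B * real CARD('p) * norm v"
      by (simp add: distrib_right)
    ultimately show ?case by simp
  qed simp
  from this[OF order_refl] show ?thesis using n(1) nv by (simp add: v_def)
qed

text \<open>Coordinate derivatives in \<theta> are available only in the interior. The estimate is
  proved on \<open>U\<close> and passes to the closure by continuity, the constant at a given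
  \<open>x\<close> being the same for all points of \<open>U\<close>.\<close>

lemma C_poly_growth_lipschitz:
  fixes f :: "real ^ 'd \<Rightarrow> real ^ 'p \<Rightarrow> real"
  assumes f: "f \<in> C_poly_growth k l \<Theta>" and l: "1 \<le> l"
    and U: "open U" "convex U" "\<Theta> = closure U"
  shows "continuous_on (UNIV \<times> \<Theta>) (\<lambda>(x, \<theta>). f x \<theta>)"
    and "\<exists>C>0. \<exists>r>0. \<forall>x. \<forall>\<theta>\<in>\<Theta>. \<forall>\<theta>'\<in>\<Theta>. \<bar>f x \<theta> - f x \<theta>'\<bar> \<le> C * (1 + norm x) powr r * norm (\<theta> - \<theta>')"
proof -
  obtain D C r where D: "partial_derivatives k l \<Theta> f D" and C: "C > 0" "r > 0"
    and bnd: "\<And>\<alpha> \<beta> x \<theta>. sum \<alpha> UNIV \<le> l \<Longrightarrow> sum \<beta> UNIV \<le> k \<Longrightarrow> \<theta> \<in> \<Theta> \<Longrightarrow> \<bar>D \<alpha> \<beta> x \<theta>\<bar> \<le> C * (1 + norm x) powr r"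
    using f unfolding C_poly_growth_def by auto
  have Df: "D (\<lambda>_. 0) (\<lambda>_. 0) x \<theta> = f x \<theta>" if "\<theta> \<in> \<Theta>" for x \<theta>
    using D that unfolding partial_derivatives_def by blast
  have "\<forall>\<alpha> \<beta>. sum \<alpha> UNIV \<le> l \<and> sum \<beta> UNIV \<le> k \<longrightarrow> continuous_on (UNIV \<times> \<Theta>) (\<lambda>(x, \<theta>). D \<alpha> \<beta> x \<theta>)"
    using D unfolding partial_derivatives_def by (elim conjE)
  from this[rule_format, of "\<lambda>_. 0" "\<lambda>_. 0"]
  have "continuous_on (UNIV \<times> \<Theta>) (\<lambda>(x, \<theta>). D (\<lambda>_. 0) (\<lambda>_. 0) x \<theta>)" by simp
  then show cont: "continuous_on (UNIV \<times> \<Theta>) (\<lambda>(x, \<theta>). f x \<theta>)"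
    by (rule continuous_on_eq) (auto simp: Df)
  have UI: "U \<subseteq> interior \<Theta>" using U(1,3) by (simp add: interior_maximal closure_subset)
  have U\<Theta>: "U \<subseteq> \<Theta>" using U(3) by (simp add: closure_subset)
  have lipU: "\<bar>f x \<theta> - f x \<theta>'\<bar> \<le> (C * (1 + norm x) powr r) * real CARD('p) * norm (\<theta> - \<theta>')"
    if "\<theta> \<in> U" "\<theta>' \<in> U" for x \<theta> \<theta>'
  proof -
    have "\<exists>d. ((\<lambda>h. D (\<lambda>_. 0) (\<lambda>_. 0) x (\<theta> + h *\<^sub>R axis j 1)) has_real_derivative d) (at 0) \<and> \<bar>d\<bar> \<le> C * (1 + norm x) powr r"
      if "\<theta> \<in> U" for \<theta> j
    proof -
      have "((\<lambda>h. D (\<lambda>_. 0) (\<lambda>_. 0) x (\<theta> + h *\<^sub>R axis j 1)) has_real_derivative D ((\<lambda>_. 0)(j := Suc 0)) (\<lambda>_. 0) x \<theta>) (at 0)"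
        using D l that UI unfolding partial_derivatives_def
        by (elim conjE) (drule spec[of _ "\<lambda>_. 0"], drule spec[of _ "\<lambda>_. 0"], auto)
      moreover have "\<bar>D ((\<lambda>_. 0)(j := Suc 0)) (\<lambda>_. 0) x \<theta>\<bar> \<le> C * (1 + norm x) powr r"
        using l that U\<Theta> by (intro bnd) (auto simp: sum.If_cases fun_upd_def)
      ultimately show ?thesis by blast
    qed
    from lipschitz_of_partial_derivatives[OF U(1,2) this _ \<open>\<theta>' \<in> U\<close> \<open>\<theta> \<in> U\<close>] C
    have "\<bar>D (\<lambda>_. 0) (\<lambda>_. 0) x \<theta> - D (\<lambda>_. 0) (\<lambda>_. 0) x \<theta>'\<bar> \<le> (C * (1 + norm x) powr r) * real CARD('p) * norm (\<theta> - \<theta>')"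
      by simp
    then show ?thesis using that U\<Theta> by (simp add: Df subset_iff)
  qed
  have "\<bar>f x \<theta> - f x \<theta>'\<bar> \<le> C * real CARD('p) * (1 + norm x) powr r * norm (\<theta> - \<theta>')"
    if \<theta>: "\<theta> \<in> \<Theta>" "\<theta>' \<in> \<Theta>" for x \<theta> \<theta>'
  proof -
    obtain s s' where s: "\<And>n. s n \<in> U" "s \<longlonglongrightarrow> \<theta>" and s': "\<And>n. s' n \<in> U" "s' \<longlonglongrightarrow> \<theta>'"
      using \<theta> unfolding U(3) closure_sequential by blast
    have c: "continuous_on \<Theta> (\<lambda>\<theta>. f x \<theta>)"
      by (rule continuous_on_compose2[OF cont, of _ "\<lambda>\<theta>. (x, \<theta>)", simplified]) (auto intro: continuous_intros)
    have "(\<lambda>n. f x (s n)) \<longlonglongrightarrow> f x \<theta>" "(\<lambda>n. f x (s' n)) \<longlonglongrightarrow> f x \<theta>'"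
      using s s' U\<Theta> \<theta> by (auto intro!: continuous_on_tendsto_compose[OF c] always_eventually)
    then have "(\<lambda>n. \<bar>f x (s n) - f x (s' n)\<bar>) \<longlonglongrightarrow> \<bar>f x \<theta> - f x \<theta>'\<bar>" by (intro tendsto_intros)
    moreover have "(\<lambda>n. (C * (1 + norm x) powr r) * real CARD('p) * norm (s n - s' n)) \<longlonglongrightarrow> (C * (1 + norm x) powr r) * real CARD('p) * norm (\<theta> - \<theta>')"
      using s s' by (intro tendsto_intros)
    ultimately have "\<bar>f x \<theta> - f x \<theta>'\<bar> \<le> (C * (1 + norm x) powr r) * real CARD('p) * norm (\<theta> - \<theta>')"
      by (rule LIMSEQ_le) (use lipU s s' in auto)
    then show ?thesis by (simp add: ac_simps)
  qed
  moreover have "C * real CARD('p) > 0" using C by simp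
  ultimately show "\<exists>C>0. \<exists>r>0. \<forall>x. \<forall>\<theta>\<in>\<Theta>. \<forall>\<theta>'\<in>\<Theta>. \<bar>f x \<theta> - f x \<theta>'\<bar> \<le> C * (1 + norm x) powr r * norm (\<theta> - \<theta>')"
    using C(2) by blast
qed

section \<open>The contrast and the deviation from the deterministic path\<close>

text \<open>The residual at \<theta> is the residual \<open>\<xi> k\<close> at the true value minus
  \<open>g k / n\<close>. After expanding the squares the terms in \<open>\<xi>\<close> alone cancel
  between the two contrasts, and so does the common factor with \<epsilon>.\<close>

lemma contrast_minimizer_inequality:
  fixes b :: "real ^ 'd \<Rightarrow> real ^ 'p \<Rightarrow> real ^ 'd"
  assumes n: "1 \<le> n" and \<epsilon>: "0 < \<epsilon>" and \<theta>\<^sub>0: "\<theta>\<^sub>0 \<in> \<Theta>"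
    and min: "is_arg_min (contrast b n \<epsilon> x) (\<lambda>\<theta>. \<theta> \<in> \<Theta>) \<theta>"
  defines "g \<equiv> \<lambda>k. b (x (real k / real n)) \<theta> - b (x (real k / real n)) \<theta>\<^sub>0"
    and "\<xi> \<equiv> \<lambda>k. x (real (Suc k) / real n) - x (real k / real n) - (1 / real n) *\<^sub>R b (x (real k / real n)) \<theta>\<^sub>0"
  shows "(\<Sum>k<n. (norm (g k))\<^sup>2 / real n) \<le> 2 * (\<Sum>k<n. g k \<bullet> \<xi> k)"
proof -
  have n0: "0 < real n" using n by simp
  have c: "contrast b n \<epsilon> x \<theta>' =
     (\<Sum>k<n. (norm (x (real (Suc k) / real n) - x (real k / real n) - (1 / real n) *\<^sub>R b (x (real k / real n)) \<theta>'))\<^sup>2) / (\<epsilon>\<^sup>2 * (1 / real n))" for \<theta>'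
    unfolding contrast_def sum_divide_distrib One_nat_def sum.atLeast1_atMost_eq by simp
  have "contrast b n \<epsilon> x \<theta> \<le> contrast b n \<epsilon> x \<theta>\<^sub>0"
    using min \<theta>\<^sub>0 unfolding is_arg_min_def by (meson not_less)
  moreover have "0 < \<epsilon>\<^sup>2 * (1 / real n)" using \<epsilon> n0 by simp
  ultimately have "(\<Sum>k<n. (norm (x (real (Suc k) / real n) - x (real k / real n) - (1 / real n) *\<^sub>R b (x (real k / real n)) \<theta>))\<^sup>2)
     \<le> (\<Sum>k<n. (norm (\<xi> k))\<^sup>2)"
    unfolding c \<xi>_def by (simp only: divide_le_cancel)
  also have "(\<Sum>k<n. (norm (x (real (Suc k) / real n) - x (real k / real n) - (1 / real n) *\<^sub>R b (x (real k / real n)) \<theta>))\<^sup>2)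
     = (\<Sum>k<n. (norm (\<xi> k))\<^sup>2 + ((norm (g k))\<^sup>2 / real n - 2 * (g k \<bullet> \<xi> k)) / real n)"
  proof (intro sum.cong refl)
    fix k
    have "x (real (Suc k) / real n) - x (real k / real n) - (1 / real n) *\<^sub>R b (x (real k / real n)) \<theta> = \<xi> k - (1 / real n) *\<^sub>R g k"
      by (simp add: \<xi>_def g_def algebra_simps)
    moreover have "(norm (\<xi> k - (1 / real n) *\<^sub>R g k))\<^sup>2 = (norm (\<xi> k))\<^sup>2 + ((norm (g k))\<^sup>2 / real n - 2 * (g k \<bullet> \<xi> k)) / real n"
      unfolding power2_norm_eq_inner using n0
      by (simp add: inner_diff_left inner_diff_right inner_commute diff_divide_distrib)
    ultimately show "(norm (x (real (Suc k) / real n) - x (real k / real n) - (1 / real n) *\<^sub>R b (x (real k / real n)) \<theta>))\<^sup>2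
      = (norm (\<xi> k))\<^sup>2 + ((norm (g k))\<^sup>2 / real n - 2 * (g k \<bullet> \<xi> k)) / real n" by simp
  qed
  finally have "(\<Sum>k<n. ((norm (g k))\<^sup>2 / real n - 2 * (g k \<bullet> \<xi> k)) / real n) \<le> 0"
    by (simp add: sum.distrib)
  then have "(\<Sum>k<n. (norm (g k))\<^sup>2 / real n - 2 * (g k \<bullet> \<xi> k)) \<le> 0"
    using n0 by (simp add: sum_divide_distrib[symmetric] divide_le_0_iff)
  then show ?thesis by (simp add: sum_subtractf sum_distrib_left)
qed

lemma ode_solution_increment:
  fixes X0 :: "real \<Rightarrow> real ^ 'd"
  assumes ode: "ode_solution f x\<^sub>0 X0" and st: "0 \<le> s" "s \<le> t" "t \<le> 1"
  shows "((\<lambda>s. f (X0 s)) has_integral (X0 t - X0 s)) {s..t}"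
proof (rule fundamental_theorem_of_calculus[OF st(2)])
  fix u assume "u \<in> {s..t}"
  then have "u \<in> {0..1}" using st by auto
  then have "(X0 has_vector_derivative f (X0 u)) (at u within {0..1})"
    using ode by (auto simp: ode_solution_def)
  then show "(X0 has_vector_derivative f (X0 u)) (at u within {s..t})"
    by (rule has_vector_derivative_within_subset) (use st in auto)
qed

lemma ode_solution_continuous:
  fixes X0 :: "real \<Rightarrow> real ^ 'd"
  assumes "ode_solution f x\<^sub>0 X0"
  shows "continuous_on {0..1} X0"
  unfolding continuous_on_eq_continuous_within
  using assms by (auto simp: ode_solution_def intro: has_vector_derivative_continuous)

lemma ode_solution_lipschitz:
  fixes X0 :: "real \<Rightarrow> real ^ 'd"
  assumes ode: "ode_solution f x\<^sub>0 X0" and C: "\<And>t. t \<in> {0..1} \<Longrightarrow> norm (f (X0 t)) \<le> C"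
    and s: "s \<in> {0..1}" and t: "t \<in> {0..1}"
  shows "norm (X0 s - X0 t) \<le> C * \<bar>s - t\<bar>"
proof -
  have C0: "0 \<le> C" using order_trans[OF norm_ge_zero C[of 0]] by simp
  have *: "norm (X0 t - X0 s) \<le> C * (t - s)" if "0 \<le> s" "s \<le> t" "t \<le> 1" for s t
    using has_integral_bound_real[OF C0 finite.emptyI ode_solution_increment[OF ode that]] C that by auto
  show ?thesis
  proof (cases "s \<le> t")
    case True
    then show ?thesis using *[of s t] s t by (simp add: norm_minus_commute)
  next
    case False
    then show ?thesis using *[of t s] s t by simp
  qed
qed

lemma sde_deviation_bound:
  fixes b :: "real ^ 'd \<Rightarrow> real ^ 'd"
  assumes K: "0 < K" and lip: "\<And>x y. norm (b x - b y) \<le> K * norm (x - y)"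
    and ode: "ode_solution b x\<^sub>0 X0" and \<epsilon>: "0 < \<epsilon>"
    and sde: "\<And>t. t \<in> {0..1} \<Longrightarrow> (\<lambda>s. b (x s)) integrable_on {0..t} \<and> x t = x\<^sub>0 + integral {0..t} (\<lambda>s. b (x s)) + \<epsilon> *\<^sub>R l t"
    and bdd: "bounded (x ` {0..1})" and R: "\<And>t. t \<in> {0..1} \<Longrightarrow> norm (l t) \<le> R"
    and t: "t \<in> {0..1}"
  shows "norm (x t - X0 t) \<le> \<epsilon> * (2 * R * exp (2 * K))"
proof -
  have X0: "((\<lambda>s. b (X0 s)) has_integral (X0 t - x\<^sub>0)) {0..t}" if "t \<in> {0..1}" for t
    using ode_solution_increment[OF ode order_refl, of t] that ode by (auto simp: ode_solution_def)
  have "norm (x t - X0 t) \<le> 2 * (\<epsilon> * R) * exp (2 * K)"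
  proof (rule integral_gronwall[where v="\<lambda>t. x t - X0 t" and g="\<lambda>s. b (x s) - b (X0 s)", OF K _ _ lip _ t])
    have "bounded (X0 ` {0..1})"
      by (intro compact_imp_bounded compact_continuous_image ode_solution_continuous[OF ode]) auto
    then show "bounded ((\<lambda>t. x t - X0 t) ` {0..1})" using bdd by (intro bounded_minus_comp)
    fix t :: real assume t: "t \<in> {0..1}"
    show "(\<lambda>s. b (x s) - b (X0 s)) integrable_on {0..t}"
      using sde[OF t] X0[OF t] by (intro integrable_diff) auto
    have "integral {0..t} (\<lambda>s. b (x s) - b (X0 s)) = integral {0..t} (\<lambda>s. b (x s)) - (X0 t - x\<^sub>0)"
      using sde[OF t] X0[OF t] by (subst Henstock_Kurzweil_Integration.integral_diff) (auto simp: integral_unique)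
    then have "x t - X0 t = integral {0..t} (\<lambda>s. b (x s) - b (X0 s)) + \<epsilon> *\<^sub>R l t"
      using sde[OF t] by simp
    then have "norm (x t - X0 t) \<le> norm (integral {0..t} (\<lambda>s. b (x s) - b (X0 s))) + norm (\<epsilon> *\<^sub>R l t)"
      by (simp only: norm_triangle_ineq)
    also have "norm (\<epsilon> *\<^sub>R l t) \<le> \<epsilon> * R" using R[OF t] \<epsilon> by (simp add: mult_left_mono)
    finally show "norm (x t - X0 t) \<le> norm (integral {0..t} (\<lambda>s. b (x s) - b (X0 s))) + \<epsilon> * R" by simp
  qed
  then show ?thesis by (simp add: ac_simps)
qed

text \<open>Three replacements lead from the discrete inequality to the integral: states by the
  deterministic path, the sum by an integral, and the drift over a grid interval by its value at the
  left endpoint. \<open>\<epsilon> \<le> 1\<close> keeps all states in the ball of radius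
  \<open>M0 + H\<close>, where \<open>Gm\<close> bounds the drift differences.\<close>

lemma contrast_identification_bound:
  fixes b :: "real ^ 'd \<Rightarrow> real ^ 'p \<Rightarrow> real ^ 'd"
  assumes K: "0 < K" and lip: "\<And>x y \<theta>. \<theta> \<in> \<Theta> \<Longrightarrow> norm (b x \<theta> - b y \<theta>) \<le> K * norm (x - y)"
    and growth: "\<And>x \<theta>. \<theta> \<in> \<Theta> \<Longrightarrow> norm (b x \<theta>) \<le> K * (1 + norm x)"
    and ode: "ode_solution (\<lambda>x. b x \<theta>\<^sub>0) x\<^sub>0 X0" and M0: "\<And>t. t \<in> {0..1} \<Longrightarrow> norm (X0 t) \<le> M0"
    and \<epsilon>: "0 < \<epsilon>" "\<epsilon> \<le> 1" and n: "1 \<le> n"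
    and sde: "\<And>t. t \<in> {0..1} \<Longrightarrow> (\<lambda>s. b (x s) \<theta>\<^sub>0) integrable_on {0..t} \<and> x t = x\<^sub>0 + integral {0..t} (\<lambda>s. b (x s) \<theta>\<^sub>0) + \<epsilon> *\<^sub>R l t"
    and bdd: "bounded (x ` {0..1})" and R: "\<And>t. t \<in> {0..1} \<Longrightarrow> norm (l t) \<le> R"
    and \<theta>: "\<theta> \<in> \<Theta>" and \<theta>\<^sub>0: "\<theta>\<^sub>0 \<in> \<Theta>"
    and min: "is_arg_min (contrast b n \<epsilon> x) (\<lambda>\<theta>. \<theta> \<in> \<Theta>) \<theta>"
  defines "H \<equiv> 2 * R * exp (2 * K)"
  defines "Gm \<equiv> 2 * K * (1 + M0 + H)"
  shows "integral {0..1} (\<lambda>s. (norm (b (X0 s) \<theta> - b (X0 s) \<theta>\<^sub>0))\<^sup>2) \<le>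
     8 * Gm * K * (\<epsilon> * H) + 6 * Gm * K * (K * (1 + M0)) / real n
     + 2 * \<epsilon> * (\<Sum>k<n. (b (x (real k / real n)) \<theta> - b (x (real k / real n)) \<theta>\<^sub>0) \<bullet> (l (real (Suc k) / real n) - l (real k / real n)))"
proof -
  define t where "t k = real k / real n" for k :: nat
  define g where "g k = b (x (t k)) \<theta> - b (x (t k)) \<theta>\<^sub>0" for k
  define h where "h s = b (X0 s) \<theta> - b (X0 s) \<theta>\<^sub>0" for s
  define C0 where "C0 = K * (1 + M0)"
  have n0: "0 < real n" using n by simp
  have t01: "t k \<in> {0..1}" if "k \<le> n" for k using that n0 by (simp add: t_def)
  have tS: "t k \<le> t (Suc k)" "t (Suc k) - t k = 1 / real n" for k using n0 by (auto simp: t_def field_simps)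
  have M00: "0 \<le> M0" using order_trans[OF norm_ge_zero M0[of 0]] by simp
  have R0: "0 \<le> R" using order_trans[OF norm_ge_zero R[of 0]] by simp
  have H0: "0 \<le> H" using R0 by (simp add: H_def)
  have Gm0: "0 \<le> Gm" using K M00 H0 by (simp add: Gm_def)
  have C00: "0 \<le> C0" using K M00 by (simp add: C0_def)
  have dev: "norm (x s - X0 s) \<le> \<epsilon> * H" if "s \<in> {0..1}" for s
    unfolding H_def by (rule sde_deviation_bound[OF K lip[OF \<theta>\<^sub>0] ode \<epsilon>(1) sde bdd R that])
  have dev': "norm (X0 s - x s) \<le> \<epsilon> * H" if "s \<in> {0..1}" for s
    using dev[OF that] by (simp add: norm_minus_commute)
  have eH: "\<epsilon> * H \<le> H" using \<epsilon> H0 by (simp add: mult_left_le_one_le)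
  have Gb: "norm (b y \<theta> - b y \<theta>\<^sub>0) \<le> Gm" if "norm y \<le> M0 + H" for y
  proof -
    have "norm (b y \<theta> - b y \<theta>\<^sub>0) \<le> K * (1 + norm y) + K * (1 + norm y)"
      using norm_triangle_ineq4[of "b y \<theta>" "b y \<theta>\<^sub>0"] growth[OF \<theta>, of y] growth[OF \<theta>\<^sub>0, of y] by linarith
    also have "\<dots> = 2 * K * (1 + norm y)" by simp
    also have "\<dots> \<le> Gm" unfolding Gm_def using that K by (intro mult_left_mono) auto
    finally show ?thesis .
  qed
  have gG: "norm (g k) \<le> Gm" if "k \<le> n" for k
    unfolding g_def
  proof (rule Gb)
    show "norm (x (t k)) \<le> M0 + H"
      using norm_triangle_ineq[of "X0 (t k)" "x (t k) - X0 (t k)"] dev[OF t01[OF that]] M0[OF t01[OF that]] eH by simp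
  qed
  have hG: "norm (h s) \<le> Gm" if "s \<in> {0..1}" for s
    unfolding h_def using M0[OF that] H0 by (intro Gb) simp
  have bX0: "norm (b (X0 s) \<theta>\<^sub>0) \<le> C0" if "s \<in> {0..1}" for s
    using order_trans[OF growth[OF \<theta>\<^sub>0, of "X0 s"] mult_left_mono[of _ "1 + M0" K]] M0[OF that] K by (simp add: C0_def)
  have X0lip: "norm (X0 s - X0 u) \<le> C0 * \<bar>s - u\<bar>" if "s \<in> {0..1}" "u \<in> {0..1}" for s u
    by (rule ode_solution_lipschitz[OF ode bX0 that])
  have diff2: "norm ((b y \<theta> - b y \<theta>\<^sub>0) - (b z \<theta> - b z \<theta>\<^sub>0)) \<le> 2 * K * norm (y - z)" for y z
    using norm_triangle_ineq4[of "b y \<theta> - b z \<theta>" "b y \<theta>\<^sub>0 - b z \<theta>\<^sub>0"] lip[OF \<theta>, of y z] lip[OF \<theta>\<^sub>0, of y z]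
    by (simp add: algebra_simps)
  have sq: "\<bar>(norm p)\<^sup>2 - (norm q)\<^sup>2\<bar> \<le> 2 * Gm * norm (p - q)" if "norm p \<le> Gm" "norm q \<le> Gm" for p q :: "real ^ 'd"
  proof -
    have "(norm p)\<^sup>2 - (norm q)\<^sup>2 = (norm p - norm q) * (norm p + norm q)"
      by (simp add: power2_eq_square algebra_simps)
    then have "\<bar>(norm p)\<^sup>2 - (norm q)\<^sup>2\<bar> = \<bar>norm p - norm q\<bar> * (norm p + norm q)" by (simp add: abs_mult)
    also have "\<dots> \<le> norm (p - q) * (2 * Gm)"
      using that by (intro mult_mono norm_triangle_ineq3) auto
    finally show ?thesis by (simp add: ac_simps)
  qed
  have hlip: "\<bar>(norm (h s))\<^sup>2 - (norm (h u))\<^sup>2\<bar> \<le> (4 * Gm * K * C0) * \<bar>s - u\<bar>" if "s \<in> {0..1}" "u \<in> {0..1}" for s u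
  proof -
    have "\<bar>(norm (h s))\<^sup>2 - (norm (h u))\<^sup>2\<bar> \<le> 2 * Gm * norm (h s - h u)" by (rule sq[OF hG[OF that(1)] hG[OF that(2)]])
    also have "\<dots> \<le> 2 * Gm * (2 * K * (C0 * \<bar>s - u\<bar>))"
      unfolding h_def using order_trans[OF diff2[of "X0 s" "X0 u"] mult_left_mono[OF X0lip[OF that], of "2 * K"]] K Gm0
      by (intro mult_left_mono) auto
    finally show ?thesis by (simp add: ac_simps)
  qed
  have riem: "\<bar>(\<Sum>k<n. (norm (h (t k)))\<^sup>2 / real n) - integral {0..1} (\<lambda>s. (norm (h s))\<^sup>2)\<bar> \<le> 4 * Gm * K * C0 / real n"
    unfolding t_def by (rule riemann_sum_lipschitz[OF hlip n])
  have avg: "(\<Sum>k<n. c / real n) = c" for c :: real using n0 by simp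
  have hg: "(\<Sum>k<n. (norm (h (t k)))\<^sup>2 / real n) \<le> (\<Sum>k<n. (norm (g k))\<^sup>2 / real n) + 4 * Gm * K * (\<epsilon> * H)"
  proof -
    have "(norm (h (t k)))\<^sup>2 / real n \<le> (norm (g k))\<^sup>2 / real n + 4 * Gm * K * (\<epsilon> * H) / real n" if "k \<in> {..<n}" for k
    proof -
      have k: "k \<le> n" using that by simp
      have "\<bar>(norm (h (t k)))\<^sup>2 - (norm (g k))\<^sup>2\<bar> \<le> 2 * Gm * norm (h (t k) - g k)"
        by (rule sq[OF hG[OF t01[OF k]] gG[OF k]])
      also have "\<dots> \<le> 2 * Gm * (2 * K * (\<epsilon> * H))"
        unfolding h_def g_def
        using order_trans[OF diff2[of "X0 (t k)" "x (t k)"] mult_left_mono[OF dev'[OF t01[OF k]], of "2 * K"]] K Gm0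
        by (intro mult_left_mono) auto
      finally have "(norm (h (t k)))\<^sup>2 \<le> (norm (g k))\<^sup>2 + 4 * Gm * K * (\<epsilon> * H)" by simp
      then show ?thesis using n0 by (simp add: divide_right_mono flip: add_divide_distrib)
    qed
    then have "(\<Sum>k<n. (norm (h (t k)))\<^sup>2 / real n) \<le> (\<Sum>k<n. (norm (g k))\<^sup>2 / real n + 4 * Gm * K * (\<epsilon> * H) / real n)"
      by (rule sum_mono)
    then show ?thesis by (simp only: sum.distrib avg)
  qed
  define \<xi> where "\<xi> k = x (t (Suc k)) - x (t k) - (1 / real n) *\<^sub>R b (x (t k)) \<theta>\<^sub>0" for k
  have basic: "(\<Sum>k<n. (norm (g k))\<^sup>2 / real n) \<le> 2 * (\<Sum>k<n. g k \<bullet> \<xi> k)"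
    using contrast_minimizer_inequality[OF n \<epsilon>(1) \<theta>\<^sub>0 min] unfolding g_def \<xi>_def t_def .
  \<comment> \<open>The residual is the error of freezing the drift plus the noise. On a grid
    interval \<open>x\<close> differs from its left value by at most two deviations
    \<open>\<epsilon> * H\<close> from the deterministic path and one step \<open>C0 / n\<close> of
    that path.\<close>
  have step: "g k \<bullet> \<xi> k \<le> Gm * (K * (2 * (\<epsilon> * H) + C0 / real n)) / real n + \<epsilon> * (g k \<bullet> (l (t (Suc k)) - l (t k)))"
    if "k \<in> {..<n}" for k
  proof -
    have k: "k \<le> n" "Suc k \<le> n" using that by auto
    let ?I = "{t k..t (Suc k)}"
    have I: "s \<in> {0..1}" if "s \<in> ?I" for s
      using that t01[OF k(1)] t01[OF k(2)] by auto
    have i1: "(\<lambda>s. b (x s) \<theta>\<^sub>0) integrable_on {0..t (Suc k)}" using sde[OF t01[OF k(2)]] by blast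
    have iI: "(\<lambda>s. b (x s) \<theta>\<^sub>0) integrable_on ?I"
      using i1 t01[OF k(1)] by (rule_tac integrable_on_subinterval) auto
    have comb: "integral {0..t (Suc k)} (\<lambda>s. b (x s) \<theta>\<^sub>0) = integral {0..t k} (\<lambda>s. b (x s) \<theta>\<^sub>0) + integral ?I (\<lambda>s. b (x s) \<theta>\<^sub>0)"
      using t01[OF k(1)] tS(1) i1 by (intro Henstock_Kurzweil_Integration.integral_combine[symmetric]) auto
    have cst: "integral ?I (\<lambda>s. b (x (t k)) \<theta>\<^sub>0) = (1 / real n) *\<^sub>R b (x (t k)) \<theta>\<^sub>0"
      by (simp only: integral_const_real content_real[OF tS(1)] tS(2))
    have "integral ?I (\<lambda>s. b (x s) \<theta>\<^sub>0 - b (x (t k)) \<theta>\<^sub>0) = integral ?I (\<lambda>s. b (x s) \<theta>\<^sub>0) - (1 / real n) *\<^sub>R b (x (t k)) \<theta>\<^sub>0"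
      by (simp only: Henstock_Kurzweil_Integration.integral_diff[OF iI integrable_const_ivl] cst)
    moreover have "x (t (Suc k)) - x (t k) = integral ?I (\<lambda>s. b (x s) \<theta>\<^sub>0) + \<epsilon> *\<^sub>R (l (t (Suc k)) - l (t k))"
      using sde[OF t01[OF k(1)]] sde[OF t01[OF k(2)]] comb by (simp add: algebra_simps)
    ultimately have \<xi>: "\<xi> k = integral ?I (\<lambda>s. b (x s) \<theta>\<^sub>0 - b (x (t k)) \<theta>\<^sub>0) + \<epsilon> *\<^sub>R (l (t (Suc k)) - l (t k))"
      by (simp add: \<xi>_def)
    have "norm (integral ?I (\<lambda>s. b (x s) \<theta>\<^sub>0 - b (x (t k)) \<theta>\<^sub>0)) \<le> integral ?I (\<lambda>s. K * (2 * (\<epsilon> * H) + C0 / real n))"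
    proof (rule integral_norm_bound_integral)
      fix s assume s: "s \<in> ?I"
      have "norm (x s - x (t k)) \<le> norm (x s - X0 s) + norm (X0 s - X0 (t k)) + norm (x (t k) - X0 (t k))"
        using norm_triangle_ineq4[of "x s - X0 s + (X0 s - X0 (t k))" "x (t k) - X0 (t k)"]
          norm_triangle_ineq[of "x s - X0 s" "X0 s - X0 (t k)"] by simp
      also have "\<dots> \<le> \<epsilon> * H + C0 * (1 / real n) + \<epsilon> * H"
      proof (intro add_mono dev I[OF s] t01 k)
        have "norm (X0 s - X0 (t k)) \<le> C0 * \<bar>s - t k\<bar>" by (rule X0lip[OF I[OF s] t01[OF k(1)]])
        also have "\<dots> \<le> C0 * (1 / real n)" using s tS(2)[of k] C00 by (intro mult_left_mono) auto
        finally show "norm (X0 s - X0 (t k)) \<le> C0 * (1 / real n)" .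
      qed
      finally have "norm (x s - x (t k)) \<le> 2 * (\<epsilon> * H) + C0 / real n" by (simp add: mult.commute)
      then have "K * norm (x s - x (t k)) \<le> K * (2 * (\<epsilon> * H) + C0 / real n)" using K by (intro mult_left_mono) auto
      then show "norm (b (x s) \<theta>\<^sub>0 - b (x (t k)) \<theta>\<^sub>0) \<le> K * (2 * (\<epsilon> * H) + C0 / real n)"
        by (rule order_trans[OF lip[OF \<theta>\<^sub>0]])
    qed (use iI in \<open>auto intro!: integrable_diff\<close>)
    also have "\<dots> = K * (2 * (\<epsilon> * H) + C0 / real n) / real n" using tS[of k] by simp
    finally have I': "norm (integral ?I (\<lambda>s. b (x s) \<theta>\<^sub>0 - b (x (t k)) \<theta>\<^sub>0)) \<le> K * (2 * (\<epsilon> * H) + C0 / real n) / real n" .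
    have "g k \<bullet> integral ?I (\<lambda>s. b (x s) \<theta>\<^sub>0 - b (x (t k)) \<theta>\<^sub>0)
      \<le> norm (g k) * norm (integral ?I (\<lambda>s. b (x s) \<theta>\<^sub>0 - b (x (t k)) \<theta>\<^sub>0))" by (rule norm_cauchy_schwarz)
    also have "\<dots> \<le> Gm * (K * (2 * (\<epsilon> * H) + C0 / real n) / real n)"
      by (rule mult_mono[OF gG[OF k(1)] I' Gm0]) simp
    finally show ?thesis unfolding \<xi> by (simp add: inner_add_right)
  qed
  have "(\<Sum>k<n. g k \<bullet> \<xi> k) \<le> (\<Sum>k<n. Gm * (K * (2 * (\<epsilon> * H) + C0 / real n)) / real n + \<epsilon> * (g k \<bullet> (l (t (Suc k)) - l (t k))))"
    by (rule sum_mono) (rule step)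
  also have "\<dots> = Gm * (K * (2 * (\<epsilon> * H) + C0 / real n)) + \<epsilon> * (\<Sum>k<n. g k \<bullet> (l (t (Suc k)) - l (t k)))"
    by (simp only: sum.distrib avg sum_distrib_left)
  finally have S: "(\<Sum>k<n. g k \<bullet> \<xi> k) \<le> Gm * (K * (2 * (\<epsilon> * H) + C0 / real n)) + \<epsilon> * (\<Sum>k<n. g k \<bullet> (l (t (Suc k)) - l (t k)))" .
  \<comment> \<open>The 8 is 4 from moving the squares to the deterministic path plus 4 from
    freezing the drift; the 6 is 4 from the Riemann sum plus 2 from freezing the drift.\<close>
  have "integral {0..1} (\<lambda>s. (norm (h s))\<^sup>2) \<le> 4 * Gm * K * C0 / real n + 4 * Gm * K * (\<epsilon> * H)
      + 2 * (Gm * (K * (2 * (\<epsilon> * H) + C0 / real n)) + \<epsilon> * (\<Sum>k<n. g k \<bullet> (l (t (Suc k)) - l (t k))))"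
  proof -
    have aux: "I \<le> e1 + e2 + 2 * w" if "\<bar>hs - I\<bar> \<le> e1" "hs \<le> gs + e2" "gs \<le> 2 * z" "z \<le> w"
      for hs I e1 e2 gs z w :: real using that by linarith
    show ?thesis by (rule aux[OF riem hg basic S])
  qed
  also have "\<dots> = 8 * Gm * K * (\<epsilon> * H) + 6 * Gm * K * C0 / real n + 2 * \<epsilon> * (\<Sum>k<n. g k \<bullet> (l (t (Suc k)) - l (t k)))"
    by (simp add: algebra_simps)
  finally show ?thesis unfolding h_def g_def t_def C0_def .
qed

lemma identifiability_gap:
  fixes b :: "real ^ 'd \<Rightarrow> real ^ 'p \<Rightarrow> real ^ 'd"
  assumes cont: "continuous_on (UNIV \<times> \<Theta>) (\<lambda>(x, \<theta>). b x \<theta>)" and \<Theta>: "compact \<Theta>" and \<theta>\<^sub>0: "\<theta>\<^sub>0 \<in> \<Theta>"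
    and X0: "continuous_on {0..1} X0" and A3: "condition_A3 b \<Theta> \<theta>\<^sub>0 X0" and \<delta>: "0 < \<delta>"
  shows "\<exists>\<kappa>>0. \<forall>\<theta>\<in>\<Theta>. \<delta> \<le> dist \<theta> \<theta>\<^sub>0 \<longrightarrow> \<kappa> \<le> integral {0..1} (\<lambda>s. (norm (b (X0 s) \<theta> - b (X0 s) \<theta>\<^sub>0))\<^sup>2)"
proof -
  let ?f = "\<lambda>\<theta> s. (norm (b (X0 s) \<theta> - b (X0 s) \<theta>\<^sub>0))\<^sup>2"
  let ?T = "{\<theta>\<in>\<Theta>. \<delta> \<le> dist \<theta> \<theta>\<^sub>0}"
  have bc: "continuous_on (\<Theta> \<times> {0..1}) (\<lambda>p. b (X0 (snd p)) (fst p))"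
  proof -
    have "continuous_on (\<Theta> \<times> {0..1}) (\<lambda>p. (X0 (snd p), fst p))"
      by (intro continuous_intros continuous_on_compose2[OF X0]) auto
    then have "continuous_on (\<Theta> \<times> {0..1}) (\<lambda>p. (\<lambda>(x, \<theta>). b x \<theta>) (X0 (snd p), fst p))"
      by (rule continuous_on_compose2[OF cont]) auto
    then show ?thesis by simp
  qed
  have b0: "continuous_on (\<Theta> \<times> {0..1}) (\<lambda>p. b (X0 (snd p)) \<theta>\<^sub>0)"
  proof -
    have "continuous_on (\<Theta> \<times> {0..1}) (\<lambda>p. (\<lambda>p. b (X0 (snd p)) (fst p)) (\<theta>\<^sub>0, snd p))"
      by (rule continuous_on_compose2[OF bc continuous_on_Pair[OF continuous_on_const continuous_on_snd[OF continuous_on_id]]])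
        (use \<theta>\<^sub>0 in auto)
    then show ?thesis by simp
  qed
  have jc: "continuous_on (\<Theta> \<times> {0..1}) (\<lambda>p. ?f (fst p) (snd p))"
    by (intro continuous_intros bc b0)
  have fc: "continuous_on {0..1} (?f \<theta>)" if "\<theta> \<in> \<Theta>" for \<theta>
  proof -
    have "continuous_on {0..1} (\<lambda>s. (\<lambda>p. ?f (fst p) (snd p)) (\<theta>, s))"
      by (rule continuous_on_compose2[OF jc continuous_on_Pair[OF continuous_on_const continuous_on_id]]) (use that in auto)
    then show ?thesis by simp
  qed
  have ic: "continuous_on \<Theta> (\<lambda>\<theta>. integral (cbox 0 1) (?f \<theta>))"
    by (rule integral_continuous_on_param) (use jc in \<open>simp add: split_beta\<close>)
  have pos: "0 < integral {0..1} (?f \<theta>)" if \<theta>: "\<theta> \<in> ?T" for \<theta>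
  proof -
    have "\<theta> \<noteq> \<theta>\<^sub>0" "\<theta> \<in> \<Theta>" using \<theta> \<delta> by auto
    then obtain t where t: "t \<in> {0..1}" "b (X0 t) \<theta> \<noteq> b (X0 t) \<theta>\<^sub>0"
      using A3 unfolding condition_A3_def by blast
    \<comment> \<open>A continuous nonnegative integrand with zero integral vanishes identically, so
      separation at the one time \<open>t\<close> already forces positivity.\<close>
    have "integral {0..1} (?f \<theta>) \<noteq> 0"
    proof
      assume "integral {0..1} (?f \<theta>) = 0"
      then have "\<forall>s\<in>{0..1}. ?f \<theta> s = 0"
        using integral_eq_0_iff[of 0 1 "?f \<theta>"] fc[OF \<open>\<theta> \<in> \<Theta>\<close>] by auto
      then show False using t by auto
    qed
    moreover have "0 \<le> integral {0..1} (?f \<theta>)" by (rule integral_nonneg) (use fc[OF \<open>\<theta> \<in> \<Theta>\<close>] in \<open>auto intro: integrable_continuous_real\<close>)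
    ultimately show ?thesis by linarith
  qed
  show ?thesis
  \<comment> \<open>If no parameter is that far from the true one, any positive constant works; the
    minimum below requires a nonempty set.\<close>
  proof (cases "?T = {}")
    case True
    then show ?thesis by (intro exI[of _ 1]) auto
  next
    case False
    have eq: "?T = \<Theta> \<inter> {\<theta>. \<delta> \<le> dist \<theta> \<theta>\<^sub>0}" by auto
    have "closed {\<theta>. \<delta> \<le> dist \<theta> \<theta>\<^sub>0}" by (intro closed_Collect_le continuous_intros)
    then have "compact ?T" unfolding eq by (intro compact_Int_closed[OF \<Theta>])
    moreover have "continuous_on ?T (\<lambda>\<theta>. integral (cbox 0 1) (?f \<theta>))" by (rule continuous_on_subset[OF ic]) auto
    ultimately obtain \<theta>1 where "\<theta>1 \<in> ?T" "\<forall>\<theta>\<in>?T. integral (cbox 0 1) (?f \<theta>1) \<le> integral (cbox 0 1) (?f \<theta>)"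
      using continuous_attains_inf[of ?T "\<lambda>\<theta>. integral (cbox 0 1) (?f \<theta>)"] False by blast
    then show ?thesis using pos by (intro exI[of _ "integral {0..1} (?f \<theta>1)"]) auto
  qed
qed

section \<open>Uniform tightness of the noise\<close>

definition noise_sum ::
    "('x \<Rightarrow> 'p \<Rightarrow> real \<Rightarrow> real \<Rightarrow> 'w \<Rightarrow> real) \<Rightarrow> nat \<Rightarrow> (nat \<Rightarrow> 'w \<Rightarrow> 'x) \<Rightarrow> 'p \<Rightarrow> 'w \<Rightarrow> real" where
  "noise_sum \<Phi> n \<xi> \<theta> \<omega> = (\<Sum>k<n. \<Phi> (\<xi> k \<omega>) \<theta> (real k / real n) (real (Suc k) / real n) \<omega>)"

text \<open>\<open>A\<close> comes before \<open>n\<close> and the states \<open>\<xi>\<close>,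
  while the event \<open>E\<close> may depend on them: this is the uniformity needed when
  \<open>n\<close> and \<epsilon> vary independently. The ball condition on the states is a premise
  inside the event, since the observed states satisfy it only off a small event. Almost everywhere
  statements appear because the decomposition of \<open>L\<close> holds only almost surely.\<close>

definition noise_bounded ::
    "'w measure \<Rightarrow> (real \<Rightarrow> 'w measure) \<Rightarrow> (real ^ 'p) set \<Rightarrow> real \<Rightarrow>
     (real ^ 'd \<Rightarrow> real ^ 'p \<Rightarrow> real \<Rightarrow> real \<Rightarrow> 'w \<Rightarrow> real) \<Rightarrow> real \<Rightarrow> real \<Rightarrow> bool" where
  "noise_bounded M F \<Theta> r \<Phi> \<eta> A \<longleftrightarrow>
     (\<forall>n\<ge>1. \<forall>\<xi>. (\<forall>k<n. \<xi> k \<in> borel_measurable (F (real k / real n))) \<longrightarrow>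
        (\<exists>E\<in>sets M. emeasure M E \<le> ennreal \<eta> \<and>
           (AE \<omega> in M. \<omega> \<notin> E \<longrightarrow> (\<forall>k<n. norm (\<xi> k \<omega>) \<le> r) \<longrightarrow> (\<forall>\<theta>\<in>\<Theta>. \<bar>noise_sum \<Phi> n \<xi> \<theta> \<omega>\<bar> \<le> A))))"

definition uniformly_tight ::
    "'w measure \<Rightarrow> (real \<Rightarrow> 'w measure) \<Rightarrow> (real ^ 'p) set \<Rightarrow> real \<Rightarrow>
     (real ^ 'd \<Rightarrow> real ^ 'p \<Rightarrow> real \<Rightarrow> real \<Rightarrow> 'w \<Rightarrow> real) \<Rightarrow> bool" where
  "uniformly_tight M F \<Theta> r \<Phi> \<longleftrightarrow> (\<forall>\<eta>>0. \<exists>A. noise_bounded M F \<Theta> r \<Phi> \<eta> A)"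

lemma noise_boundedE:
  assumes "noise_bounded M F \<Theta> r \<Phi> \<eta> A" "1 \<le> n" "\<forall>k<n. \<xi> k \<in> borel_measurable (F (real k / real n))"
  obtains E where "E \<in> sets M" "emeasure M E \<le> ennreal \<eta>"
    "AE \<omega> in M. \<omega> \<notin> E \<longrightarrow> (\<forall>k<n. norm (\<xi> k \<omega>) \<le> r) \<longrightarrow> (\<forall>\<theta>\<in>\<Theta>. \<bar>noise_sum \<Phi> n \<xi> \<theta> \<omega>\<bar> \<le> A)"
  using assms unfolding noise_bounded_def by blast

lemma uniformly_tight_add:
  fixes M :: "'w measure" and \<Phi> :: "real ^ 'd \<Rightarrow> real ^ 'p \<Rightarrow> real \<Rightarrow> real \<Rightarrow> 'w \<Rightarrow> real"
  assumes 1: "uniformly_tight M F \<Theta> r \<Phi>" and 2: "uniformly_tight M F \<Theta> r \<Psi>"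
  shows "uniformly_tight M F \<Theta> r (\<lambda>x \<theta> s t \<omega>. \<Phi> x \<theta> s t \<omega> + \<Psi> x \<theta> s t \<omega>)"
  unfolding uniformly_tight_def
proof (intro allI impI)
  fix \<eta> :: real assume "0 < \<eta>"
  then have h: "0 < \<eta> / 2" by simp
  obtain A where A: "noise_bounded M F \<Theta> r \<Phi> (\<eta> / 2) A" using 1 h unfolding uniformly_tight_def by blast
  obtain B where B: "noise_bounded M F \<Theta> r \<Psi> (\<eta> / 2) B" using 2 h unfolding uniformly_tight_def by blast
  show "\<exists>A. noise_bounded M F \<Theta> r (\<lambda>x \<theta> s t \<omega>. \<Phi> x \<theta> s t \<omega> + \<Psi> x \<theta> s t \<omega>) \<eta> A"
    unfolding noise_bounded_def
  proof (intro exI[of _ "A + B"] allI impI)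
    fix n :: nat and \<xi> :: "nat \<Rightarrow> 'w \<Rightarrow> real ^ 'd"
    let ?\<Sigma> = "\<lambda>\<Phi> \<theta> \<omega>. noise_sum \<Phi> n \<xi> \<theta> \<omega>" and ?S = "noise_sum (\<lambda>x \<theta> s t \<omega>. \<Phi> x \<theta> s t \<omega> + \<Psi> x \<theta> s t \<omega>) n \<xi>"
    assume n: "1 \<le> n" and \<xi>: "\<forall>k<n. \<xi> k \<in> borel_measurable (F (real k / real n))"
    obtain E1 where E1: "E1 \<in> sets M" "emeasure M E1 \<le> ennreal (\<eta> / 2)"
      "AE \<omega> in M. \<omega> \<notin> E1 \<longrightarrow> (\<forall>k<n. norm (\<xi> k \<omega>) \<le> r) \<longrightarrow> (\<forall>\<theta>\<in>\<Theta>. \<bar>?\<Sigma> \<Phi> \<theta> \<omega>\<bar> \<le> A)"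
      by (rule noise_boundedE[OF A n \<xi>])
    obtain E2 where E2: "E2 \<in> sets M" "emeasure M E2 \<le> ennreal (\<eta> / 2)"
      "AE \<omega> in M. \<omega> \<notin> E2 \<longrightarrow> (\<forall>k<n. norm (\<xi> k \<omega>) \<le> r) \<longrightarrow> (\<forall>\<theta>\<in>\<Theta>. \<bar>?\<Sigma> \<Psi> \<theta> \<omega>\<bar> \<le> B)"
      by (rule noise_boundedE[OF B n \<xi>])
    have "emeasure M (E1 \<union> E2) \<le> emeasure M E1 + emeasure M E2" using E1 E2 by (intro emeasure_subadditive)
    also have "\<dots> \<le> ennreal (\<eta> / 2) + ennreal (\<eta> / 2)" by (intro add_mono E1 E2)
    also have "\<dots> = ennreal \<eta>" using h by (simp flip: ennreal_plus)
    finally have E: "emeasure M (E1 \<union> E2) \<le> ennreal \<eta>" .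
    have "?S \<theta> \<omega> = ?\<Sigma> \<Phi> \<theta> \<omega> + ?\<Sigma> \<Psi> \<theta> \<omega>" for \<theta> \<omega> by (simp only: noise_sum_def sum.distrib)
    then have bnd: "\<bar>?S \<theta> \<omega>\<bar> \<le> A + B" if "\<bar>?\<Sigma> \<Phi> \<theta> \<omega>\<bar> \<le> A" "\<bar>?\<Sigma> \<Psi> \<theta> \<omega>\<bar> \<le> B" for \<theta> \<omega>
      using that by simp
    have "AE \<omega> in M. \<omega> \<notin> E1 \<union> E2 \<longrightarrow> (\<forall>k<n. norm (\<xi> k \<omega>) \<le> r) \<longrightarrow> (\<forall>\<theta>\<in>\<Theta>. \<bar>?S \<theta> \<omega>\<bar> \<le> A + B)"
      using E1(3) E2(3) by eventually_elim (use bnd in blast)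
    then show "\<exists>E\<in>sets M. emeasure M E \<le> ennreal \<eta> \<and>
       (AE \<omega> in M. \<omega> \<notin> E \<longrightarrow> (\<forall>k<n. norm (\<xi> k \<omega>) \<le> r) \<longrightarrow> (\<forall>\<theta>\<in>\<Theta>. \<bar>?S \<theta> \<omega>\<bar> \<le> A + B))"
      by (intro bexI[of _ "E1 \<union> E2"] conjI sets.Un E E1(1) E2(1))
  qed
qed

lemma uniformly_tight_cmult:
  fixes M :: "'w measure" and \<Phi> :: "real ^ 'd \<Rightarrow> real ^ 'p \<Rightarrow> real \<Rightarrow> real \<Rightarrow> 'w \<Rightarrow> real"
  assumes "uniformly_tight M F \<Theta> r \<Phi>"
  shows "uniformly_tight M F \<Theta> r (\<lambda>x \<theta> s t \<omega>. c * \<Phi> x \<theta> s t \<omega>)"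
  unfolding uniformly_tight_def
proof (intro allI impI)
  fix \<eta> :: real assume "0 < \<eta>"
  then obtain A where A: "noise_bounded M F \<Theta> r \<Phi> \<eta> A" using assms unfolding uniformly_tight_def by blast
  show "\<exists>A. noise_bounded M F \<Theta> r (\<lambda>x \<theta> s t \<omega>. c * \<Phi> x \<theta> s t \<omega>) \<eta> A"
    unfolding noise_bounded_def
  proof (intro exI[of _ "\<bar>c\<bar> * A"] allI impI)
    fix n :: nat and \<xi> :: "nat \<Rightarrow> 'w \<Rightarrow> real ^ 'd"
    let ?S = "noise_sum (\<lambda>x \<theta> s t \<omega>. c * \<Phi> x \<theta> s t \<omega>) n \<xi>"
    assume n: "1 \<le> n" and \<xi>: "\<forall>k<n. \<xi> k \<in> borel_measurable (F (real k / real n))"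
    obtain E where E: "E \<in> sets M" "emeasure M E \<le> ennreal \<eta>"
      and AE: "AE \<omega> in M. \<omega> \<notin> E \<longrightarrow> (\<forall>k<n. norm (\<xi> k \<omega>) \<le> r) \<longrightarrow> (\<forall>\<theta>\<in>\<Theta>. \<bar>noise_sum \<Phi> n \<xi> \<theta> \<omega>\<bar> \<le> A)"
      by (rule noise_boundedE[OF A n \<xi>])
    have "?S \<theta> \<omega> = c * noise_sum \<Phi> n \<xi> \<theta> \<omega>" for \<theta> \<omega> by (simp only: noise_sum_def sum_distrib_left)
    then have bnd: "\<bar>?S \<theta> \<omega>\<bar> \<le> \<bar>c\<bar> * A" if "\<bar>noise_sum \<Phi> n \<xi> \<theta> \<omega>\<bar> \<le> A" for \<theta> \<omega>
      using that by (simp add: abs_mult mult_left_mono)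
    have "AE \<omega> in M. \<omega> \<notin> E \<longrightarrow> (\<forall>k<n. norm (\<xi> k \<omega>) \<le> r) \<longrightarrow> (\<forall>\<theta>\<in>\<Theta>. \<bar>?S \<theta> \<omega>\<bar> \<le> \<bar>c\<bar> * A)"
      using AE by eventually_elim (use bnd in blast)
    with E show "\<exists>E\<in>sets M. emeasure M E \<le> ennreal \<eta> \<and>
       (AE \<omega> in M. \<omega> \<notin> E \<longrightarrow> (\<forall>k<n. norm (\<xi> k \<omega>) \<le> r) \<longrightarrow> (\<forall>\<theta>\<in>\<Theta>. \<bar>?S \<theta> \<omega>\<bar> \<le> \<bar>c\<bar> * A))"
      by blast
  qed
qed

lemma uniformly_tight_zero: "uniformly_tight M F \<Theta> r (\<lambda>x \<theta> s t \<omega>. 0)"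
  unfolding uniformly_tight_def noise_bounded_def noise_sum_def
  by (intro allI impI exI[of _ 0] bexI[of _ "{}"]) auto

lemma uniformly_tight_sum:
  assumes "finite I" "\<And>i. i \<in> I \<Longrightarrow> uniformly_tight M F \<Theta> r (\<Phi> i)"
  shows "uniformly_tight M F \<Theta> r (\<lambda>x \<theta> s t \<omega>. \<Sum>i\<in>I. \<Phi> i x \<theta> s t \<omega>)"
  using assms
proof (induction I)
  case empty
  then show ?case by (simp add: uniformly_tight_zero)
next
  case (insert i I)
  then show ?case using uniformly_tight_add[of M F \<Theta> r "\<Phi> i" "\<lambda>x \<theta> s t \<omega>. \<Sum>i\<in>I. \<Phi> i x \<theta> s t \<omega>"] by simp
qed

lemma uniformly_tight_AE_cong:
  fixes M :: "'w measure" and \<Phi> :: "real ^ 'd \<Rightarrow> real ^ 'p \<Rightarrow> real \<Rightarrow> real \<Rightarrow> 'w \<Rightarrow> real"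
  assumes 1: "uniformly_tight M F \<Theta> r \<Phi>"
    and eq: "AE \<omega> in M. \<forall>x. \<forall>\<theta>\<in>\<Theta>. \<forall>s\<ge>0. \<forall>t\<ge>s. \<Phi> x \<theta> s t \<omega> = \<Psi> x \<theta> s t \<omega>"
  shows "uniformly_tight M F \<Theta> r \<Psi>"
  unfolding uniformly_tight_def
proof (intro allI impI)
  fix \<eta> :: real assume "0 < \<eta>"
  then obtain A where A: "noise_bounded M F \<Theta> r \<Phi> \<eta> A" using 1 unfolding uniformly_tight_def by blast
  show "\<exists>A. noise_bounded M F \<Theta> r \<Psi> \<eta> A"
    unfolding noise_bounded_def
  proof (intro exI[of _ A] allI impI)
    fix n :: nat and \<xi> :: "nat \<Rightarrow> 'w \<Rightarrow> real ^ 'd"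
    assume n: "1 \<le> n" and \<xi>: "\<forall>k<n. \<xi> k \<in> borel_measurable (F (real k / real n))"
    obtain E where E: "E \<in> sets M" "emeasure M E \<le> ennreal \<eta>"
      and AE: "AE \<omega> in M. \<omega> \<notin> E \<longrightarrow> (\<forall>k<n. norm (\<xi> k \<omega>) \<le> r) \<longrightarrow> (\<forall>\<theta>\<in>\<Theta>. \<bar>noise_sum \<Phi> n \<xi> \<theta> \<omega>\<bar> \<le> A)"
      by (rule noise_boundedE[OF A n \<xi>])
    have st: "0 \<le> real k / real n" "real k / real n \<le> real (Suc k) / real n" for k by (auto simp: divide_right_mono)
    have "AE \<omega> in M. \<omega> \<notin> E \<longrightarrow> (\<forall>k<n. norm (\<xi> k \<omega>) \<le> r) \<longrightarrow> (\<forall>\<theta>\<in>\<Theta>. \<bar>noise_sum \<Psi> n \<xi> \<theta> \<omega>\<bar> \<le> A)"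
      using AE eq
    proof eventually_elim
      case (elim \<omega>)
      have "noise_sum \<Psi> n \<xi> \<theta> \<omega> = noise_sum \<Phi> n \<xi> \<theta> \<omega>" if "\<theta> \<in> \<Theta>" for \<theta>
        unfolding noise_sum_def by (intro sum.cong refl elim(2)[rule_format, OF that st, symmetric])
      then show ?case using elim(1) by simp
    qed
    with E show "\<exists>E\<in>sets M. emeasure M E \<le> ennreal \<eta> \<and>
       (AE \<omega> in M. \<omega> \<notin> E \<longrightarrow> (\<forall>k<n. norm (\<xi> k \<omega>) \<le> r) \<longrightarrow> (\<forall>\<theta>\<in>\<Theta>. \<bar>noise_sum \<Psi> n \<xi> \<theta> \<omega>\<bar> \<le> A))"
      by blast
  qed
qed

text \<open>Weights bounded by \<open>G\<close> cost at most \<open>G\<close> times the variation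
  along the grid. No adaptedness is used, and one event serves all grids.\<close>

lemma uniformly_tight_finite_variation:
  fixes M :: "'w measure" and b :: "real ^ 'd \<Rightarrow> real ^ 'p \<Rightarrow> real ^ 'd"
  assumes G: "0 \<le> G" "\<And>x \<theta>. norm x \<le> r \<Longrightarrow> \<theta> \<in> \<Theta> \<Longrightarrow> norm (b x \<theta>) \<le> G"
    and V: "\<And>\<eta>. 0 < \<eta> \<Longrightarrow> \<exists>V. \<exists>E\<in>sets M. emeasure M E \<le> ennreal \<eta> \<and>
       (AE \<omega> in M. \<omega> \<notin> E \<longrightarrow> (\<forall>n\<ge>1. (\<Sum>k<n. norm (P (real (Suc k) / real n) \<omega> - P (real k / real n) \<omega>)) \<le> V))"
  shows "uniformly_tight M F \<Theta> r (\<lambda>x \<theta> s t \<omega>. b x \<theta> \<bullet> (P t \<omega> - P s \<omega>))"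
  unfolding uniformly_tight_def
proof (intro allI impI)
  fix \<eta> :: real assume h: "0 < \<eta>"
  obtain V E where E: "E \<in> sets M" "emeasure M E \<le> ennreal \<eta>"
    and AE: "AE \<omega> in M. \<omega> \<notin> E \<longrightarrow> (\<forall>n\<ge>1. (\<Sum>k<n. norm (P (real (Suc k) / real n) \<omega> - P (real k / real n) \<omega>)) \<le> V)"
    using V[OF h] by blast
  show "\<exists>A. noise_bounded M F \<Theta> r (\<lambda>x \<theta> s t \<omega>. b x \<theta> \<bullet> (P t \<omega> - P s \<omega>)) \<eta> A"
    unfolding noise_bounded_def noise_sum_def
  proof (intro exI[of _ "G * V"] allI impI bexI[OF _ E(1)] conjI E(2))
    fix n :: nat and \<xi> :: "nat \<Rightarrow> 'w \<Rightarrow> real ^ 'd" assume n: "1 \<le> n"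
    show "AE \<omega> in M. \<omega> \<notin> E \<longrightarrow> (\<forall>k<n. norm (\<xi> k \<omega>) \<le> r) \<longrightarrow>
              (\<forall>\<theta>\<in>\<Theta>. \<bar>\<Sum>k<n. b (\<xi> k \<omega>) \<theta> \<bullet> (P (real (Suc k) / real n) \<omega> - P (real k / real n) \<omega>)\<bar> \<le> G * V)"
      using AE
    proof (eventually_elim, intro impI ballI)
      fix \<omega> \<theta>
      assume e: "\<omega> \<notin> E \<longrightarrow> (\<forall>n\<ge>1. (\<Sum>k<n. norm (P (real (Suc k) / real n) \<omega> - P (real k / real n) \<omega>)) \<le> V)"
        "\<omega> \<notin> E" "\<forall>k<n. norm (\<xi> k \<omega>) \<le> r" "\<theta> \<in> \<Theta>"
      let ?d = "\<lambda>k. P (real (Suc k) / real n) \<omega> - P (real k / real n) \<omega>"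
      have "\<bar>\<Sum>k<n. b (\<xi> k \<omega>) \<theta> \<bullet> ?d k\<bar> \<le> (\<Sum>k<n. \<bar>b (\<xi> k \<omega>) \<theta> \<bullet> ?d k\<bar>)" by (rule sum_abs)
      also have "\<dots> \<le> (\<Sum>k<n. G * norm (?d k))"
      proof (rule sum_mono)
        fix k assume "k \<in> {..<n}"
        then have "norm (b (\<xi> k \<omega>) \<theta>) \<le> G" using e by (intro G) auto
        then have "norm (b (\<xi> k \<omega>) \<theta>) * norm (?d k) \<le> G * norm (?d k)" by (rule mult_right_mono) simp
        then show "\<bar>b (\<xi> k \<omega>) \<theta> \<bullet> ?d k\<bar> \<le> G * norm (?d k)" using Cauchy_Schwarz_ineq2 order_trans by blast
      qed
      also have "\<dots> = G * (\<Sum>k<n. norm (?d k))" by (simp only: sum_distrib_left)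
      also have "\<dots> \<le> G * V" using e n G(1) by (intro mult_left_mono) auto
      finally show "\<bar>\<Sum>k<n. b (\<xi> k \<omega>) \<theta> \<bullet> ?d k\<bar> \<le> G * V" .
    qed
  qed
qed

text \<open>Divided by the Lipschitz constant and by the distance of the parameters, differences of
  weights become adapted and bounded by 1. This is exactly the input of an exponential integrator,
  and the resulting moment bound is the hypothesis of chaining.\<close>

lemma uniformly_tight_exp_integrator:
  fixes \<beta> :: "real ^ 'd \<Rightarrow> real ^ 'p \<Rightarrow> real" and W :: "real \<Rightarrow> 'w \<Rightarrow> real"
  assumes F: "filtered_prob_space M F" and \<Theta>: "bounded \<Theta>" "\<theta>\<^sub>0 \<in> \<Theta>"
    and W: "\<And>n. 1 \<le> n \<Longrightarrow> exp_integrator M F n C (\<lambda>k. W (real k / real n))"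
    and \<beta>[measurable]: "\<And>\<theta>. \<theta> \<in> \<Theta> \<Longrightarrow> (\<lambda>x. \<beta> x \<theta>) \<in> borel_measurable borel"
    and cont: "\<And>x. continuous_on \<Theta> (\<beta> x)"
    and \<Lambda>: "0 < \<Lambda>"
    and lip: "\<And>x \<theta> \<theta>'. norm x \<le> r \<Longrightarrow> \<theta> \<in> \<Theta> \<Longrightarrow> \<theta>' \<in> \<Theta> \<Longrightarrow> \<bar>\<beta> x \<theta> - \<beta> x \<theta>'\<bar> \<le> \<Lambda> * norm (\<theta> - \<theta>')"
  shows "uniformly_tight M F \<Theta> r (\<lambda>x \<theta> s t \<omega>. (\<beta> x \<theta> - \<beta> x \<theta>\<^sub>0) * (W t \<omega> - W s \<omega>))"
  unfolding uniformly_tight_def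
proof (intro allI impI)
  interpret prob_space M using F by (simp add: filtered_prob_space_def)
  have sub: "subalgebra M (F t)" for t using F by (simp add: filtered_prob_space_def)
  fix \<eta> :: real assume h: "0 < \<eta>"
  \<comment> \<open>The factor 2 comes from
    \<open>exp \<bar>a\<bar> \<le> exp a + exp (- a)\<close>, as both \<open>Y\<close> and
    \<open>- Y\<close> are admissible weights.\<close>
  have K: "0 \<le> 2 * exp C" by simp
  obtain A where "0 \<le> A" and A: "\<And>S. (\<forall>\<theta>\<in>\<Theta>. S \<theta> \<in> borel_measurable M) \<Longrightarrow>
     (\<forall>\<omega>\<in>space M. continuous_on \<Theta> (\<lambda>\<theta>. S \<theta> \<omega> :: real)) \<Longrightarrow>
     (\<forall>x\<in>\<Theta>. \<forall>y\<in>\<Theta>. x \<noteq> y \<longrightarrow> (\<integral>\<^sup>+ \<omega>. ennreal (exp (\<bar>S x \<omega> - S y \<omega>\<bar> / norm (x - y))) \<partial>M) \<le> ennreal (2 * exp C)) \<Longrightarrow>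
     (\<exists>E\<in>sets M. emeasure M E \<le> ennreal \<eta> \<and> (\<forall>\<omega>\<in>space M - E. \<forall>\<theta>\<in>\<Theta>. \<bar>S \<theta> \<omega> - S \<theta>\<^sub>0 \<omega>\<bar> \<le> A))"
    using subexponential_chaining[OF \<Theta> K h] by blast
  show "\<exists>A. noise_bounded M F \<Theta> r (\<lambda>x \<theta> s t \<omega>. (\<beta> x \<theta> - \<beta> x \<theta>\<^sub>0) * (W t \<omega> - W s \<omega>)) \<eta> A"
    unfolding noise_bounded_def noise_sum_def
  proof (intro exI[of _ "\<Lambda> * A"] allI impI)
    fix n :: nat and \<xi> :: "nat \<Rightarrow> 'w \<Rightarrow> real ^ 'd"
    assume n: "1 \<le> n" and \<xi>: "\<forall>k<n. \<xi> k \<in> borel_measurable (F (real k / real n))"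
    let ?t = "\<lambda>k::nat. real k / real n"
    let ?d = "\<lambda>k \<omega>. W (?t (Suc k)) \<omega> - W (?t k) \<omega>"
    \<comment> \<open>The Lipschitz bound holds only in the ball, but the exponential moment needs
      weights bounded everywhere. The cutoff depends on the present state alone, so adaptedness is
      kept, and it equals 1 on the paths that matter.\<close>
    define cut :: "real ^ 'd \<Rightarrow> real" where "cut = indicator (cball 0 r)"
    have cut_meas[measurable]: "cut \<in> borel_measurable borel" unfolding cut_def by (rule borel_measurable_indicator[OF borel_closed[OF closed_cball]])
    define S where "S \<theta> \<omega> = (\<Sum>k<n. (cut (\<xi> k \<omega>) * \<beta> (\<xi> k \<omega>) \<theta> / \<Lambda>) * ?d k \<omega>)" for \<theta> \<omega>
    have Wm: "W (?t k) \<in> borel_measurable M" if "k \<le> n" for k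
      using W[OF n] that by (simp add: exp_integrator_def)
    have \<xi>M: "\<xi> k \<in> borel_measurable M" if "k < n" for k using \<xi> that measurable_from_subalg[OF sub] by blast
    have Sm: "S \<theta> \<in> borel_measurable M" if "\<theta> \<in> \<Theta>" for \<theta>
    proof -
      have m: "(\<lambda>x. cut x * \<beta> x \<theta> / \<Lambda>) \<in> borel_measurable borel" using \<beta>[OF that] by measurable
      show ?thesis unfolding S_def[abs_def]
        by (intro borel_measurable_sum borel_measurable_times borel_measurable_diff Wm measurable_compose[OF \<xi>M m]) auto
    qed
    have Sc: "continuous_on \<Theta> (\<lambda>\<theta>. S \<theta> \<omega>)" for \<omega>
      unfolding S_def using \<Lambda> by (intro continuous_intros cont) auto
    have Se: "(\<integral>\<^sup>+ \<omega>. ennreal (exp (\<bar>S x \<omega> - S y \<omega>\<bar> / norm (x - y))) \<partial>M) \<le> ennreal (2 * exp C)"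
      if xy: "x \<in> \<Theta>" "y \<in> \<Theta>" "x \<noteq> y" for x y
    proof -
      define Y where "Y k \<omega> = cut (\<xi> k \<omega>) * (\<beta> (\<xi> k \<omega>) x - \<beta> (\<xi> k \<omega>) y) / (\<Lambda> * norm (x - y))" for k \<omega>
      have nz: "norm (x - y) > 0" using xy by simp
      have m: "(\<lambda>z. cut z * (\<beta> z x - \<beta> z y) / (\<Lambda> * norm (x - y))) \<in> borel_measurable borel"
        using \<beta>[OF xy(1)] \<beta>[OF xy(2)] by measurable
      have Ym: "Y k \<in> borel_measurable (F (?t k))" if "k < n" for k
        unfolding Y_def[abs_def] using \<xi> that by (intro measurable_compose[OF _ m]) auto
      have Y1: "\<bar>Y k \<omega>\<bar> \<le> 1" for k \<omega>
        using lip[of "\<xi> k \<omega>" x y] xy nz \<Lambda> by (auto simp: Y_def cut_def indicator_def abs_mult)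
      have eq: "(S x \<omega> - S y \<omega>) / norm (x - y) = (\<Sum>k<n. Y k \<omega> * ?d k \<omega>)" for \<omega>
        unfolding S_def sum_subtractf[symmetric] sum_divide_distrib Y_def
        by (intro sum.cong) (use \<Lambda> nz in \<open>auto simp: field_simps\<close>)
      have i1: "(\<integral>\<^sup>+ \<omega>. ennreal (exp (\<Sum>k<n. Y k \<omega> * ?d k \<omega>)) \<partial>M) \<le> ennreal (exp C)"
        using W[OF n] Ym Y1 unfolding exp_integrator_def by blast
      have "(\<integral>\<^sup>+ \<omega>. ennreal (exp (\<Sum>k<n. - Y k \<omega> * ?d k \<omega>)) \<partial>M) \<le> ennreal (exp C)"
        using W[OF n] Ym Y1 unfolding exp_integrator_def
        by (elim conjE allE[of _ "\<lambda>k \<omega>. - Y k \<omega>"]) auto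
      then have i2: "(\<integral>\<^sup>+ \<omega>. ennreal (exp (- (\<Sum>k<n. Y k \<omega> * ?d k \<omega>))) \<partial>M) \<le> ennreal (exp C)"
        by (simp add: sum_negf)
      have "(\<lambda>\<omega>. \<Sum>k<n. Y k \<omega> * ?d k \<omega>) \<in> borel_measurable M"
        unfolding eq[symmetric] using Sm[OF xy(1)] Sm[OF xy(2)] by measurable
      then have sm[measurable]: "(\<lambda>\<omega>. exp (\<Sum>k<n. Y k \<omega> * ?d k \<omega>)) \<in> borel_measurable M"
        "(\<lambda>\<omega>. exp (- (\<Sum>k<n. Y k \<omega> * ?d k \<omega>))) \<in> borel_measurable M" by measurable
      have "(\<integral>\<^sup>+ \<omega>. ennreal (exp (\<bar>S x \<omega> - S y \<omega>\<bar> / norm (x - y))) \<partial>M)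
        \<le> (\<integral>\<^sup>+ \<omega>. ennreal (exp (\<Sum>k<n. Y k \<omega> * ?d k \<omega>)) + ennreal (exp (- (\<Sum>k<n. Y k \<omega> * ?d k \<omega>))) \<partial>M)"
      proof (rule nn_integral_mono)
        fix \<omega>
        have ab: "exp \<bar>a\<bar> \<le> exp a + exp (- a)" for a :: real by (simp add: abs_if)
        have "\<bar>S x \<omega> - S y \<omega>\<bar> / norm (x - y) = \<bar>\<Sum>k<n. Y k \<omega> * ?d k \<omega>\<bar>"
          unfolding eq[symmetric] using nz by simp
        then show "ennreal (exp (\<bar>S x \<omega> - S y \<omega>\<bar> / norm (x - y))) \<le> ennreal (exp (\<Sum>k<n. Y k \<omega> * ?d k \<omega>)) + ennreal (exp (- (\<Sum>k<n. Y k \<omega> * ?d k \<omega>)))"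
          using ab by (simp add: ennreal_leI del: sum_negf flip: ennreal_plus)
      qed
      also have "\<dots> = (\<integral>\<^sup>+ \<omega>. ennreal (exp (\<Sum>k<n. Y k \<omega> * ?d k \<omega>)) \<partial>M) + (\<integral>\<^sup>+ \<omega>. ennreal (exp (- (\<Sum>k<n. Y k \<omega> * ?d k \<omega>))) \<partial>M)"
        by (rule nn_integral_add) (use sm in auto)
      also have "\<dots> \<le> ennreal (exp C) + ennreal (exp C)" by (rule add_mono[OF i1 i2])
      also have "\<dots> = ennreal (2 * exp C)" by (simp flip: ennreal_plus)
      finally show ?thesis .
    qed
    obtain E where E: "E \<in> sets M" "emeasure M E \<le> ennreal \<eta>"
      and bnd: "\<forall>\<omega>\<in>space M - E. \<forall>\<theta>\<in>\<Theta>. \<bar>S \<theta> \<omega> - S \<theta>\<^sub>0 \<omega>\<bar> \<le> A"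
      using A[of S] Sm Sc Se by blast
    have "\<bar>\<Sum>k<n. (\<beta> (\<xi> k \<omega>) \<theta> - \<beta> (\<xi> k \<omega>) \<theta>\<^sub>0) * ?d k \<omega>\<bar> \<le> \<Lambda> * A"
      if \<omega>: "\<omega> \<in> space M - E" "\<forall>k<n. norm (\<xi> k \<omega>) \<le> r" and \<theta>: "\<theta> \<in> \<Theta>" for \<omega> \<theta>
    proof -
      have "(\<Sum>k<n. (\<beta> (\<xi> k \<omega>) \<theta> - \<beta> (\<xi> k \<omega>) \<theta>\<^sub>0) * ?d k \<omega>) = \<Lambda> * (S \<theta> \<omega> - S \<theta>\<^sub>0 \<omega>)"
        unfolding S_def sum_subtractf[symmetric] sum_distrib_left
        by (intro sum.cong) (use \<Lambda> \<omega>(2) in \<open>auto simp: cut_def field_simps\<close>)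
      then have "\<bar>\<Sum>k<n. (\<beta> (\<xi> k \<omega>) \<theta> - \<beta> (\<xi> k \<omega>) \<theta>\<^sub>0) * ?d k \<omega>\<bar> = \<Lambda> * \<bar>S \<theta> \<omega> - S \<theta>\<^sub>0 \<omega>\<bar>"
        using \<Lambda> by (simp add: abs_mult)
      also have "\<dots> \<le> \<Lambda> * A" using bnd \<omega>(1) \<theta> \<Lambda> by (intro mult_left_mono) auto
      finally show ?thesis .
    qed
    then have "AE \<omega> in M. \<omega> \<notin> E \<longrightarrow> (\<forall>k<n. norm (\<xi> k \<omega>) \<le> r) \<longrightarrow>
              (\<forall>\<theta>\<in>\<Theta>. \<bar>\<Sum>k<n. (\<beta> (\<xi> k \<omega>) \<theta> - \<beta> (\<xi> k \<omega>) \<theta>\<^sub>0) * ?d k \<omega>\<bar> \<le> \<Lambda> * A)"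
      by (intro AE_I2) blast
    with E show "\<exists>E\<in>sets M. emeasure M E \<le> ennreal \<eta> \<and>
           (AE \<omega> in M. \<omega> \<notin> E \<longrightarrow> (\<forall>k<n. norm (\<xi> k \<omega>) \<le> r) \<longrightarrow>
              (\<forall>\<theta>\<in>\<Theta>. \<bar>\<Sum>k<n. (\<beta> (\<xi> k \<omega>) \<theta> - \<beta> (\<xi> k \<omega>) \<theta>\<^sub>0) * ?d k \<omega>\<bar> \<le> \<Lambda> * A))"
      by blast
  qed
qed

section \<open>Tightness of the large jumps\<close>

text \<open>Continuity from above: a quantity that is finite almost surely is bounded by a constant
  off an event of small probability. It serves both the large jumps and the path bounds, where no
  moments are available.\<close>

lemma (in prob_space) decreasing_events_small:
  assumes E: "\<And>m. E m \<in> sets M" and dec: "decseq E" and null: "AE \<omega> in M. \<exists>m::nat. \<omega> \<notin> E m"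
    and \<eta>: "0 < \<eta>"
  shows "\<exists>m. emeasure M (E m) \<le> ennreal \<eta>"
proof -
  have "(\<lambda>m. emeasure M (E m)) \<longlonglongrightarrow> emeasure M (\<Inter>m. E m)"
    by (rule Lim_emeasure_decseq) (use E dec in \<open>auto simp: emeasure_finite\<close>)
  moreover have "emeasure M (\<Inter>m. E m) = 0"
  proof -
    have "(\<Inter>m. E m) \<in> sets M" using E by auto
    moreover have "AE \<omega> in M. \<omega> \<notin> (\<Inter>m. E m)" using null by eventually_elim auto
    ultimately show ?thesis by (simp add: AE_iff_null_sets null_setsD1)
  qed
  ultimately have lim: "(\<lambda>m. emeasure M (E m)) \<longlonglongrightarrow> 0" by simp
  have "0 < ennreal \<eta>" using \<eta> by simp
  from order_tendstoD(2)[OF lim this] show ?thesis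
    by (auto simp: eventually_sequentially intro: less_imp_le)
qed

lemma big_jumps_finite_variation:
  fixes \<nu> :: "(real ^ 'd) measure"
  assumes F: "filtered_prob_space M F" and L: "levy_measure \<nu>"
    and P: "poisson_random_measure M (jump_intensity \<nu>) N" and \<eta>: "0 < \<eta>"
  defines "I \<equiv> \<lambda>t \<omega>. LINT q : {0<..t} \<times> {z. 1 < norm z} | N \<omega>. snd q"
  shows "\<exists>V. \<exists>E\<in>sets M. emeasure M E \<le> ennreal \<eta> \<and>
       (AE \<omega> in M. \<omega> \<notin> E \<longrightarrow> (\<forall>n\<ge>1. (\<Sum>k<n. norm (I (real (Suc k) / real n) \<omega> - I (real k / real n) \<omega>)) \<le> V))"
proof -
  interpret prob_space M using F by (simp add: filtered_prob_space_def)
  let ?Z = "\<lambda>m::nat. {z::real ^ 'd. real m < norm z}"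
  let ?S = "\<lambda>m. {0<..1} \<times> ?Z m"
  have Z1: "{z::real ^ 'd. 1 < norm z} = ?Z 1" by simp
  have Z: "?Z m \<in> sets \<nu>" for m by (rule norm_annulus_sets(1)[OF L]) simp
  have Sm: "?S m \<in> sets (jump_intensity \<nu>)" for m by (rule jump_intensity_rectangle(1)[OF L _ _ Z]) auto
  have sets: "sets (N \<omega>) = sets (jump_intensity \<nu>)" "\<And>A. A \<in> sets (jump_intensity \<nu>) \<Longrightarrow> emeasure (N \<omega>) A \<in> range ennreal_of_enat"
    if "\<omega> \<in> space M" for \<omega>
    using P that unfolding poisson_random_measure_def by blast+
  have Nm[measurable]: "(\<lambda>\<omega>. emeasure (N \<omega>) (?S m)) \<in> borel_measurable M" for m
    using P Sm unfolding poisson_random_measure_def by blast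
  have mu: "emeasure (jump_intensity \<nu>) (?S 1) < \<infinity>"
    using levy_measure_finite[OF L zero_less_one] by (subst jump_intensity_rectangle(2)[OF L _ _ Z]) auto
  \<comment> \<open>The event fails to be good if some jump exceeds \<open>m + 1\<close> in norm or
    if there are more than \<open>m + 1\<close> large jumps up to time 1. Off it the variation is at
    most the product of these two bounds.\<close>
  define E where "E m = {\<omega>\<in>space M. \<not> (emeasure (N \<omega>) (?S (Suc m)) \<le> 0 \<and> emeasure (N \<omega>) (?S 1) \<le> of_nat (Suc m))}" for m
  have E: "E m \<in> sets M" for m unfolding E_def by measurable
  have dec: "decseq E"
  proof (rule decseq_SucI, safe)
    fix m \<omega> assume \<omega>: "\<omega> \<in> E (Suc m)"
    then have "\<omega> \<in> space M" by (simp add: E_def)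
    have SN: "?S m \<in> sets (N \<omega>)" for m unfolding sets(1)[OF \<open>\<omega> \<in> space M\<close>] by (rule Sm)
    have "emeasure (N \<omega>) (?S (Suc (Suc m))) \<le> emeasure (N \<omega>) (?S (Suc m))"
      by (rule emeasure_mono[OF _ SN]) auto
    moreover have "(of_nat (Suc m) :: ennreal) \<le> of_nat (Suc (Suc m))" by (intro of_nat_mono) simp
    ultimately show "\<omega> \<in> E m" using \<omega> unfolding E_def by (auto intro: order_trans simp del: of_nat_Suc)
  qed
  have null: "AE \<omega> in M. \<exists>m. \<omega> \<notin> E m"
    using poisson_AE_nat[OF P Sm mu] AE_space
  proof eventually_elim
    case (elim \<omega>)
    then obtain c :: nat where c: "emeasure (N \<omega>) (?S 1) = of_nat c" by blast
    note s = sets[OF elim(2)]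
    have SN: "?S m \<in> sets (N \<omega>)" for m unfolding s(1) by (rule Sm)
    have lim: "(\<lambda>m. emeasure (N \<omega>) (?S (Suc m))) \<longlonglongrightarrow> emeasure (N \<omega>) (\<Inter>m. ?S (Suc m))"
    proof (rule Lim_emeasure_decseq)
      show "range (\<lambda>m. ?S (Suc m)) \<subseteq> sets (N \<omega>)" using SN by blast
      show "decseq (\<lambda>m. ?S (Suc m))" by (rule decseq_SucI) auto
      show "emeasure (N \<omega>) (?S (Suc m)) \<noteq> \<infinity>" for m
      proof -
        have "emeasure (N \<omega>) (?S (Suc m)) \<le> emeasure (N \<omega>) (?S 1)" by (rule emeasure_mono[OF _ SN]) auto
        also have "\<dots> < \<infinity>" unfolding c by (simp add: of_nat_less_top)
        finally show ?thesis by simp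
      qed
    qed
    have emp: "(\<Inter>m. ?S (Suc m)) = {}"
    proof -
      have "\<exists>m. \<not> real (Suc m) < norm z" for z :: "real ^ 'd"
        using reals_Archimedean2[of "norm z"] by (metis less_asym less_trans of_nat_less_iff lessI)
      then show ?thesis by fastforce
    qed
    have "(\<lambda>m. emeasure (N \<omega>) (?S (Suc m))) \<longlonglongrightarrow> 0" using lim unfolding emp emeasure_empty .
    \<comment> \<open>The values of the random measure are natural numbers or infinity, so being
      below 1 means being 0: from some index on there are no jumps that large.\<close>
    from order_tendstoD(2)[OF this, of 1] obtain m0 where m0: "\<And>m. m0 \<le> m \<Longrightarrow> emeasure (N \<omega>) (?S (Suc m)) < 1"
      by (auto simp: eventually_sequentially)
    have "emeasure (N \<omega>) (?S (Suc m)) = 0" if "m0 \<le> m" for m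
    proof -
      obtain e where e: "emeasure (N \<omega>) (?S (Suc m)) = ennreal_of_enat e" using s(2)[OF Sm] by blast
      show ?thesis
      proof (cases e)
        case (enat i)
        then have "(of_nat i :: ennreal) < of_nat 1" using m0[OF that] e by simp
        then have "i = 0" by (simp only: of_nat_less_iff less_one)
        then show ?thesis using e enat by simp
      next
        case infinity
        then show ?thesis using m0[OF that] e by simp
      qed
    qed
    moreover have "emeasure (N \<omega>) (?S 1) \<le> of_nat (Suc (max m0 c))"
      unfolding c by (intro of_nat_mono) simp
    ultimately have "\<omega> \<notin> E (max m0 c)" by (simp add: E_def)
    then show ?case by blast
  qed
  obtain m where m: "emeasure M (E m) \<le> ennreal \<eta>" using decreasing_events_small[OF E dec null \<eta>] by blast
  let ?B = "real (Suc m)"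
  have "(\<Sum>k<n. norm (I (real (Suc k) / real n) \<omega> - I (real k / real n) \<omega>)) \<le> ?B * ?B"
    if \<omega>: "\<omega> \<in> space M" "\<omega> \<notin> E m" and n: "1 \<le> n" for \<omega> n
  proof -
    let ?t = "\<lambda>k::nat. real k / real n"
    note s = sets[OF \<omega>(1)]
    have SN: "?S m \<in> sets (N \<omega>)" for m unfolding s(1) by (rule Sm)
    have N0: "emeasure (N \<omega>) (?S (Suc m)) = 0" and N1: "emeasure (N \<omega>) (?S 1) \<le> of_nat (Suc m)"
      using \<omega> by (auto simp: E_def)
    have N1': "measure (N \<omega>) (?S 1) \<le> ?B"
    proof -
      have "measure (N \<omega>) (?S 1) \<le> enn2real (of_nat (Suc m))"
        unfolding measure_def by (rule enn2real_mono[OF N1]) (simp add: of_nat_less_top del: of_nat_Suc)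
      also have "enn2real (of_nat (Suc m)) = ?B" by (simp del: of_nat_Suc)
      finally show ?thesis .
    qed
    have finS: "emeasure (N \<omega>) (?S 1) < \<infinity>" by (rule le_less_trans[OF N1]) (simp add: of_nat_less_top del: of_nat_Suc)
    have rect: "{u<..v} \<times> ?Z 1 \<in> sets (N \<omega>)" if "0 \<le> u" "u \<le> v" for u v
      unfolding s(1) by (rule jump_intensity_rectangle(1)[OF L that Z])
    have finr: "emeasure (N \<omega>) ({u<..v} \<times> ?Z 1) < \<infinity>" if "0 \<le> u" "u \<le> v" "v \<le> 1" for u v
      by (rule le_less_trans[OF emeasure_mono[OF _ SN] finS]) (use that in auto)
    have snd[measurable]: "snd \<in> borel_measurable (N \<omega>)" by (rule jump_size_measurable[OF L s(1)])
    have "?S (Suc m) \<in> null_sets (N \<omega>)" by (rule null_setsI[OF N0 SN])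
    then have "AE q in N \<omega>. q \<notin> ?S (Suc m)" by (rule AE_not_in)
    then have AEb: "AE q in N \<omega>. q \<in> {u<..v} \<times> ?Z 1 \<longrightarrow> norm (snd q) \<le> ?B" if "0 \<le> u" "v \<le> 1" for u v
      by eventually_elim (use that in \<open>auto simp: not_less\<close>)
    have int: "set_integrable (N \<omega>) ({u<..v} \<times> ?Z 1) snd" if uv: "0 \<le> u" "u \<le> v" "v \<le> 1" for u v
      unfolding set_integrable_def
    proof (rule Bochner_Integration.integrable_bound)
      show "integrable (N \<omega>) (\<lambda>q. ?B * indicator ({u<..v} \<times> ?Z 1) q :: real)"
        using rect[OF uv(1,2)] finr[OF uv] by (intro integrable_mult_right integrable_real_indicator) auto
      show "(\<lambda>q. indicator ({u<..v} \<times> ?Z 1) q *\<^sub>R snd q) \<in> borel_measurable (N \<omega>)"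
        using rect[OF uv(1,2)] by measurable
      show "AE q in N \<omega>. norm (indicator ({u<..v} \<times> ?Z 1) q *\<^sub>R snd q) \<le> norm (?B * indicator ({u<..v} \<times> ?Z 1) q)"
        using AEb[OF uv(1,3)] by eventually_elim (auto simp: indicator_def)
    qed
    have inc: "norm (I v \<omega> - I u \<omega>) \<le> ?B * measure (N \<omega>) ({u<..v} \<times> ?Z 1)" if uv: "0 \<le> u" "u \<le> v" "v \<le> 1" for u v
    proof -
      have un: "{0<..v} \<times> ?Z 1 = {0<..u} \<times> ?Z 1 \<union> {u<..v} \<times> ?Z 1" using uv by auto
      have "I v \<omega> = I u \<omega> + (LINT q : {u<..v} \<times> ?Z 1 | N \<omega>. snd q)"
        unfolding I_def Z1 un by (rule set_integral_Un) (use int uv in auto)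
      then have "norm (I v \<omega> - I u \<omega>) = norm (LINT q : {u<..v} \<times> ?Z 1 | N \<omega>. snd q)" by simp
      also have "\<dots> \<le> (LINT q : {u<..v} \<times> ?Z 1 | N \<omega>. norm (snd q))"
        by (rule set_integral_norm_bound[OF int[OF uv]])
      also have "\<dots> \<le> (LINT q|N \<omega>. ?B * indicator ({u<..v} \<times> ?Z 1) q)"
        unfolding set_lebesgue_integral_def
      proof (rule integral_mono_AE)
        show "integrable (N \<omega>) (\<lambda>q. ?B * indicator ({u<..v} \<times> ?Z 1) q :: real)"
          using rect[OF uv(1,2)] finr[OF uv] by (intro integrable_mult_right integrable_real_indicator) auto
        show "integrable (N \<omega>) (\<lambda>q. indicator ({u<..v} \<times> ?Z 1) q *\<^sub>R norm (snd q))"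
          using set_integrable_norm[OF int[OF uv]] by (simp add: set_integrable_def)
        show "AE q in N \<omega>. indicator ({u<..v} \<times> ?Z 1) q *\<^sub>R norm (snd q) \<le> ?B * indicator ({u<..v} \<times> ?Z 1) q"
          using AEb[OF uv(1,3)] by eventually_elim (auto simp: indicator_def)
      qed
      also have "\<dots> = ?B * measure (N \<omega>) ({u<..v} \<times> ?Z 1)"
        using rect[OF uv(1,2)] by simp
      finally show ?thesis .
    qed
    have t1: "?t k \<le> 1" if "k \<le> n" for k using that n by (simp add: divide_le_eq_1)
    have t: "0 \<le> ?t k" "?t k \<le> ?t (Suc k)" for k by (auto simp: divide_right_mono)
    have "(\<Sum>k<j. norm (I (?t (Suc k)) \<omega> - I (?t k) \<omega>)) \<le> ?B * measure (N \<omega>) ({0<..?t j} \<times> ?Z 1)" if "j \<le> n" for j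
      using that
    proof (induction j)
      case (Suc j)
      have un: "{0<..v} \<times> ?Z 1 = {0<..u} \<times> ?Z 1 \<union> {u<..v} \<times> ?Z 1" if "0 \<le> u" "u \<le> v" for u v :: real
        using that by auto
      have m: "measure (N \<omega>) ({0<..?t (Suc j)} \<times> ?Z 1) = measure (N \<omega>) ({0<..?t j} \<times> ?Z 1) + measure (N \<omega>) ({?t j<..?t (Suc j)} \<times> ?Z 1)"
        unfolding un[OF t[of j]]
      proof (rule measure_Union)
        show "emeasure (N \<omega>) ({0<..?t j} \<times> ?Z 1) \<noteq> \<infinity>"
          using finr[OF order_refl t(1)[of j] t1] Suc.prems by (simp add: less_top[symmetric] del: of_nat_Suc)
        show "emeasure (N \<omega>) ({?t j<..?t (Suc j)} \<times> ?Z 1) \<noteq> \<infinity>"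
          using finr[OF t t1[OF Suc.prems]] by (simp add: less_top[symmetric] del: of_nat_Suc)
        show "{0<..?t j} \<times> ?Z 1 \<in> sets (N \<omega>)" by (rule rect[OF order_refl t(1)])
        show "{?t j<..?t (Suc j)} \<times> ?Z 1 \<in> sets (N \<omega>)" by (rule rect[OF t])
      qed auto
      have "norm (I (?t (Suc j)) \<omega> - I (?t j) \<omega>) \<le> ?B * measure (N \<omega>) ({?t j<..?t (Suc j)} \<times> ?Z 1)"
        by (rule inc[OF t t1[OF Suc.prems]])
      then show ?case using Suc unfolding m sum.lessThan_Suc distrib_left by simp
    qed simp
    from this[OF order_refl] have "(\<Sum>k<n. norm (I (?t (Suc k)) \<omega> - I (?t k) \<omega>)) \<le> ?B * measure (N \<omega>) (?S 1)"
      using n by simp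
    also have "\<dots> \<le> ?B * ?B" using N1' by (intro mult_left_mono) auto
    finally show ?thesis .
  qed
  then have "AE \<omega> in M. \<omega> \<notin> E m \<longrightarrow> (\<forall>n\<ge>1. (\<Sum>k<n. norm (I (real (Suc k) / real n) \<omega> - I (real k / real n) \<omega>)) \<le> ?B * ?B)"
    by (intro AE_I2) blast
  with m E show ?thesis by blast
qed

text \<open>Exponential integrators are scalar, so the Brownian part and the small jumps are treated
  one coordinate at a time, the entries of \<open>\<sigma>\<close> being constant factors. Tightness
  is stable under finite sums, whatever the dependence between the terms.\<close>

lemma levy_noise_uniformly_tight:
  fixes b :: "real ^ 'd \<Rightarrow> real ^ 'p \<Rightarrow> real ^ 'd" and \<sigma> :: "real ^ 'r ^ 'd"
  assumes F: "filtered_prob_space M F" and L: "levy_process M F a \<sigma> B \<nu> N L"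
    and \<Theta>: "bounded \<Theta>" "\<theta>\<^sub>0 \<in> \<Theta>"
    and meas: "\<And>\<theta>. \<theta> \<in> \<Theta> \<Longrightarrow> (\<lambda>x. b x \<theta>) \<in> borel_measurable borel"
    and cont: "\<And>x. continuous_on \<Theta> (b x)"
    and G: "0 \<le> G" "\<And>x \<theta>. norm x \<le> r \<Longrightarrow> \<theta> \<in> \<Theta> \<Longrightarrow> norm (b x \<theta> - b x \<theta>\<^sub>0) \<le> G"
    and \<Lambda>: "\<And>j::'d. 0 < \<Lambda> j"
    and lip: "\<And>j x \<theta> \<theta>'. norm x \<le> r \<Longrightarrow> \<theta> \<in> \<Theta> \<Longrightarrow> \<theta>' \<in> \<Theta> \<Longrightarrow> \<bar>b x \<theta> $ j - b x \<theta>' $ j\<bar> \<le> \<Lambda> j * norm (\<theta> - \<theta>')"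
  shows "uniformly_tight M F \<Theta> r (\<lambda>x \<theta> s t \<omega>. (b x \<theta> - b x \<theta>\<^sub>0) \<bullet> (L t \<omega> - L s \<omega>))"
proof -
  interpret prob_space M using F by (simp add: filtered_prob_space_def)
  have B: "brownian_motion M F B" and \<nu>: "levy_measure \<nu>" and P: "poisson_random_measure M (jump_intensity \<nu>) N"
    and C: "filtration_compatible M F (jump_intensity \<nu>) N"
    using L by (auto simp: levy_process_def)
  obtain J where J: "is_compensated_small_jump_integral M \<nu> N J"
    and dec: "AE \<omega> in M. \<forall>t\<ge>0. L t \<omega> =
           t *\<^sub>R a + \<sigma> *v B t \<omega> + J t \<omega> + (LINT q : {0<..t} \<times> {z. 1 < norm z} | N \<omega>. snd q)"
    using L unfolding levy_process_def by blast
  define I where "I t \<omega> = (LINT q : {0<..t} \<times> {z. 1 < norm z} | N \<omega>. snd q)" for t \<omega>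
  have mj: "(\<lambda>x. b x \<theta> $ j) \<in> borel_measurable borel" if "\<theta> \<in> \<Theta>" for \<theta> j
    by (rule measurable_compose[OF meas[OF that] borel_measurable_nth])
  have cj: "continuous_on \<Theta> (\<lambda>\<theta>. b x \<theta> $ j)" for x j by (intro continuous_intros cont)
  have tB: "uniformly_tight M F \<Theta> r (\<lambda>x \<theta> s t \<omega>. (b x \<theta> $ j - b x \<theta>\<^sub>0 $ j) * (B t \<omega> $ i - B s \<omega> $ i))" for i j
    by (rule uniformly_tight_exp_integrator[where \<beta>="\<lambda>x \<theta>. b x \<theta> $ j" and W="\<lambda>t \<omega>. B t \<omega> $ i", OF F \<Theta> brownian_exp_integrator[OF F B] mj cj \<Lambda> lip])
  have tJ: "uniformly_tight M F \<Theta> r (\<lambda>x \<theta> s t \<omega>. (b x \<theta> $ j - b x \<theta>\<^sub>0 $ j) * (J t \<omega> $ j - J s \<omega> $ j))" for j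
    by (rule uniformly_tight_exp_integrator[where \<beta>="\<lambda>x \<theta>. b x \<theta> $ j" and W="\<lambda>t \<omega>. J t \<omega> $ j", OF F \<Theta> small_jump_exp_integrator[OF F _ \<nu> P C J] mj cj \<Lambda> lip])
  have tI: "uniformly_tight M F \<Theta> r (\<lambda>x \<theta> s t \<omega>. (b x \<theta> - b x \<theta>\<^sub>0) \<bullet> (I t \<omega> - I s \<omega>))"
    unfolding I_def by (rule uniformly_tight_finite_variation[OF G big_jumps_finite_variation[OF F \<nu> P]])
  have ta: "uniformly_tight M F \<Theta> r (\<lambda>x \<theta> s t \<omega>. (b x \<theta> - b x \<theta>\<^sub>0) \<bullet> (t *\<^sub>R a - s *\<^sub>R a))"
  proof (rule uniformly_tight_finite_variation[OF G])
    fix \<eta> :: real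
    have "(\<Sum>k<n. norm ((real (Suc k) / real n) *\<^sub>R a - (real k / real n) *\<^sub>R a)) \<le> norm a" if n: "1 \<le> n" for n
    proof -
      have "norm ((real (Suc k) / real n) *\<^sub>R a - (real k / real n) *\<^sub>R a) = norm a / real n" for k
        using n by (simp add: field_simps flip: scaleR_left_diff_distrib diff_divide_distrib)
      then show ?thesis using n by simp
    qed
    then show "\<exists>V. \<exists>E\<in>sets M. emeasure M E \<le> ennreal \<eta> \<and>
       (AE \<omega> in M. \<omega> \<notin> E \<longrightarrow> (\<forall>n\<ge>1. (\<Sum>k<n. norm ((real (Suc k) / real n) *\<^sub>R a - (real k / real n) *\<^sub>R a)) \<le> V))"
      by (intro exI[of _ "norm a"] bexI[of _ "{}"]) auto
  qed
  have "uniformly_tight M F \<Theta> r (\<lambda>x \<theta> s t \<omega>. ((b x \<theta> - b x \<theta>\<^sub>0) \<bullet> (t *\<^sub>R a - s *\<^sub>R a)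
       + (b x \<theta> - b x \<theta>\<^sub>0) \<bullet> (I t \<omega> - I s \<omega>))
       + ((\<Sum>j\<in>UNIV. \<Sum>i\<in>UNIV. \<sigma> $ j $ i * ((b x \<theta> $ j - b x \<theta>\<^sub>0 $ j) * (B t \<omega> $ i - B s \<omega> $ i)))
       + (\<Sum>j\<in>UNIV. (b x \<theta> $ j - b x \<theta>\<^sub>0 $ j) * (J t \<omega> $ j - J s \<omega> $ j))))"
    by (intro uniformly_tight_add uniformly_tight_sum uniformly_tight_cmult ta tI tB tJ finite)
  then show ?thesis
  proof (rule uniformly_tight_AE_cong)
    show "AE \<omega> in M. \<forall>x. \<forall>\<theta>\<in>\<Theta>. \<forall>s\<ge>0. \<forall>t\<ge>s. ((b x \<theta> - b x \<theta>\<^sub>0) \<bullet> (t *\<^sub>R a - s *\<^sub>R a)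
       + (b x \<theta> - b x \<theta>\<^sub>0) \<bullet> (I t \<omega> - I s \<omega>))
       + ((\<Sum>j\<in>UNIV. \<Sum>i\<in>UNIV. \<sigma> $ j $ i * ((b x \<theta> $ j - b x \<theta>\<^sub>0 $ j) * (B t \<omega> $ i - B s \<omega> $ i)))
       + (\<Sum>j\<in>UNIV. (b x \<theta> $ j - b x \<theta>\<^sub>0 $ j) * (J t \<omega> $ j - J s \<omega> $ j)))
       = (b x \<theta> - b x \<theta>\<^sub>0) \<bullet> (L t \<omega> - L s \<omega>)"
      using dec
    proof (eventually_elim, intro allI ballI impI)
      fix \<omega> x \<theta> and s t :: real
      assume d: "\<forall>t\<ge>0. L t \<omega> = t *\<^sub>R a + \<sigma> *v B t \<omega> + J t \<omega> + (LINT q : {0<..t} \<times> {z. 1 < norm z} | N \<omega>. snd q)"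
        and s: "0 \<le> s" and t: "s \<le> t"
      let ?g = "b x \<theta> - b x \<theta>\<^sub>0"
      have "L t \<omega> - L s \<omega> = (t *\<^sub>R a - s *\<^sub>R a) + (I t \<omega> - I s \<omega>) + (\<sigma> *v (B t \<omega> - B s \<omega>) + (J t \<omega> - J s \<omega>))"
        using d[rule_format, OF s] d[rule_format, OF order_trans[OF s t]]
        by (simp add: I_def matrix_vector_mult_diff_distrib)
      then have "?g \<bullet> (L t \<omega> - L s \<omega>) = (?g \<bullet> (t *\<^sub>R a - s *\<^sub>R a) + ?g \<bullet> (I t \<omega> - I s \<omega>))
         + (?g \<bullet> (\<sigma> *v (B t \<omega> - B s \<omega>)) + ?g \<bullet> (J t \<omega> - J s \<omega>))"
        by (simp only: inner_add_right)
      moreover have "?g \<bullet> (\<sigma> *v (B t \<omega> - B s \<omega>)) = (\<Sum>j\<in>UNIV. \<Sum>i\<in>UNIV. \<sigma> $ j $ i * ((b x \<theta> $ j - b x \<theta>\<^sub>0 $ j) * (B t \<omega> $ i - B s \<omega> $ i)))"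
        by (simp add: inner_vec_def matrix_vector_mult_def sum_distrib_left mult.left_commute)
      moreover have "?g \<bullet> (J t \<omega> - J s \<omega>) = (\<Sum>j\<in>UNIV. (b x \<theta> $ j - b x \<theta>\<^sub>0 $ j) * (J t \<omega> $ j - J s \<omega> $ j))"
        by (simp add: inner_vec_def)
      ultimately show "(?g \<bullet> (t *\<^sub>R a - s *\<^sub>R a) + ?g \<bullet> (I t \<omega> - I s \<omega>))
         + ((\<Sum>j\<in>UNIV. \<Sum>i\<in>UNIV. \<sigma> $ j $ i * ((b x \<theta> $ j - b x \<theta>\<^sub>0 $ j) * (B t \<omega> $ i - B s \<omega> $ i)))
         + (\<Sum>j\<in>UNIV. (b x \<theta> $ j - b x \<theta>\<^sub>0 $ j) * (J t \<omega> $ j - J s \<omega> $ j))) = ?g \<bullet> (L t \<omega> - L s \<omega>)"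
        by simp
    qed
  qed
qed

section \<open>Uniform bounds for the driving paths\<close>

text \<open>Right-continuity reaches every time before 1 through rationals to its right, and the
  endpoint 1 is itself rational.\<close>

lemma cadlag_on_bounded_by_rationals:
  fixes f :: "real \<Rightarrow> 'b::real_normed_vector"
  assumes f: "cadlag_on {0..1} f" and q: "\<And>q. q \<in> \<rat> \<inter> {0..1} \<Longrightarrow> norm (f q) \<le> m" and t: "t \<in> {0..1}"
  shows "norm (f t) \<le> m"
proof (rule ccontr)
  assume "\<not> norm (f t) \<le> m"
  then have m: "m < norm (f t)" by simp
  have "t \<noteq> 1" using m q[of 1] by auto
  then have t1: "t < 1" using t by simp
  have "((\<lambda>x. norm (f x)) \<longlongrightarrow> norm (f t)) (at t within ({0..1} \<inter> {t<..}))"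
    using f t by (intro tendsto_norm) (simp add: cadlag_on_def)
  from order_tendstoD(1)[OF this m] obtain d where d: "d > 0"
    "\<And>x. x \<in> {0..1} \<inter> {t<..} \<Longrightarrow> x \<noteq> t \<Longrightarrow> dist x t < d \<Longrightarrow> m < norm (f x)"
    unfolding eventually_at by auto
  have "t < min 1 (t + d)" using t1 d(1) by simp
  then obtain x where x: "x \<in> \<rat>" "t < x" "x < min 1 (t + d)" using Rats_dense_in_real by blast
  have "m < norm (f x)" using x t by (intro d(2)) (auto simp: dist_real_def)
  moreover have "norm (f x) \<le> m" using x t by (intro q) auto
  ultimately show False by simp
qed

text \<open>The solution with noise level 1 is cadlag by definition, hence bounded along almost
  every path. Its equation expresses \<open>L\<close> through it, and linear growth of the drift
  transfers the bound.\<close>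

lemma levy_paths_bounded:
  fixes L :: "real \<Rightarrow> 'w \<Rightarrow> real ^ 'd"
  assumes F: "filtered_prob_space M F" and sde: "sde_solution M F drift x\<^sub>0 1 L X"
    and K: "0 \<le> K" "\<And>x. norm (drift x) \<le> K * (1 + norm x)" and \<eta>: "0 < \<eta>"
  shows "\<exists>R. \<exists>E\<in>sets M. emeasure M E \<le> ennreal \<eta> \<and> (AE \<omega> in M. \<omega> \<notin> E \<longrightarrow> (\<forall>t\<in>{0..1}. norm (L t \<omega>) \<le> R))"
proof -
  interpret prob_space M using F by (simp add: filtered_prob_space_def)
  have sub: "subalgebra M (F t)" for t using F by (simp add: filtered_prob_space_def)
  have ad: "X t \<in> borel_measurable M" if "t \<in> {0..1}" for t
    using sde that measurable_from_subalg[OF sub] unfolding sde_solution_def adapted_on_def by blast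
  have cad: "AE \<omega> in M. cadlag_on {0..1} (\<lambda>t. X t \<omega>)"
    and eq: "AE \<omega> in M. \<forall>t\<in>{0..1}. (\<lambda>s. drift (X s \<omega>)) integrable_on {0..t} \<and>
        X t \<omega> = x\<^sub>0 + integral {0..t} (\<lambda>s. drift (X s \<omega>)) + 1 *\<^sub>R L t \<omega>"
    using sde unfolding sde_solution_def by blast+
  \<comment> \<open>Only rational times are used, so that the event is a countable union and
    therefore measurable.\<close>
  define E where "E m = (\<Union>q\<in>\<rat> \<inter> {0..1}. {\<omega>\<in>space M. real m < norm (X q \<omega>)})" for m :: nat
  have E: "E m \<in> sets M" for m
    unfolding E_def
  proof (rule sets.countable_UN')
    show "countable (\<rat> \<inter> {0..1::real})" using countable_rat by (rule countable_Int1)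
    have "{\<omega>\<in>space M. real m < norm (X q \<omega>)} \<in> sets M" if "q \<in> \<rat> \<inter> {0..1}" for q
    proof -
      have [measurable]: "X q \<in> borel_measurable M" using that by (intro ad) auto
      show ?thesis by measurable
    qed
    then show "(\<lambda>q. {\<omega>\<in>space M. real m < norm (X q \<omega>)}) ` (\<rat> \<inter> {0..1}) \<subseteq> sets M" by blast
  qed
  have dec: "decseq E" by (rule decseq_SucI) (force simp: E_def)
  have null: "AE \<omega> in M. \<exists>m. \<omega> \<notin> E m"
    using cad
  proof eventually_elim
    case (elim \<omega>)
    have "bounded ((\<lambda>t. X t \<omega>) ` {0..1})" by (rule cadlag_on_bounded[OF elim]) simp
    then obtain c where c: "\<forall>t\<in>{0..1}. norm (X t \<omega>) \<le> c" by (auto simp: bounded_iff)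
    obtain m :: nat where "c \<le> real m" using real_arch_simple by blast
    then have "\<omega> \<notin> E m" using c by (force simp: E_def)
    then show ?case by blast
  qed
  obtain m where m: "emeasure M (E m) \<le> ennreal \<eta>" using decreasing_events_small[OF E dec null \<eta>] by blast
  have "AE \<omega> in M. \<omega> \<notin> E m \<longrightarrow> (\<forall>t\<in>{0..1}. norm (L t \<omega>) \<le> real m + norm x\<^sub>0 + K * (1 + real m))"
    using cad eq AE_space
  proof (eventually_elim, intro impI ballI)
    fix \<omega> and t :: real assume c: "cadlag_on {0..1} (\<lambda>t. X t \<omega>)"
      and e: "\<forall>t\<in>{0..1}. (\<lambda>s. drift (X s \<omega>)) integrable_on {0..t} \<and>
        X t \<omega> = x\<^sub>0 + integral {0..t} (\<lambda>s. drift (X s \<omega>)) + 1 *\<^sub>R L t \<omega>"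
      and \<omega>: "\<omega> \<in> space M" "\<omega> \<notin> E m" and t: "t \<in> {0..1}"
    have q: "norm (X q \<omega>) \<le> real m" if "q \<in> \<rat> \<inter> {0..1}" for q
      using \<omega> that unfolding E_def by (auto simp: not_less)
    have Xm: "norm (X s \<omega>) \<le> real m" if "s \<in> {0..1}" for s
      by (rule cadlag_on_bounded_by_rationals[OF c q that])
    have "norm (integral {0..t} (\<lambda>s. drift (X s \<omega>))) \<le> integral {0..t} (\<lambda>s. K * (1 + real m))"
    proof (rule integral_norm_bound_integral)
      fix s assume "s \<in> {0..t}"
      then have "norm (X s \<omega>) \<le> real m" using t by (intro Xm) auto
      then have "K * (1 + norm (X s \<omega>)) \<le> K * (1 + real m)" using K(1) by (intro mult_left_mono) auto
      then show "norm (drift (X s \<omega>)) \<le> K * (1 + real m)" by (rule order_trans[OF K(2)])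
    qed (use e t in auto)
    also have "\<dots> = t * (K * (1 + real m))" using t by simp
    also have "\<dots> \<le> 1 * (K * (1 + real m))" using t K(1) by (intro mult_right_mono) auto
    finally have int: "norm (integral {0..t} (\<lambda>s. drift (X s \<omega>))) \<le> K * (1 + real m)" by simp
    have "L t \<omega> = X t \<omega> - x\<^sub>0 - integral {0..t} (\<lambda>s. drift (X s \<omega>))" using e t by simp
    then have "norm (L t \<omega>) \<le> norm (X t \<omega>) + norm x\<^sub>0 + norm (integral {0..t} (\<lambda>s. drift (X s \<omega>)))"
      using norm_triangle_ineq4[of "X t \<omega> - x\<^sub>0" "integral {0..t} (\<lambda>s. drift (X s \<omega>))"] norm_triangle_ineq4[of "X t \<omega>" "x\<^sub>0"]
      by simp
    then show "norm (L t \<omega>) \<le> real m + norm x\<^sub>0 + K * (1 + real m)" using int Xm[OF t] by linarith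
  qed
  with m E show ?thesis by blast
qed

section \<open>Consistency\<close>

theorem theorem2p1:
  fixes M :: "'w measure" and F :: "real \<Rightarrow> 'w measure"
    and a :: "real ^ 'd" and \<sigma> :: "real ^ 'r ^ 'd" and B :: "real \<Rightarrow> 'w \<Rightarrow> real ^ 'r"
    and \<nu> :: "(real ^ 'd) measure" and N :: "'w \<Rightarrow> (real \<times> (real ^ 'd)) measure"
    and L :: "real \<Rightarrow> 'w \<Rightarrow> real ^ 'd"
    and \<Theta>\<^sub>0 \<Theta> :: "(real ^ 'p) set" and \<theta>\<^sub>0 :: "real ^ 'p"
    and b :: "real ^ 'd \<Rightarrow> real ^ 'p \<Rightarrow> real ^ 'd" and x\<^sub>0 :: "real ^ 'd"
    and X :: "real \<Rightarrow> real \<Rightarrow> 'w \<Rightarrow> real ^ 'd" and X0 :: "real \<Rightarrow> real ^ 'd"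
    and est :: "nat \<Rightarrow> real \<Rightarrow> 'w \<Rightarrow> real ^ 'p"
  assumes "filtered_prob_space M F"
    and "levy_process M F a \<sigma> B \<nu> N L"
    and "open \<Theta>\<^sub>0" and "bounded \<Theta>\<^sub>0" and "convex \<Theta>\<^sub>0" and "\<Theta> = closure \<Theta>\<^sub>0" and "\<theta>\<^sub>0 \<in> \<Theta>\<^sub>0"
    and "\<And>\<epsilon>. 0 < \<epsilon> \<Longrightarrow> \<epsilon> \<le> 1 \<Longrightarrow> sde_solution M F (\<lambda>x. b x \<theta>\<^sub>0) x\<^sub>0 \<epsilon> L (X \<epsilon>)"
    and "ode_solution (\<lambda>x. b x \<theta>\<^sub>0) x\<^sub>0 X0"
    and "condition_A1 b \<Theta>" and "condition_A2 b \<Theta>" and "condition_A3 b \<Theta> \<theta>\<^sub>0 X0"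
    and "\<And>n \<epsilon>. 1 \<le> n \<Longrightarrow> 0 < \<epsilon> \<Longrightarrow> \<epsilon> \<le> 1 \<Longrightarrow> least_squares_estimator M b \<Theta> n \<epsilon> (X \<epsilon>) (est n \<epsilon>)"
  shows "tendsto_in_prob M (\<lambda>(n, \<epsilon>). est n \<epsilon>) \<theta>\<^sub>0 (sequentially \<times>\<^sub>F at_right 0)"
proof -
  note F = assms(1) and sde = assms(8) and ode = assms(9) and lse = assms(13)
  interpret prob_space M using F by (simp add: filtered_prob_space_def)
  have \<theta>\<^sub>0: "\<theta>\<^sub>0 \<in> \<Theta>" using assms(6,7) closure_subset by blast
  have b\<Theta>: "bounded \<Theta>" and c\<Theta>: "compact \<Theta>"
    using assms(4,6) by (simp_all add: bounded_closure compact_eq_bounded_closed)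
  obtain K where K: "0 < K" and lip: "\<And>x y \<theta>. \<theta> \<in> \<Theta> \<Longrightarrow> norm (b x \<theta> - b y \<theta>) \<le> K * norm (x - y)"
    and growth: "\<And>x \<theta>. \<theta> \<in> \<Theta> \<Longrightarrow> norm (b x \<theta>) \<le> K * (1 + norm x)"
    using assms(10) unfolding condition_A1_def by blast
  have comp: "(\<lambda>x \<theta>. b x \<theta> $ j) \<in> C_poly_growth 2 3 \<Theta>" for j
    using assms(11) by (simp add: condition_A2_def)
  note cpl = C_poly_growth_lipschitz[OF comp _ assms(3,5,6)]
  have bcont: "continuous_on (UNIV \<times> \<Theta>) (\<lambda>(x, \<theta>). b x \<theta>)"
  proof -
    have "continuous_on (UNIV \<times> \<Theta>) (\<lambda>p. \<chi> j. (case p of (x, \<theta>) \<Rightarrow> b x \<theta> $ j))"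
      by (intro continuous_on_vec_lambda cpl(1)) simp
    then show ?thesis by (rule continuous_on_eq) (auto simp: vec_eq_iff)
  qed
  have \<theta>cont: "continuous_on \<Theta> (b x)" for x
  proof -
    have "continuous_on \<Theta> (\<lambda>\<theta>. (\<lambda>(x, \<theta>). b x \<theta>) (x, \<theta>))"
      by (rule continuous_on_compose2[OF bcont continuous_on_Pair[OF continuous_on_const continuous_on_id]]) auto
    then show ?thesis by simp
  qed
  have bmeas: "(\<lambda>x. b x \<theta>) \<in> borel_measurable borel" if "\<theta> \<in> \<Theta>" for \<theta>
  proof (rule borel_measurable_continuous_onI)
    show "continuous_on UNIV (\<lambda>x. b x \<theta>)"
      by (rule lipschitz_on_continuous_on[OF lipschitz_onI[where L=K]]) (use lip[OF that] K in \<open>auto simp: dist_norm\<close>)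
  qed
  have "\<forall>j. \<exists>C r. 0 < C \<and> (\<forall>x. \<forall>\<theta>\<in>\<Theta>. \<forall>\<theta>'\<in>\<Theta>. \<bar>b x \<theta> $ j - b x \<theta>' $ j\<bar> \<le> C * (1 + norm x) powr r * norm (\<theta> - \<theta>'))
     \<and> 0 < r"
    using cpl(2) by (metis one_le_numeral)
  then obtain C r where Cr: "\<And>j. 0 < C j" "\<And>j. 0 < r j"
    "\<And>j x \<theta> \<theta>'. \<theta> \<in> \<Theta> \<Longrightarrow> \<theta>' \<in> \<Theta> \<Longrightarrow> \<bar>b x \<theta> $ j - b x \<theta>' $ j\<bar> \<le> C j * (1 + norm x) powr r j * norm (\<theta> - \<theta>')"
    by metis
  have X0c: "continuous_on {0..1} X0" by (rule ode_solution_continuous[OF ode])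
  then have "bounded (X0 ` {0..1})" by (intro compact_imp_bounded compact_continuous_image) auto
  then obtain M0 where M0: "\<And>t. t \<in> {0..1} \<Longrightarrow> norm (X0 t) \<le> M0" unfolding bounded_iff by blast
  have M00: "0 \<le> M0" using order_trans[OF norm_ge_zero M0[of 0]] by simp
  show ?thesis
    unfolding tendsto_in_prob_def
  proof (intro allI impI)
    fix \<delta> :: real assume \<delta>: "0 < \<delta>"
    obtain \<kappa> where \<kappa>: "0 < \<kappa>"
      "\<And>\<theta>. \<theta> \<in> \<Theta> \<Longrightarrow> \<delta> \<le> dist \<theta> \<theta>\<^sub>0 \<Longrightarrow> \<kappa> \<le> integral {0..1} (\<lambda>s. (norm (b (X0 s) \<theta> - b (X0 s) \<theta>\<^sub>0))\<^sup>2)"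
      using identifiability_gap[OF bcont c\<Theta> \<theta>\<^sub>0 X0c assms(12) \<delta>] by blast
    show "((\<lambda>i. measure M {\<omega>\<in>space M. \<delta> < dist ((case i of (n, \<epsilon>) \<Rightarrow> est n \<epsilon>) \<omega>) \<theta>\<^sub>0}) \<longlongrightarrow> 0) (sequentially \<times>\<^sub>F at_right 0)"
    proof (rule tendstoI)
      fix e :: real assume e: "0 < e"
      \<comment> \<open>Two exceptional events of probability at most \<open>e / 3\<close> each
        leave room for the strict inequality.\<close>
      then have e3: "0 < e / 3" by simp
      obtain R' E1 where E1: "E1 \<in> sets M" "emeasure M E1 \<le> ennreal (e / 3)"
        and LR': "AE \<omega> in M. \<omega> \<notin> E1 \<longrightarrow> (\<forall>t\<in>{0..1}. norm (L t \<omega>) \<le> R')"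
        using levy_paths_bounded[OF F sde[OF zero_less_one order_refl] less_imp_le[OF K] growth[OF \<theta>\<^sub>0] e3] by blast
      \<comment> \<open>\<open>R'\<close> is only informative off \<open>E1\<close> and a null set,
        so nothing excludes a negative value; the maximum secures nonnegative constants
        below.\<close>
      define R where "R = max R' 0"
      have R0: "0 \<le> R" by (simp add: R_def)
      define H where "H = 2 * R * exp (2 * K)"
      have H0: "0 \<le> H" using R0 by (simp add: H_def)
      define Gm where "Gm = 2 * K * (1 + M0 + H)"
      have Gm0: "0 \<le> Gm" using K M00 H0 by (simp add: Gm_def)
      \<comment> \<open>Since \<open>\<epsilon> \<le> 1\<close>, the deviation from the
        deterministic path is at most \<open>H\<close>, so off \<open>E1\<close> and a null set all
        states stay in this ball. It is fixed before \<open>n\<close> and \<epsilon>.\<close>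
      define \<rho> where "\<rho> = M0 + H"
      have \<rho>0: "0 \<le> \<rho>" using M00 H0 by (simp add: \<rho>_def)
      have G: "norm (b x \<theta> - b x \<theta>\<^sub>0) \<le> Gm" if "norm x \<le> \<rho>" "\<theta> \<in> \<Theta>" for x \<theta>
      proof -
        have "norm (b x \<theta> - b x \<theta>\<^sub>0) \<le> K * (1 + norm x) + K * (1 + norm x)"
          using norm_triangle_ineq4[of "b x \<theta>" "b x \<theta>\<^sub>0"] growth[OF that(2), of x] growth[OF \<theta>\<^sub>0, of x] by linarith
        also have "\<dots> = 2 * K * (1 + norm x)" by simp
        also have "\<dots> \<le> Gm" unfolding Gm_def using that(1) K by (intro mult_left_mono) (auto simp: \<rho>_def)
        finally show ?thesis .
      qed
      have \<Lambda>: "0 < C j * (1 + \<rho>) powr r j" for j using Cr(1) \<rho>0 by simp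
      have lip\<theta>: "\<bar>b x \<theta> $ j - b x \<theta>' $ j\<bar> \<le> (C j * (1 + \<rho>) powr r j) * norm (\<theta> - \<theta>')"
        if "norm x \<le> \<rho>" "\<theta> \<in> \<Theta>" "\<theta>' \<in> \<Theta>" for j x \<theta> \<theta>'
      proof -
        have "(1 + norm x) powr r j \<le> (1 + \<rho>) powr r j"
          using that(1) Cr(2)[of j] by (intro powr_mono2) auto
        then have "C j * (1 + norm x) powr r j * norm (\<theta> - \<theta>') \<le> C j * (1 + \<rho>) powr r j * norm (\<theta> - \<theta>')"
          using Cr(1)[of j] by (intro mult_right_mono mult_left_mono) auto
        then show ?thesis by (rule order_trans[OF Cr(3)[OF that(2,3)]])
      qed
      have "uniformly_tight M F \<Theta> \<rho> (\<lambda>x \<theta> s t \<omega>. (b x \<theta> - b x \<theta>\<^sub>0) \<bullet> (L t \<omega> - L s \<omega>))"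
        by (rule levy_noise_uniformly_tight[OF F assms(2) b\<Theta> \<theta>\<^sub>0 bmeas \<theta>cont Gm0 G \<Lambda> lip\<theta>])
      then obtain A where
        A: "noise_bounded M F \<Theta> \<rho> (\<lambda>x \<theta> s t \<omega>. (b x \<theta> - b x \<theta>\<^sub>0) \<bullet> (L t \<omega> - L s \<omega>)) (e / 3) A"
        using e3 unfolding uniformly_tight_def by blast
      \<comment> \<open>\<open>c\<close> and \<open>d\<close> are the coefficients of \<epsilon> and
        \<open>1 / n\<close> in the final bound, the noise contributing \<open>2 * A\<close> to the
        former. Neither depends on \<open>n\<close> or \<epsilon>.\<close>
      define c where "c = 8 * Gm * K * H + 2 * A"
      define d where "d = 6 * Gm * K * (K * (1 + M0))"
      have main: "measure M {\<omega>\<in>space M. \<delta> < dist (est n \<epsilon> \<omega>) \<theta>\<^sub>0} < e"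
        if n: "1 \<le> n" "d / real n < \<kappa> / 2" and \<epsilon>: "0 < \<epsilon>" "\<epsilon> \<le> 1" "c * \<epsilon> < \<kappa> / 2" for n \<epsilon>
      proof -
        note S = sde[OF \<epsilon>(1,2), unfolded sde_solution_def]
        have t01: "real k / real n \<in> {0..1}" if "k \<le> n" for k using that n(1) by simp
        have "\<forall>k<n. X \<epsilon> (real k / real n) \<in> borel_measurable (F (real k / real n))"
          using S t01 unfolding adapted_on_def by auto
        then obtain E2 where E2: "E2 \<in> sets M" "emeasure M E2 \<le> ennreal (e / 3)"
          and noise: "AE \<omega> in M. \<omega> \<notin> E2 \<longrightarrow> (\<forall>k<n. norm (X \<epsilon> (real k / real n) \<omega>) \<le> \<rho>) \<longrightarrow>
              (\<forall>\<theta>\<in>\<Theta>. \<bar>\<Sum>k<n. (b (X \<epsilon> (real k / real n) \<omega>) \<theta> - b (X \<epsilon> (real k / real n) \<omega>) \<theta>\<^sub>0) \<bullet> (L (real (Suc k) / real n) \<omega> - L (real k / real n) \<omega>)\<bar> \<le> A)"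
          using noise_boundedE[OF A n(1), of "\<lambda>k. X \<epsilon> (real k / real n)"] unfolding noise_sum_def by blast
        have cad: "AE \<omega> in M. cadlag_on {0..1} (\<lambda>t. X \<epsilon> t \<omega>)"
          and eq: "AE \<omega> in M. \<forall>t\<in>{0..1}. (\<lambda>s. b (X \<epsilon> s \<omega>) \<theta>\<^sub>0) integrable_on {0..t} \<and>
              X \<epsilon> t \<omega> = x\<^sub>0 + integral {0..t} (\<lambda>s. b (X \<epsilon> s \<omega>) \<theta>\<^sub>0) + \<epsilon> *\<^sub>R L t \<omega>"
          using S by blast+
        let ?B = "{\<omega>\<in>space M. \<delta> < dist (est n \<epsilon> \<omega>) \<theta>\<^sub>0}"
        \<comment> \<open>Off \<open>E1\<close> the bound on \<open>L\<close> keeps the states in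
          the ball, and this activates the implication that holds off \<open>E2\<close>. The
          identification bound then contradicts the gap \<open>\<kappa>\<close>.\<close>
        have "AE \<omega> in M. \<omega> \<in> ?B \<longrightarrow> \<omega> \<in> E1 \<union> E2"
          using LR' noise cad eq
        proof (eventually_elim, intro impI)
          fix \<omega>
          assume LR1: "\<omega> \<notin> E1 \<longrightarrow> (\<forall>t\<in>{0..1}. norm (L t \<omega>) \<le> R')"
            and noise: "\<omega> \<notin> E2 \<longrightarrow> (\<forall>k<n. norm (X \<epsilon> (real k / real n) \<omega>) \<le> \<rho>) \<longrightarrow>
              (\<forall>\<theta>\<in>\<Theta>. \<bar>\<Sum>k<n. (b (X \<epsilon> (real k / real n) \<omega>) \<theta> - b (X \<epsilon> (real k / real n) \<omega>) \<theta>\<^sub>0) \<bullet> (L (real (Suc k) / real n) \<omega> - L (real k / real n) \<omega>)\<bar> \<le> A)"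
            and cad: "cadlag_on {0..1} (\<lambda>t. X \<epsilon> t \<omega>)"
            and eq: "\<forall>t\<in>{0..1}. (\<lambda>s. b (X \<epsilon> s \<omega>) \<theta>\<^sub>0) integrable_on {0..t} \<and>
              X \<epsilon> t \<omega> = x\<^sub>0 + integral {0..t} (\<lambda>s. b (X \<epsilon> s \<omega>) \<theta>\<^sub>0) + \<epsilon> *\<^sub>R L t \<omega>"
            and \<omega>B: "\<omega> \<in> ?B"
          show "\<omega> \<in> E1 \<union> E2"
          proof (rule ccontr)
            assume \<omega>: "\<omega> \<notin> E1 \<union> E2"
            have LR: "norm (L t \<omega>) \<le> R" if "t \<in> {0..1}" for t
              using LR1 \<omega> that by (auto simp: R_def intro: max.coboundedI1)
            have bdd: "bounded ((\<lambda>t. X \<epsilon> t \<omega>) ` {0..1})" by (rule cadlag_on_bounded[OF cad]) simp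
            have dev: "norm (X \<epsilon> t \<omega> - X0 t) \<le> \<epsilon> * H" if "t \<in> {0..1}" for t
              unfolding H_def
              by (rule sde_deviation_bound[where l="\<lambda>t. L t \<omega>" and x="\<lambda>t. X \<epsilon> t \<omega>", OF K lip[OF \<theta>\<^sub>0] ode \<epsilon>(1) bspec[OF eq] bdd LR that])
            have eH: "\<epsilon> * H \<le> H" using \<epsilon> H0 by (simp add: mult_left_le_one_le)
            have X\<rho>: "norm (X \<epsilon> (real k / real n) \<omega>) \<le> \<rho>" if "k < n" for k
              using norm_triangle_ineq[of "X0 (real k / real n)" "X \<epsilon> (real k / real n) \<omega> - X0 (real k / real n)"]
                dev[OF t01[OF less_imp_le[OF that]]] M0[OF t01[OF less_imp_le[OF that]]] eH by (simp add: \<rho>_def)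
            have ls: "is_arg_min (contrast b n \<epsilon> (\<lambda>t. X \<epsilon> t \<omega>)) (\<lambda>\<theta>. \<theta> \<in> \<Theta>) (est n \<epsilon> \<omega>)"
              using lse[OF n(1) \<epsilon>(1,2)] \<omega>B by (simp add: least_squares_estimator_def)
            then have \<theta>: "est n \<epsilon> \<omega> \<in> \<Theta>" by (simp add: is_arg_min_def)
            let ?S = "\<Sum>k<n. (b (X \<epsilon> (real k / real n) \<omega>) (est n \<epsilon> \<omega>) - b (X \<epsilon> (real k / real n) \<omega>) \<theta>\<^sub>0) \<bullet> (L (real (Suc k) / real n) \<omega> - L (real k / real n) \<omega>)"
            have "\<bar>?S\<bar> \<le> A" using noise \<omega> \<theta> X\<rho> by blast
            then have "2 * \<epsilon> * ?S \<le> 2 * \<epsilon> * A" using \<epsilon>(1) by (intro mult_left_mono) auto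
            moreover have "integral {0..1} (\<lambda>s. (norm (b (X0 s) (est n \<epsilon> \<omega>) - b (X0 s) \<theta>\<^sub>0))\<^sup>2)
               \<le> 8 * Gm * K * (\<epsilon> * H) + d / real n + 2 * \<epsilon> * ?S"
              unfolding Gm_def H_def d_def
              by (rule contrast_identification_bound[where l="\<lambda>t. L t \<omega>" and x="\<lambda>t. X \<epsilon> t \<omega>",
                    OF K lip growth ode M0 \<epsilon>(1,2) n(1) bspec[OF eq] bdd LR \<theta> \<theta>\<^sub>0 ls])
            moreover have "\<kappa> \<le> integral {0..1} (\<lambda>s. (norm (b (X0 s) (est n \<epsilon> \<omega>) - b (X0 s) \<theta>\<^sub>0))\<^sup>2)"
              using \<omega>B by (intro \<kappa>(2)[OF \<theta>]) auto
            moreover have "8 * Gm * K * (\<epsilon> * H) + 2 * \<epsilon> * A = c * \<epsilon>" by (simp add: c_def algebra_simps)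
            ultimately have "\<kappa> \<le> c * \<epsilon> + d / real n" by linarith
            then show False using n(2) \<epsilon>(3) by linarith
          qed
        qed
        then have "emeasure M ?B \<le> emeasure M (E1 \<union> E2)"
          using E1 E2 by (intro emeasure_mono_AE) auto
        also have "\<dots> \<le> emeasure M E1 + emeasure M E2" using E1 E2 by (intro emeasure_subadditive)
        also have "\<dots> \<le> ennreal (e / 3) + ennreal (e / 3)" by (intro add_mono E1 E2)
        also have "\<dots> = ennreal (2 * e / 3)" using e by (simp flip: ennreal_plus)
        finally have "measure M ?B \<le> 2 * e / 3" using e by (simp add: emeasure_eq_measure)
        then show ?thesis using e by simp
      qed
      \<comment> \<open>Each half of \<open>\<kappa>\<close> is spent on one of the two variables
        alone, so the conditions on \<open>n\<close> and on \<epsilon> separate, as the product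
        filter requires.\<close>
      have "\<forall>\<^sub>F n in sequentially. 1 \<le> n \<and> d / real n < \<kappa> / 2"
      proof (rule eventually_conj)
        have "(\<lambda>n. d / real n) \<longlonglongrightarrow> 0" by (rule lim_const_over_n)
        from order_tendstoD(2)[OF this, of "\<kappa> / 2"] \<kappa>(1) show "\<forall>\<^sub>F n in sequentially. d / real n < \<kappa> / 2" by simp
      qed (rule eventually_ge_at_top)
      moreover have "\<forall>\<^sub>F \<epsilon> in at_right 0. 0 < \<epsilon> \<and> \<epsilon> \<le> 1 \<and> c * \<epsilon> < \<kappa> / 2"
      proof (intro eventually_conj)
        show "\<forall>\<^sub>F \<epsilon>::real in at_right 0. 0 < \<epsilon>" by (rule eventually_at_right_less)
        show "\<forall>\<^sub>F \<epsilon>::real in at_right 0. \<epsilon> \<le> 1"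
          unfolding eventually_at_right_field by (intro exI[of _ 1]) auto
        have "((\<lambda>\<epsilon>. c * \<epsilon>) \<longlongrightarrow> c * 0) (at_right 0)" by (intro tendsto_intros)
        then have lim: "((\<lambda>\<epsilon>. c * \<epsilon>) \<longlongrightarrow> 0) (at_right 0)" by simp
        show "\<forall>\<^sub>F \<epsilon> in at_right 0. c * \<epsilon> < \<kappa> / 2"
          by (rule order_tendstoD(2)[OF lim]) (use \<kappa>(1) in simp)
      qed
      ultimately show "\<forall>\<^sub>F i in sequentially \<times>\<^sub>F at_right 0.
         dist (measure M {\<omega>\<in>space M. \<delta> < dist ((case i of (n, \<epsilon>) \<Rightarrow> est n \<epsilon>) \<omega>) \<theta>\<^sub>0}) 0 < e"
        unfolding eventually_prod_filter using main by (intro exI conjI) (assumption, assumption, auto)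
    qed
  qed
qed

end
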